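(* Let $F\subset E$ and consider the following conditions (limits as $n\to\infty$): (1) $k_n\uparrow\infty$ and $n^{-1}k_n\log n\to0$; (2) $0<m\le M<+\infty$ and $nk_n^{-1}\Delta_n\to0$; (K0) for all $n\ge1$, $\int_{E\times E}|K_n(x,t)|\,\nu(dx)\nu(dt)<\infty$; (K1) for all $(x_1,x_2)\in F\times F$, $\Gamma_n(x_1)\|K_n(x_2,\cdot)\|_1=o\left(\|K_n(x_1,\cdot)\|_2\|K_n(x_2,\cdot)\|_2\right)$; (K2) for all $(x_1,x_2)\in F\times F$, $\langle K_n(x_1,\cdot),K_n(x_2,\cdot)\rangle_2\left(\|K_n(x_1,\cdot)\|_2\|K_n(x_2,\cdot)\|_2\right)^{-1}\to\sigma(x_1,x_2)$; (K3) for all $x\in F$, $k_n^{-1/2}\|K_n(x,\cdot)\|_2^{-1}\|K_n(x,\cdot)\|_E\to0$; (K4) for all $x\in F$, $nk_n^{-1/2}\|K_n(x,\cdot)\|_2^{-1}\max\left(\Psi_n(x);\,\Delta_n\|K_n(x,\cdot)\|_1\right)\to0$; (K5) for all $x\in F$, $nk_n^{-1/2}\|K_n(x,\cdot)\|_2^{-1}\sum_{r=1}^{k_n}\left|\int_{I_{n,r}}\left(K_n(x,t)-K_n(x,x_{n,r})\right)\nu(dt)\right|\to0$. For $(x_1,\dots,x_p)\subset F$ put $\Sigma_{(x_1,\dots,x_p)}=[\sigma(x_i,x_j)]_{1\le i,j\le p}$. Then: a) Under (1), (2), (K0)--(K4), for all $(x_1,\dots,x_p)\subset F$, $$\left\{nck_n^{-1/2}\|K_n(x_j,\cdot)\|_2^{-1}\left(\widehat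 f_n(x_j)-f(x_j)\right):1\le j\le p\right\}\underset{\mathcal D}{\to}N\left(0,\Sigma_{(x_1,\dots,x_p)}\right).$$ b) If, moreover, (K5) holds, then for all $(x_1,\dots,x_p)\subset F$, $$\left\{nck_n^{-1/2}\|K_n(x_j,\cdot)\|_2^{-1}\left(\widetilde f_n(x_j)-f(x_j)\right):1\le j\le p\right\}\underset{\mathcal D}{\to}N\left(0,\Sigma_{(x_1,\dots,x_p)}\right).$$ c) The convergences in a) and b) also hold (under the respective assumptions) when $c$ is replaced by $\widehat c_n=N_n(S)/(n\widehat a_n)$, where $\widehat a_n=\sum_{r=1}^{k_n}\nu_{n,r}\left(1+\frac1{N_{n,r}}\right)Y^*_{n,r}$. Here $\underset{\mathcal D}{\to}$ denotes convergence in distribution and $N(0,\Sigma)$ the centered Gaussian distribution in $\mathbb{R}^p$ with covariance matrix $\Sigma$.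
   Context: $(E,\mathcal{E},\nu)$ is a probability space, $f:E\to\mathbb{R}^+$ is measurable, $S=\{(x,y)\in E\times\mathbb{R}:0\le y\le f(x)\}$, $c>0$ is a constant and $\lambda$ is Lebesgue measure on $\mathbb{R}^+$. For each $n\ge1$, $N_n$ is a Poisson point process on $E\times\mathbb{R}^+$ with intensity measure $nc(\nu\otimes\lambda)\mathbf{1}_S$, and $\{(X_{n,i},Y_{n,i}):1\le i\le N_n(S)\}$ is its set of points. $(k_n)$ is a sequence of positive integers and, for each $n$, $\{I_{n,r}:1\le r\le k_n\}$ is a measurable partition of $E$ such that $\nu_{n,r}:=\nu(I_{n,r})=k_n^{-1}$ for all $r\le k_n$. Put $D_{n,r}=\{(x,y):x\in I_{n,r},\,0\le y\le f(x)\}$, $N_{n,r}=N_n(D_{n,r})$, and $Y^*_{n,r}=\max\{Y_{n,i}:(X_{n,i},Y_{n,i})\in D_{n,r}\}$ if $N_{n,r}\ne0$, $Y^*_{n,r}=0$ otherwise. The convention $0\times\infty=0$ is used, so $(1+1/N_{n,r})Y^*_{n,r}=0$ when $N_{n,r}=0$ (and $\widehat c_n=0$ when $N_n(S)=0$). Let $m=\sup\{\alpha>0:\nu(\{f<\alpha\})=0\}$, $M=\inf\{\alpha>0:\nu(\{f>\alpha\})=0\}$, $m_{n,r}=\sup\{\alpha>0:\nu(\{f<\alpha\}\cap I_{n,r})=0\}$, $M_{n,r}=\inf\{\alpha>0:\nu(\{f>\alpha\}\cap I_{n,r})=0\}$ (essential infima and suprema of $f$ on $E$ and on $I_{n,r}$),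 and $\Delta_n=\max_{1\le r\le k_n}(M_{n,r}-m_{n,r})$. $K_n:E\times E\to\mathbb{R}$, $n\ge1$, is a sequence of measurable kernels. For $g:E\to\mathbb{R}$: $\|g\|_1=\int_E|g|\,d\nu$, $\|g\|_2=(\int_E g^2\,d\nu)^{1/2}$, $\|g\|_E=\sup_{t\in E}|g(t)|$, and $\langle\cdot,\cdot\rangle_2$ is the inner product of $L^2(E,\nu)$; for $x\in F$ these norms of $K_n(x,\cdot)$ are finite and $\|K_n(x,\cdot)\|_2>0$. For $x\in E$, $$\Gamma_n(x)=\max_{r\le k_n}\sup\{K_n(x,t)-K_n(x,s):(s,t)\in I_{n,r}\times I_{n,r}\},\qquad \Psi_n(x)=\left|\int_EK_n(x,t)f(t)\,\nu(dt)-f(x)\right|.$$ For each $n,r$ a point $x_{n,r}\in I_{n,r}$ is fixed. The estimators are $$\widehat f_n(x)=\sum_{r=1}^{k_n}\left(\int_{I_{n,r}}K_n(x,t)\,\nu(dt)\right)\left(1+\frac1{N_{n,r}}\right)Y^*_{n,r},\qquad \widetilde f_n(x)=\sum_{r=1}^{k_n}\nu_{n,r}K_n(x,x_{n,r})\left(1+\frac1{N_{n,r}}\right)Y^*_{n,r}.$$ *)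

theory Defs
  imports "HOL-Probability.Probability"
begin

section \<open>Poisson point processes\<close>

text \<open>
  A Poisson point process with intensity measure \<open>\<mu>\<close> is a random measure \<open>N\<close>: counts of measurable
  sets are Poisson (almost surely infinite where \<open>\<mu>\<close> is infinite), and counts of disjoint sets are
  independent. The Poisson weights are written out because \<open>poisson_pmf\<close> needs a positive rate;
  with \<open>0 ^ 0 = 1\<close> the formula below gives the point mass at \<open>0\<close> when \<open>\<mu> A = 0\<close>.
\<close>

definition poisson_point_process ::
    "'w measure \<Rightarrow> 'b measure \<Rightarrow> ('w \<Rightarrow> 'b measure) \<Rightarrow> bool" where
  "poisson_point_process P \<mu> N \<longleftrightarrow>
     (\<forall>\<omega>\<in>space P. sets (N \<omega>) = sets \<mu>) \<and>
     (\<forall>A\<in>sets \<mu>. (\<lambda>\<omega>. emeasure (N \<omega>) A) \<in> borel_measurable P) \<and>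
     (\<forall>A\<in>sets \<mu>. emeasure \<mu> A < \<infinity> \<longrightarrow>
        (\<forall>j::nat. measure P {\<omega>\<in>space P. emeasure (N \<omega>) A = of_nat j}
           = exp (- measure \<mu> A) * measure \<mu> A ^ j / fact j)) \<and>
     (\<forall>A\<in>sets \<mu>. emeasure \<mu> A = \<infinity> \<longrightarrow> (AE \<omega> in P. emeasure (N \<omega>) A = \<infinity>)) \<and>
     (\<forall>(A :: nat \<Rightarrow> 'b set) J. finite J \<longrightarrow> (\<forall>j\<in>J. A j \<in> sets \<mu>) \<longrightarrow> disjoint_family_on A J \<longrightarrow>
        prob_space.indep_vars P (\<lambda>_. borel) (\<lambda>j \<omega>. emeasure (N \<omega>) (A j)) J)"

text \<open>
  The set of indices \<open>1 \<le> i \<le> N(S)\<close> whose point \<open>(X i, Y i)\<close> lies in \<open>A\<close>, for one realization \<open>N\<close> of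
  the process. The inequality is in \<open>ennreal\<close>, so \<open>N(S) = \<infinity>\<close> allows every \<open>i \<ge> 1\<close>.
\<close>

definition point_indices ::
    "('a \<times> real) set \<Rightarrow> ('a \<times> real) measure \<Rightarrow> (nat \<Rightarrow> 'a) \<Rightarrow> (nat \<Rightarrow> real) \<Rightarrow> ('a \<times> real) set \<Rightarrow> nat set" where
  "point_indices S N X Y A = {i. 1 \<le> i \<and> of_nat i \<le> emeasure N S \<and> (X i, Y i) \<in> A}"

definition has_points ::
    "('a \<times> real) measure \<Rightarrow> ('a \<times> real) set \<Rightarrow> (nat \<Rightarrow> 'a) \<Rightarrow> (nat \<Rightarrow> real) \<Rightarrow> bool" where
  "has_points N S X Y \<longleftrightarrow>
     (\<forall>A\<in>sets N. emeasure N A = emeasure (count_space UNIV) (point_indices S N X Y A))"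

text \<open>The part of the region under the graph of \<open>f\<close> that lies over \<open>A\<close>.\<close>

definition subgraph :: "('a \<Rightarrow> real) \<Rightarrow> 'a set \<Rightarrow> ('a \<times> real) set" where
  "subgraph f A = {(x, y). x \<in> A \<and> 0 \<le> y \<and> y \<le> f x}"

definition intensity :: "'a measure \<Rightarrow> ('a \<Rightarrow> real) \<Rightarrow> real \<Rightarrow> nat \<Rightarrow> ('a \<times> real) measure" where
  "intensity \<nu> f c n =
     density (\<nu> \<Otimes>\<^sub>M restrict_space lborel {0..})
       (\<lambda>z. ennreal (real n * c) * indicator (subgraph f (space \<nu>)) z)"


section \<open>Essential bounds and quantities built from the kernel\<close>

text \<open>
  Both bounds are taken over positive \<open>\<alpha>\<close> and live in \<open>ennreal\<close>: the supremum of no \<open>\<alpha>\<close> is \<open>0\<close> and the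
  infimum of no \<open>\<alpha>\<close> is \<open>\<infinity>\<close>.
\<close>

definition ess_lower :: "'a measure \<Rightarrow> ('a \<Rightarrow> real) \<Rightarrow> 'a set \<Rightarrow> ennreal" where
  "ess_lower \<nu> f A = (SUP \<alpha> \<in> {\<alpha>::real. 0 < \<alpha> \<and> measure \<nu> ({x\<in>space \<nu>. f x < \<alpha>} \<inter> A) = 0}. ennreal \<alpha>)"

definition ess_upper :: "'a measure \<Rightarrow> ('a \<Rightarrow> real) \<Rightarrow> 'a set \<Rightarrow> ennreal" where
  "ess_upper \<nu> f A = (INF \<alpha> \<in> {\<alpha>::real. 0 < \<alpha> \<and> measure \<nu> ({x\<in>space \<nu>. f x > \<alpha>} \<inter> A) = 0}. ennreal \<alpha>)"

text \<open>
  \<open>\<Delta>\<^sub>n\<close>, for one partition \<open>I 1, \<dots>, I k\<close>. It is only meaningful when \<open>f\<close> is essentially bounded,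
  since \<open>enn2real \<infinity> = 0\<close>.
\<close>

definition max_osc :: "'a measure \<Rightarrow> ('a \<Rightarrow> real) \<Rightarrow> nat \<Rightarrow> (nat \<Rightarrow> 'a set) \<Rightarrow> real" where
  "max_osc \<nu> f k I =
     (MAX r \<in> {1..k}. enn2real (ess_upper \<nu> f (I r)) - enn2real (ess_lower \<nu> f (I r)))"

definition norm1 :: "'a measure \<Rightarrow> ('a \<Rightarrow> real) \<Rightarrow> real" where
  "norm1 \<nu> g = (\<integral>t. \<bar>g t\<bar> \<partial>\<nu>)"

definition norm2 :: "'a measure \<Rightarrow> ('a \<Rightarrow> real) \<Rightarrow> real" where
  "norm2 \<nu> g = sqrt (\<integral>t. (g t)\<^sup>2 \<partial>\<nu>)"

definition norm_sup :: "'a measure \<Rightarrow> ('a \<Rightarrow> real) \<Rightarrow> real" where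
  "norm_sup \<nu> g = (SUP t \<in> space \<nu>. \<bar>g t\<bar>)"

definition inner2 :: "'a measure \<Rightarrow> ('a \<Rightarrow> real) \<Rightarrow> ('a \<Rightarrow> real) \<Rightarrow> real" where
  "inner2 \<nu> g h = (\<integral>t. g t * h t \<partial>\<nu>)"

definition finite_norms :: "'a measure \<Rightarrow> ('a \<Rightarrow> real) \<Rightarrow> bool" where
  "finite_norms \<nu> g \<longleftrightarrow>
     integrable \<nu> g \<and> integrable \<nu> (\<lambda>t. (g t)\<^sup>2) \<and> bdd_above ((\<lambda>t. \<bar>g t\<bar>) ` space \<nu>)"

text \<open>\<open>\<Gamma>\<^sub>n(x)\<close> and \<open>\<Psi>\<^sub>n(x)\<close>.\<close>

definition kernel_osc :: "nat \<Rightarrow> (nat \<Rightarrow> 'a set) \<Rightarrow> ('a \<Rightarrow> 'a \<Rightarrow> real) \<Rightarrow> 'a \<Rightarrow> real" where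
  "kernel_osc k I K x = (MAX r \<in> {1..k}. SUP (s, t) \<in> I r \<times> I r. K x t - K x s)"

definition kernel_bias :: "'a measure \<Rightarrow> ('a \<Rightarrow> real) \<Rightarrow> ('a \<Rightarrow> 'a \<Rightarrow> real) \<Rightarrow> 'a \<Rightarrow> real" where
  "kernel_bias \<nu> f K x = \<bar>(\<integral>t. K x t * f t \<partial>\<nu>) - f x\<bar>"


section \<open>Estimators, for one realization of the process\<close>

text \<open>
  \<open>Y*\<^sub>n\<^sub>,\<^sub>r\<close>. The supremum is the maximum whenever the latter exists, in particular for finitely many
  points; \<open>Max\<close> is not used because it is unspecified on infinite sets, even on those with a maximum.
\<close>

definition cell_max ::
    "'a measure \<Rightarrow> ('a \<Rightarrow> real) \<Rightarrow> ('a \<times> real) measure \<Rightarrow> (nat \<Rightarrow> 'a) \<Rightarrow> (nat \<Rightarrow> real) \<Rightarrow> 'a set \<Rightarrow> real" where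
  "cell_max \<nu> f N X Y A =
     (if emeasure N (subgraph f A) = 0 then 0
      else (SUP i \<in> point_indices (subgraph f (space \<nu>)) N X Y (subgraph f A). Y i))"

text \<open>
  \<open>(1 + 1 / N\<^sub>n\<^sub>,\<^sub>r) Y*\<^sub>n\<^sub>,\<^sub>r\<close>. If \<open>N\<^sub>n\<^sub>,\<^sub>r = 0\<close> then \<open>cell_max\<close> is \<open>0\<close>, hence so is the product, in accordance
  with the convention \<open>0 \<times> \<infinity> = 0\<close>.
\<close>

definition corrected_max ::
    "'a measure \<Rightarrow> ('a \<Rightarrow> real) \<Rightarrow> ('a \<times> real) measure \<Rightarrow> (nat \<Rightarrow> 'a) \<Rightarrow> (nat \<Rightarrow> real) \<Rightarrow> 'a set \<Rightarrow> real" where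
  "corrected_max \<nu> f N X Y A = (1 + 1 / measure N (subgraph f A)) * cell_max \<nu> f N X Y A"

definition f_hat ::
    "'a measure \<Rightarrow> ('a \<Rightarrow> real) \<Rightarrow> nat \<Rightarrow> (nat \<Rightarrow> 'a set) \<Rightarrow> ('a \<Rightarrow> 'a \<Rightarrow> real) \<Rightarrow>
     ('a \<times> real) measure \<Rightarrow> (nat \<Rightarrow> 'a) \<Rightarrow> (nat \<Rightarrow> real) \<Rightarrow> 'a \<Rightarrow> real" where
  "f_hat \<nu> f k I K N X Y x =
     (\<Sum>r = 1..k. (LINT t:I r|\<nu>. K x t) * corrected_max \<nu> f N X Y (I r))"

definition f_tilde ::
    "'a measure \<Rightarrow> ('a \<Rightarrow> real) \<Rightarrow> nat \<Rightarrow> (nat \<Rightarrow> 'a set) \<Rightarrow> (nat \<Rightarrow> 'a) \<Rightarrow> ('a \<Rightarrow> 'a \<Rightarrow> real) \<Rightarrow>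
     ('a \<times> real) measure \<Rightarrow> (nat \<Rightarrow> 'a) \<Rightarrow> (nat \<Rightarrow> real) \<Rightarrow> 'a \<Rightarrow> real" where
  "f_tilde \<nu> f k I \<xi> K N X Y x =
     (\<Sum>r = 1..k. measure \<nu> (I r) * K x (\<xi> r) * corrected_max \<nu> f N X Y (I r))"

definition a_hat ::
    "'a measure \<Rightarrow> ('a \<Rightarrow> real) \<Rightarrow> nat \<Rightarrow> (nat \<Rightarrow> 'a set) \<Rightarrow>
     ('a \<times> real) measure \<Rightarrow> (nat \<Rightarrow> 'a) \<Rightarrow> (nat \<Rightarrow> real) \<Rightarrow> real" where
  "a_hat \<nu> f k I N X Y = (\<Sum>r = 1..k. measure \<nu> (I r) * corrected_max \<nu> f N X Y (I r))"

text \<open>When the process has no point in \<open>S\<close> the quotient is \<open>0 / 0 = 0\<close>, as the convention requires.\<close>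

definition c_hat ::
    "'a measure \<Rightarrow> ('a \<Rightarrow> real) \<Rightarrow> nat \<Rightarrow> nat \<Rightarrow> (nat \<Rightarrow> 'a set) \<Rightarrow>
     ('a \<times> real) measure \<Rightarrow> (nat \<Rightarrow> 'a) \<Rightarrow> (nat \<Rightarrow> real) \<Rightarrow> real" where
  "c_hat \<nu> f n k I N X Y =
     measure N (subgraph f (space \<nu>)) / (real n * a_hat \<nu> f k I N X Y)"


section \<open>Convergence in distribution to a centered Gaussian vector\<close>

text \<open>The normal law on the line with mean \<open>m\<close> and variance \<open>v \<ge> 0\<close>, degenerate if \<open>v = 0\<close>.\<close>

definition normal_law :: "real \<Rightarrow> real \<Rightarrow> real measure" where
  "normal_law m v = (if v = 0 then return borel m else density lborel (normal_density m (sqrt v)))"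

text \<open>
  \<open>\<mu>\<close> is \<open>N(0, C)\<close>: every linear functional has a centered, possibly degenerate, normal law under \<open>\<mu>\<close>,
  and \<open>C\<close> is the covariance matrix of \<open>\<mu>\<close>. The matrix \<open>C\<close> may be singular. For given \<open>C\<close> there is at
  most one such measure.
\<close>

definition centered_gaussian :: "real ^ 'p ^ 'p \<Rightarrow> (real ^ 'p::finite) measure \<Rightarrow> bool" where
  "centered_gaussian C \<mu> \<longleftrightarrow>
     sets \<mu> = sets borel \<and>
     (\<forall>v. \<exists>s\<ge>0. distr \<mu> borel (\<lambda>z. v \<bullet> z) = normal_law 0 s) \<and>
     (\<forall>i j. (\<integral>z. z $ i * z $ j \<partial>\<mu>) = C $ i $ j)"

definition converges_in_distribution ::
    "'w measure \<Rightarrow> (nat \<Rightarrow> 'w \<Rightarrow> 'b::topological_space) \<Rightarrow> 'b measure \<Rightarrow> bool" where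
  "converges_in_distribution P Z \<mu> \<longleftrightarrow>
     (\<forall>\<^sub>F n in sequentially. Z n \<in> borel_measurable P) \<and>
     (\<forall>g :: 'b \<Rightarrow> real. continuous_on UNIV g \<longrightarrow> bounded (range g) \<longrightarrow>
        (\<lambda>n. \<integral>\<omega>. g (Z n \<omega>) \<partial>P) \<longlonglongrightarrow> (\<integral>z. g z \<partial>\<mu>))"

definition converges_to_gaussian ::
    "'w measure \<Rightarrow> (nat \<Rightarrow> 'w \<Rightarrow> real ^ 'p::finite) \<Rightarrow> real ^ 'p ^ 'p \<Rightarrow> bool" where
  "converges_to_gaussian P Z C \<longleftrightarrow>
     (\<exists>\<mu>. centered_gaussian C \<mu> \<and> converges_in_distribution P Z \<mu>)"

end

(*
  Write th = n c / k_n and let h_r be the essential infimum of f on the cell I_r. Up to an expected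
  error of order Delta_n per cell, the corrected maximum over the cell may be computed from the points
  below height h_r only, and these form a Poisson process on a rectangle. There the area U_r above
  the highest point (scaled by n c) is a unit exponential variable truncated at th h_r, and

    th (1 + 1/N) Y* = th h_r - U_r + (th h_r - U_r) / N.

  The last quotient has mean 1 up to an exponentially small error, which cancels the bias of U_r, and
  its variance is of order 1 / (th h_r). The normalised error at x is therefore, up to terms that vanish
  in L1, the sum over r of w_r (E U_r - U_r), where w_r = sqrt(k_n) int_{I_r} K_n(x,.) / ||K_n(x,.)||_2.
  The U_r are independent, (K3) makes the weights uniformly small, and (K1), (K2) give the limits
  sigma(x_i, x_j) of the sums over r of products of weights, so that the characteristic functions
  converge to that of N(0, Sigma). A continuity theorem for characteristic functions on Euclidean
  spaces concludes. Replacing c by its estimator is harmless, since that estimator is consistent.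
*)

theory Submission
  imports Defs
begin

section \<open>Continuity theorem in Euclidean space\<close>

text \<open>The points of the process enter through an enumeration \<open>X\<close>,
  \<open>Y\<close> on which no measurability is imposed. Heights therefore become random variables
  only through counts: the highest point is at most t when the part above t has count 0, and
  measurability and independence are both derived from this. Cutting a cell at its essential infimum
  makes the law explicit: below it almost every vertical slice is complete, and the moments of the
  top gap on the event of j points are again Poisson weights, which is why the bias cancels up to
  exponential terms. Points above the cut appear with probability at most theta (H - h) and,
  independently of that event, change the corrected maximum by a mean of order 1 / theta + (H - h);
  the product explains the order Delta. These errors are not centred and are summed with absolute
  weights, of total size up to sqrt k, whereas the centred terms use independence and cost only the
  square sum. The limit covariance may be singular, so the Gaussian law is built from a matrix
  factor instead of a density.\<close>

inductive trig_poly :: "('v::real_inner \<Rightarrow> complex) \<Rightarrow> bool" where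
  exp: "trig_poly (\<lambda>x. a * iexp (v \<bullet> x))"
| add: "trig_poly g \<Longrightarrow> trig_poly h \<Longrightarrow> trig_poly (\<lambda>x. g x + h x)"

lemma trig_poly_const: "trig_poly (\<lambda>x. a)"
  using trig_poly.exp[of a 0] by simp

text \<open>Multiplication by one exponential only shifts every frequency by \<open>v\<close>;
  additivity in the other factor then gives closure under products.\<close>

lemma trig_poly_mult_exp:
  assumes "trig_poly g" shows "trig_poly (\<lambda>x. g x * (a * iexp (v \<bullet> x)))"
  using assms
proof induction
  case (exp b w)
  have "(\<lambda>x. b * iexp (w \<bullet> x) * (a * iexp (v \<bullet> x))) = (\<lambda>x. (b * a) * iexp ((w + v) \<bullet> x))"
    by (simp add: inner_add_left exp_add algebra_simps)
  then show ?case by (simp only: trig_poly.exp)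
next
  case (add g h)
  then show ?case by (simp add: trig_poly.add distrib_right)
qed

lemma trig_poly_mult:
  assumes "trig_poly h" "trig_poly g" shows "trig_poly (\<lambda>x. g x * h x)"
  using assms
proof induction
  case (exp a v)
  then show ?case by (rule trig_poly_mult_exp)
next
  case (add h1 h2)
  then show ?case by (simp add: trig_poly.add distrib_left)
qed

lemma trig_poly_sum:
  assumes "finite A" "\<And>i. i \<in> A \<Longrightarrow> trig_poly (g i)"
  shows "trig_poly (\<lambda>x. \<Sum>i\<in>A. g i x)"
  using assms by (induction A) (auto intro: trig_poly_const trig_poly.add)

lemma trig_poly_sin: "trig_poly (\<lambda>x. of_real (sin (v \<bullet> x)))"
proof -
  have "(\<lambda>x. complex_of_real (sin (v \<bullet> x)))
      = (\<lambda>x. (1 / (2 * \<i>)) * iexp (v \<bullet> x) + (- 1 / (2 * \<i>)) * iexp ((- v) \<bullet> x))"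
    by (auto simp: sin_exp_eq sin_of_real[symmetric] diff_divide_distrib right_diff_distrib)
  then show ?thesis by (simp only: trig_poly.add trig_poly.exp)
qed

text \<open>A sine is a combination of two exponentials, and trigonometric polynomials form an
  algebra. The coordinatewise sine maps the whole space into a cube, so polynomial approximation on
  a compact set becomes usable on the whole space.\<close>

lemma trig_poly_real_polynomial:
  fixes q :: "'v::euclidean_space \<Rightarrow> real"
  assumes "real_polynomial_function q"
  shows "trig_poly (\<lambda>x. of_real (q (\<Sum>b\<in>Basis. sin (t * (x \<bullet> b)) *\<^sub>R b)))"
  using assms
proof induction
  case (linear q)
  interpret bounded_linear q by fact
  have "trig_poly (\<lambda>x. \<Sum>b\<in>Basis. of_real (sin ((t *\<^sub>R b) \<bullet> x)) * of_real (q b))"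
    by (intro trig_poly_sum finite_Basis trig_poly_mult trig_poly_const trig_poly_sin)
  then show ?case by (simp add: sum scaleR inner_commute)
next
  case (const c) then show ?case by (rule trig_poly_const)
next
  case (add f g) then show ?case by (simp add: trig_poly.add)
next
  case (mult f g) then show ?case by (simp add: trig_poly_mult)
qed

lemma trig_poly_bounded_continuous:
  assumes "trig_poly g"
  shows "continuous_on UNIV g" "\<exists>B. \<forall>x. norm (g x) \<le> B"
proof -
  show "continuous_on UNIV g"
    using assms by induction (auto intro!: continuous_intros)
  show "\<exists>B. \<forall>x. norm (g x) \<le> B"
    using assms
  proof induction
    case (exp a v) then show ?case by (auto simp: norm_mult)
  next
    case (add g h) 
    then obtain B C where "\<forall>x. norm (g x) \<le> B" "\<forall>x. norm (h x) \<le> C" by auto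
    then have "\<forall>x. norm (g x + h x) \<le> B + C" by (auto intro!: norm_triangle_le add_mono)
    then show ?case by blast
  qed
qed

lemma trig_poly_integrable:
  fixes g :: "'v::euclidean_space \<Rightarrow> complex"
  assumes "trig_poly g" "prob_space M" "Z \<in> borel_measurable M"
  shows "integrable M (\<lambda>\<omega>. g (Z \<omega>))"
proof -
  interpret prob_space M by fact
  have [measurable]: "g \<in> borel_measurable borel"
    using trig_poly_bounded_continuous(1)[OF assms(1)] by (rule borel_measurable_continuous_onI)
  note [measurable] = assms(3)
  obtain B where "\<forall>x. norm (g x) \<le> B" using trig_poly_bounded_continuous(2)[OF assms(1)] ..
  then show ?thesis by (intro integrable_const_bound[of _ B]) auto
qed

lemma tendsto_trig_poly:
  fixes Z :: "nat \<Rightarrow> 'w \<Rightarrow> 'v::euclidean_space"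
  assumes "prob_space P" "\<And>n. Z n \<in> borel_measurable P" "prob_space \<mu>" "sets \<mu> = sets borel"
    and char: "\<And>v. (\<lambda>n. \<integral>\<omega>. iexp (v \<bullet> Z n \<omega>) \<partial>P) \<longlonglongrightarrow> (\<integral>z. iexp (v \<bullet> z) \<partial>\<mu>)"
    and "trig_poly g"
  shows "(\<lambda>n. \<integral>\<omega>. g (Z n \<omega>) \<partial>P) \<longlonglongrightarrow> (\<integral>z. g z \<partial>\<mu>)"
  using assms(6)
proof induction
  case (exp a v)
  then show ?case using tendsto_mult_left[OF char[of v]] by simp
next
  case (add g h)
  have i: "(\<lambda>z. z) \<in> borel_measurable \<mu>" using assms(4) by simp
  show ?case
    using tendsto_add[OF add.IH]
      trig_poly_integrable[OF add.hyps(1) assms(3) i] trig_poly_integrable[OF add.hyps(2) assms(3) i]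
      trig_poly_integrable[OF add.hyps(1) assms(1,2)] trig_poly_integrable[OF add.hyps(2) assms(1,2)]
    by simp
qed

text \<open>Tightness of the limit law in one direction. The cutoff is continuous instead of an
  indicator, so that its integrals along a convergent sequence converge too.\<close>

lemma tail_cutoff_vanishes:
  fixes \<mu> :: "'v::euclidean_space measure"
  assumes "prob_space \<mu>" "sets \<mu> = sets borel"
  shows "(\<lambda>R::nat. \<integral>z. min 1 (max 0 (\<bar>z \<bullet> b\<bar> - real R)) \<partial>\<mu>) \<longlonglongrightarrow> 0"
proof -
  interpret prob_space \<mu> by fact
  have [measurable]: "(\<lambda>z. z) \<in> borel_measurable \<mu>" using assms(2) by simp
  have "(\<lambda>R::nat. \<integral>z. min 1 (max 0 (\<bar>z \<bullet> b\<bar> - real R)) \<partial>\<mu>) \<longlonglongrightarrow> (\<integral>z. 0 \<partial>\<mu>)"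
  proof (rule integral_dominated_convergence[where w = "\<lambda>_. 1"])
    show "AE z in \<mu>. (\<lambda>R::nat. min 1 (max 0 (\<bar>z \<bullet> b\<bar> - real R))) \<longlonglongrightarrow> 0"
    proof (rule AE_I2)
      fix z
      have "eventually (\<lambda>R::nat. real R \<ge> \<bar>z \<bullet> b\<bar>) sequentially"
        by (meson eventually_sequentiallyI nat_ceiling_le_eq)
      then show "(\<lambda>R::nat. min 1 (max 0 (\<bar>z \<bullet> b\<bar> - real R))) \<longlonglongrightarrow> 0"
        by (intro tendsto_eventually) (auto elim!: eventually_mono)
    qed
  qed auto
  then show ?thesis by simp
qed

text \<open>On a large box \<open>g\<close> is a continuous function of sines of the coordinates,
  which Stone-Weierstrass replaces by a trigonometric polynomial; for these the convergence is
  linear in the hypothesis. Outside the box the error is bounded by a multiple of the cutoffs, whose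
  integrals are controlled by the one-dimensional continuity theorem applied to projections.\<close>

theorem levy_continuity_euclidean:
  fixes Z :: "nat \<Rightarrow> 'w \<Rightarrow> 'v::euclidean_space"
  assumes P: "prob_space P" and Z: "\<And>n. Z n \<in> borel_measurable P"
    and \<mu>: "prob_space \<mu>" "sets \<mu> = sets borel"
    and char: "\<And>v. (\<lambda>n. \<integral>\<omega>. iexp (v \<bullet> Z n \<omega>) \<partial>P) \<longlonglongrightarrow> (\<integral>z. iexp (v \<bullet> z) \<partial>\<mu>)"
  shows "converges_in_distribution P Z \<mu>"
proof -
  interpret P: prob_space P by fact
  interpret M: prob_space \<mu> by fact
  note [measurable] = Z
  have idm[measurable]: "(\<lambda>z. z) \<in> borel_measurable \<mu>" using \<mu>(2) by simp
  define \<phi> where "\<phi> R b z = min 1 (max 0 (\<bar>z \<bullet> b\<bar> - R))" for R :: real and b z :: 'v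
  have \<phi>m[measurable]: "\<phi> R b \<in> borel_measurable borel" for R b
    unfolding \<phi>_def by measurable
  have \<phi>_bd: "0 \<le> \<phi> R b z" "\<phi> R b z \<le> 1" for R b z by (auto simp: \<phi>_def)
  have \<phi>iP: "integrable P (\<lambda>\<omega>. \<phi> R b (Z n \<omega>))" for R b n
    using \<phi>_bd by (intro P.integrable_const_bound[of _ 1]) auto
  have \<phi>i\<mu>: "integrable \<mu> (\<lambda>z. \<phi> R b z)" for R b
    using \<phi>_bd measurable_compose[OF idm \<phi>m] by (intro M.integrable_const_bound[of _ 1]) auto
  have \<phi>_lim: "(\<lambda>n. \<integral>\<omega>. \<phi> R b (Z n \<omega>) \<partial>P) \<longlonglongrightarrow> (\<integral>z. \<phi> R b z \<partial>\<mu>)" for R b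
  proof -
    \<comment> \<open>The projection onto \<open>b\<close> has convergent characteristic functions,
      so the one-dimensional theorem carries the cutoff to the limit.\<close>
    let ?D = "\<lambda>n. distr P borel (\<lambda>\<omega>. Z n \<omega> \<bullet> b)" and ?E = "distr \<mu> borel (\<lambda>z. z \<bullet> b)"
    have D: "real_distribution (?D n)" for n by (intro P.real_distribution_distr) simp
    have E: "real_distribution ?E" by (intro M.real_distribution_distr) simp
    have "weak_conv_m ?D ?E"
    proof (rule levy_continuity[OF D E])
      fix t
      show "(\<lambda>n. char (?D n) t) \<longlonglongrightarrow> char ?E t"
        using char[of "t *\<^sub>R b"] by (simp add: char_def integral_distr inner_commute)
    qed
    have "(\<lambda>n. \<integral>x. min 1 (max 0 (\<bar>x\<bar> - R)) \<partial>?D n) \<longlonglongrightarrow> (\<integral>x. min 1 (max 0 (\<bar>x\<bar> - R)) \<partial>?E)"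
      by (rule weak_conv_imp_integral_bdd_continuous_conv[OF D E \<open>weak_conv_m ?D ?E\<close>, of _ 1])
        (auto intro!: continuous_intros)
    then show ?thesis by (simp add: integral_distr \<phi>_def)
  qed
  have "(\<lambda>n. \<integral>\<omega>. g (Z n \<omega>) \<partial>P) \<longlonglongrightarrow> (\<integral>z. g z \<partial>\<mu>)"
    if g: "continuous_on UNIV g" "bounded (range g)" for g :: "'v \<Rightarrow> real"
  proof (rule LIMSEQ_I)
    fix r :: real assume "0 < r"
    obtain B where B: "\<And>x. \<bar>g x\<bar> \<le> B" "B > 0"
      using g(2) by (auto simp: bounded_pos)
    have gm[measurable]: "g \<in> borel_measurable borel" using g(1) by (rule borel_measurable_continuous_onI)
    \<comment> \<open>The pieces of the estimate add up to less than 3 e + 4 B e, hence to less than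
      r.\<close>
    define e where "e = r / (4 + 4 * B)"
    have e: "0 < e" using \<open>0 < r\<close> B by (simp add: e_def)
    have "(\<lambda>R::nat. \<Sum>b\<in>Basis. \<integral>z. \<phi> R b z \<partial>\<mu>) \<longlonglongrightarrow> (\<Sum>b\<in>(Basis :: 'v set). 0)"
      unfolding \<phi>_def by (intro tendsto_sum tail_cutoff_vanishes \<mu>)
    then have "eventually (\<lambda>R::nat. (\<Sum>b\<in>Basis. \<integral>z. \<phi> R b z \<partial>\<mu>) < e) sequentially"
      using e by (intro order_tendstoD(2)) auto
    then obtain R :: nat where R: "(\<Sum>b\<in>Basis. \<integral>z. \<phi> R b z \<partial>\<mu>) < e"
      by (auto simp: eventually_sequentially)
    \<comment> \<open>Division by this scale sends [-(R + 1), R + 1] onto [-pi/2, pi/2], where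
      arcsin inverts sin.\<close>
    define L where "L = 2 * (real R + 1) / pi"
    have L: "L > 0" by (simp add: L_def)
    define s where "s x = (\<Sum>b\<in>Basis. sin (inverse L * (x \<bullet> b)) *\<^sub>R b)" for x :: 'v
    \<comment> \<open>\<open>G\<close> undoes the folding \<open>s\<close> on the box; being a value
      of \<open>g\<close>, it stays bounded by B everywhere.\<close>
    define G where "G y = g (\<Sum>b\<in>Basis. (L * arcsin (y \<bullet> b)) *\<^sub>R b)" for y :: 'v
    have s_cube: "s x \<in> cbox (- One) One" for x by (simp add: s_def mem_box)
    have contG: "continuous_on (cbox (- One) One) G"
      unfolding G_def
      by (rule continuous_on_compose2[OF g(1)]) (auto intro!: continuous_intros simp: mem_box)
    obtain q where q: "real_polynomial_function q" "\<And>y. y \<in> cbox (- One) One \<Longrightarrow> \<bar>G y - q y\<bar> < e"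
      using Stone_Weierstrass_real_polynomial_function[OF compact_cbox contG e] by blast
    have agree: "G (s x) = g x" if "\<And>b. b \<in> Basis \<Longrightarrow> \<bar>x \<bullet> b\<bar> \<le> real R + 1" for x
    proof -
      have "L * arcsin (s x \<bullet> b) = x \<bullet> b" if b: "b \<in> Basis" for b
      proof -
        have 1: "\<bar>inverse L * (x \<bullet> b)\<bar> \<le> pi / 2"
          using mult_left_mono[OF \<open>\<And>b. b \<in> Basis \<Longrightarrow> \<bar>x \<bullet> b\<bar> \<le> real R + 1\<close>[OF b], of pi] L
          by (simp add: L_def abs_mult field_simps)
        have "arcsin (sin (inverse L * (x \<bullet> b))) = inverse L * (x \<bullet> b)"
          by (intro arcsin_sin) (use 1 in \<open>auto simp: abs_le_iff\<close>)
        then show ?thesis using b L by (simp add: s_def)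
      qed
      then show ?thesis by (simp add: G_def euclidean_representation)
    qed
    have key: "\<bar>g x - q (s x)\<bar> \<le> e + 2 * B * (\<Sum>b\<in>Basis. \<phi> R b x)" for x
    proof (cases "\<forall>b\<in>Basis. \<bar>x \<bullet> b\<bar> \<le> real R + 1")
      case True
      then have "G (s x) = g x" by (intro agree) auto
      then have "\<bar>g x - q (s x)\<bar> \<le> e" using q(2)[OF s_cube[of x]] by simp
      moreover have "0 \<le> 2 * B * (\<Sum>b\<in>Basis. \<phi> R b x)"
        using B \<phi>_bd by (intro mult_nonneg_nonneg sum_nonneg) auto
      ultimately show ?thesis by linarith
    next
      case False
      \<comment> \<open>Outside the box one cutoff already equals 1, which pays for the trivial
        bound 2 B.\<close>
      then obtain b where b: "b \<in> Basis" "\<phi> R b x = 1" by (force simp: \<phi>_def)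
      have "1 \<le> (\<Sum>b\<in>Basis. \<phi> R b x)"
        using member_le_sum[OF b(1), of "\<lambda>b. \<phi> R b x"] \<phi>_bd b by simp
      then have "2 * B \<le> 2 * B * (\<Sum>b\<in>Basis. \<phi> R b x)" using B by simp
      moreover have "\<bar>g x - q (s x)\<bar> \<le> \<bar>g x\<bar> + \<bar>G (s x)\<bar> + \<bar>G (s x) - q (s x)\<bar>" by linarith
      moreover have "\<bar>g x\<bar> \<le> B" "\<bar>G (s x)\<bar> \<le> B" using B by (auto simp: G_def)
      ultimately show ?thesis using q(2)[OF s_cube[of x]] by linarith
    qed
    define Q where "Q x = complex_of_real (q (s x))" for x
    have tQ: "trig_poly Q"
      unfolding Q_def s_def by (rule trig_poly_real_polynomial) fact
    have qcond: "integrable M (\<lambda>\<omega>. q (s (Y \<omega>)))" "(\<integral>\<omega>. Q (Y \<omega>) \<partial>M) = of_real (\<integral>\<omega>. q (s (Y \<omega>)) \<partial>M)"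
      if "prob_space M" "Y \<in> borel_measurable M" for M :: "'b measure" and Y
    proof -
      show i: "integrable M (\<lambda>\<omega>. q (s (Y \<omega>)))"
        using integrable_Re[OF trig_poly_integrable[OF tQ that]] by (simp add: Q_def)
      show "(\<integral>\<omega>. Q (Y \<omega>) \<partial>M) = of_real (\<integral>\<omega>. q (s (Y \<omega>)) \<partial>M)"
        by (simp add: Q_def)
    qed
    have bound: "\<bar>(\<integral>\<omega>. g (Y \<omega>) \<partial>M) - (\<integral>\<omega>. q (s (Y \<omega>)) \<partial>M)\<bar>
        \<le> e + 2 * B * (\<Sum>b\<in>Basis. \<integral>\<omega>. \<phi> R b (Y \<omega>) \<partial>M)"
      if "prob_space M" "Y \<in> borel_measurable M" for M :: "'b measure" and Y
    proof -
      interpret prob_space M by fact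
      note [measurable] = that(2)
      have ig: "integrable M (\<lambda>\<omega>. g (Y \<omega>))" using B by (intro integrable_const_bound[of _ B]) auto
      have i\<phi>: "integrable M (\<lambda>\<omega>. \<phi> R b (Y \<omega>))" for b
        using \<phi>_bd by (intro integrable_const_bound[of _ 1]) auto
      have "\<bar>(\<integral>\<omega>. g (Y \<omega>) \<partial>M) - (\<integral>\<omega>. q (s (Y \<omega>)) \<partial>M)\<bar> = \<bar>\<integral>\<omega>. g (Y \<omega>) - q (s (Y \<omega>)) \<partial>M\<bar>"
        using ig qcond(1)[OF that] by simp
      also have "\<dots> \<le> (\<integral>\<omega>. \<bar>g (Y \<omega>) - q (s (Y \<omega>))\<bar> \<partial>M)" by (rule integral_abs_bound)
      also have "\<dots> \<le> (\<integral>\<omega>. e + 2 * B * (\<Sum>b\<in>Basis. \<phi> R b (Y \<omega>)) \<partial>M)"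
        using ig qcond(1)[OF that] i\<phi> key by (intro integral_mono) auto
      also have "\<dots> = e + 2 * B * (\<Sum>b\<in>Basis. \<integral>\<omega>. \<phi> R b (Y \<omega>) \<partial>M)"
        using i\<phi> by (simp add: prob_space)
      finally show ?thesis .
    qed
    have "(\<lambda>n. \<integral>\<omega>. Q (Z n \<omega>) \<partial>P) \<longlonglongrightarrow> (\<integral>z. Q z \<partial>\<mu>)"
      by (rule tendsto_trig_poly[OF P Z \<mu> char tQ])
    then have "(\<lambda>n. \<integral>\<omega>. q (s (Z n \<omega>)) \<partial>P) \<longlonglongrightarrow> (\<integral>z. q (s z) \<partial>\<mu>)"
      using qcond(2)[OF P Z] qcond(2)[OF \<mu>(1) idm] by (simp add: tendsto_of_real_iff)
    from LIMSEQ_D[OF this e] obtain n1 where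
      n1: "\<And>n. n \<ge> n1 \<Longrightarrow> \<bar>(\<integral>\<omega>. q (s (Z n \<omega>)) \<partial>P) - (\<integral>z. q (s z) \<partial>\<mu>)\<bar> < e" by auto
    have "(\<lambda>n. \<Sum>b\<in>Basis. \<integral>\<omega>. \<phi> R b (Z n \<omega>) \<partial>P) \<longlonglongrightarrow> (\<Sum>b\<in>Basis. \<integral>z. \<phi> R b z \<partial>\<mu>)"
      by (intro tendsto_sum \<phi>_lim)
    from order_tendstoD(2)[OF this R] obtain n2 where
      n2: "\<And>n. n \<ge> n2 \<Longrightarrow> (\<Sum>b\<in>Basis. \<integral>\<omega>. \<phi> R b (Z n \<omega>) \<partial>P) < e"
      by (auto simp: eventually_sequentially)
    show "\<exists>no. \<forall>n\<ge>no. norm ((\<integral>\<omega>. g (Z n \<omega>) \<partial>P) - (\<integral>z. g z \<partial>\<mu>)) < r"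
    proof (intro exI[of _ "max n1 n2"] allI impI)
      fix n assume n: "max n1 n2 \<le> n"
      have "2 * B * (\<Sum>b\<in>Basis. \<integral>\<omega>. \<phi> R b (Z n \<omega>) \<partial>P) < 2 * B * e"
        "2 * B * (\<Sum>b\<in>Basis. \<integral>z. \<phi> R b z \<partial>\<mu>) < 2 * B * e"
        using n2[of n] n B R by auto
      note less = this
      have "\<bar>(\<integral>\<omega>. g (Z n \<omega>) \<partial>P) - (\<integral>\<omega>. q (s (Z n \<omega>)) \<partial>P)\<bar> < e + 2 * B * e"
        using bound[OF P Z, of n] less(1) by linarith
      moreover have "\<bar>(\<integral>z. g z \<partial>\<mu>) - (\<integral>z. q (s z) \<partial>\<mu>)\<bar> < e + 2 * B * e"
        using bound[OF \<mu>(1) idm] less(2) by linarith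
      ultimately have "\<bar>(\<integral>\<omega>. g (Z n \<omega>) \<partial>P) - (\<integral>z. g z \<partial>\<mu>)\<bar> < 3 * e + 4 * B * e"
        using n1[of n] n by simp
      also have "\<dots> \<le> (4 + 4 * B) * e" using e by (simp add: algebra_simps)
      also have "\<dots> = r" using B by (simp add: e_def)
      finally show "norm ((\<integral>\<omega>. g (Z n \<omega>) \<partial>P) - (\<integral>z. g z \<partial>\<mu>)) < r" by simp
    qed
  qed
  then show ?thesis using Z unfolding converges_in_distribution_def by (simp add: always_eventually)
qed

section \<open>Gaussian vectors\<close>

text \<open>Symmetric elimination of one index at a time: a Cholesky factorisation that tolerates
  zero pivots.\<close>

lemma psd_factor:
  fixes S :: "'p \<Rightarrow> 'p \<Rightarrow> real"
  assumes "finite J" "\<And>i j. i \<in> J \<Longrightarrow> j \<in> J \<Longrightarrow> S i j = S j i"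
    and "\<And>v. 0 \<le> (\<Sum>i\<in>J. \<Sum>j\<in>J. v i * v j * S i j)"
  shows "\<exists>a. \<forall>i\<in>J. \<forall>j\<in>J. S i j = (\<Sum>l\<in>J. a i l * a j l)"
  using assms
proof (induction J arbitrary: S)
  case empty
  then show ?case by simp
next
  case (insert q J)
  note sym = insert.prems(1) and psd = insert.prems(2)
  define d where "d = S q q"
  \<comment> \<open>The Schur complement. For a zero pivot the quotient is 0 by x / 0 = 0, which is
    right because the whole row vanishes then (\<open>zero\<close>).\<close>
  define S' where "S' i j = S i j - S i q * S q j / d" for i j
  have expand: "(\<Sum>i\<in>insert q J. \<Sum>j\<in>insert q J. v i * v j * S i j)
      = (v q)\<^sup>2 * d + 2 * v q * (\<Sum>i\<in>J. v i * S i q) + (\<Sum>i\<in>J. \<Sum>j\<in>J. v i * v j * S i j)" for v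
  proof -
    have "(\<Sum>j\<in>J. v q * v j * S q j) = v q * (\<Sum>i\<in>J. v i * S i q)"
      unfolding sum_distrib_left using sym by (intro sum.cong) auto
    moreover have "(\<Sum>i\<in>J. v i * v q * S i q) = v q * (\<Sum>i\<in>J. v i * S i q)"
      unfolding sum_distrib_left by (intro sum.cong) auto
    ultimately show ?thesis
      using insert.hyps by (simp add: sum.distrib d_def power2_eq_square)
  qed
  have d0: "0 \<le> d"
  proof -
    have z: "(\<Sum>i\<in>J. of_bool (i = q) * S i q) = 0"
      "(\<Sum>i\<in>J. \<Sum>j\<in>J. of_bool (i = q) * of_bool (j = q) * S i j) = 0"
      using insert.hyps by (auto intro!: sum.neutral)
    show ?thesis using psd[of "\<lambda>i. of_bool (i = q)"] unfolding expand z by simp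
  qed
  have zero: "S i q = 0" if "d = 0" "i \<in> J" for i
  proof (rule ccontr)
    assume ne: "S i q \<noteq> 0"
    \<comment> \<open>With this t one has 2 t S i q + S i i = -1, so the form would be negative at
      v.\<close>
    define t where "t = - (S i i + 1) / (2 * S i q)"
    define v where "v j = (if j = q then t else of_bool (j = i))" for j
    have v: "v q = t" "\<And>j. j \<in> J \<Longrightarrow> v j = of_bool (j = i)" using insert.hyps by (auto simp: v_def)
    have "(\<Sum>j\<in>J. v j * S j q) = (\<Sum>j\<in>J. if j = i then S j q else 0)"
      by (intro sum.cong) (auto simp: v)
    then have "(\<Sum>j\<in>J. v j * S j q) = S i q"
      using that(2) insert.hyps(1) by simp
    moreover have "(\<Sum>k\<in>J. \<Sum>j\<in>J. v k * v j * S k j)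
        = (\<Sum>k\<in>J. if k = i then (\<Sum>j\<in>J. if j = i then S k j else 0) else 0)"
      by (intro sum.cong) (auto simp: v intro!: sum.cong)
    then have "(\<Sum>k\<in>J. \<Sum>j\<in>J. v k * v j * S k j) = S i i"
      using that(2) insert.hyps(1) by simp
    ultimately have "0 \<le> 2 * t * S i q + S i i"
      using psd[of v] that(1) unfolding expand v(1) by simp
    then show False using ne by (simp add: t_def field_simps)
  qed
  have "\<exists>a. \<forall>i\<in>J. \<forall>j\<in>J. S' i j = (\<Sum>l\<in>J. a i l * a j l)"
  proof (rule insert.IH)
    show "S' i j = S' j i" if "i \<in> J" "j \<in> J" for i j
      using sym[of i j] sym[of i q] sym[of j q] that by (simp add: S'_def)
    fix v :: "'p \<Rightarrow> real"
    define \<beta> where "\<beta> = (\<Sum>i\<in>J. v i * S i q)"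
    \<comment> \<open>Completing the square: with this coordinate at q the form of \<open>S\<close>
      at \<open>w\<close> equals the form of \<open>S'\<close> at \<open>v\<close>. For d = 0 the
      new coordinate is 0 and both are the form of \<open>S\<close>.\<close>
    define w where "w j = (if j = q then - \<beta> / d else v j)" for j
    have w: "w q = - \<beta> / d" "\<And>j. j \<in> J \<Longrightarrow> w j = v j" using insert.hyps by (auto simp: w_def)
    have "(\<Sum>i\<in>J. \<Sum>j\<in>J. v i * v j * S' i j)
       = (\<Sum>i\<in>J. \<Sum>j\<in>J. v i * v j * S i j) - (\<Sum>i\<in>J. \<Sum>j\<in>J. v i * S i q * (v j * S j q)) / d"
      unfolding sum_divide_distrib sum_subtractf[symmetric]
      using sym by (intro sum.cong) (auto simp: S'_def algebra_simps)
    also have "(\<Sum>i\<in>J. \<Sum>j\<in>J. v i * S i q * (v j * S j q)) = \<beta> * \<beta>"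
      by (simp add: \<beta>_def sum_product)
    also have "(\<Sum>i\<in>J. \<Sum>j\<in>J. v i * v j * S i j) - \<beta> * \<beta> / d
        = (\<Sum>i\<in>insert q J. \<Sum>j\<in>insert q J. w i * w j * S i j)"
      unfolding expand using w by (simp add: \<beta>_def[symmetric] power2_eq_square)
    also have "\<dots> \<ge> 0" by (rule psd)
    finally show "0 \<le> (\<Sum>i\<in>J. \<Sum>j\<in>J. v i * v j * S' i j)" .
  qed
  then obtain a' where a': "\<And>i j. i \<in> J \<Longrightarrow> j \<in> J \<Longrightarrow> S' i j = (\<Sum>l\<in>J. a' i l * a' j l)" by blast
  \<comment> \<open>Column q carries the eliminated row divided by sqrt d; the other columns factor
    the complement and vanish in row q.\<close>
  define a where "a i l = (if l = q then (if i = q then sqrt d else S i q / sqrt d)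
      else if i = q then 0 else a' i l)" for i l
  have a: "(\<Sum>l\<in>insert q J. a i l * a j l) = a i q * a j q + (\<Sum>l\<in>J. a i l * a j l)" for i j
    using insert.hyps by simp
  have aJ: "(\<Sum>l\<in>J. a i l * a j l) = (if i = q \<or> j = q then 0 else S' i j)"
    if "i \<in> insert q J" "j \<in> insert q J" for i j
    using that insert.hyps a' by (auto simp: a_def intro!: sum.neutral sum.cong)
  have "S i j = (\<Sum>l\<in>insert q J. a i l * a j l)" if ij: "i \<in> insert q J" "j \<in> insert q J" for i j
  proof -
    have aq: "a i q * sqrt d = S i q" if "i \<in> insert q J" for i
      using that d0 zero by (cases "d = 0") (auto simp: a_def d_def)
    consider "i = q" | "j = q" | "i \<noteq> q" "j \<noteq> q" by blast
    then show ?thesis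
    proof cases
      case 1
      then show ?thesis unfolding a aJ[OF ij] using aq[OF ij(2)] sym[OF ij] by (simp add: a_def mult.commute)
    next
      case 2
      then show ?thesis unfolding a aJ[OF ij] using aq[OF ij(1)] by (simp add: a_def)
    next
      case 3
      then show ?thesis unfolding a aJ[OF ij] using d0 sym[OF ij(2), of q]
        by (simp add: a_def S'_def)
    qed
  qed
  then show ?case by blast
qed

text \<open>A scaled standard normal variable also covers the degenerate case, so that the
  characteristic function and the moments below avoid a case distinction.\<close>

lemma normal_law_eq_distr:
  assumes "0 \<le> s"
  shows "normal_law 0 s = distr std_normal_distribution borel (\<lambda>x. sqrt s * x)"
proof (cases "s = 0")
  case True
  interpret real_distribution std_normal_distribution by (rule real_dist_normal_dist)
  show ?thesis using True distr_const[of 0 borel] by (simp add: normal_law_def)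
next
  case False
  interpret real_distribution std_normal_distribution by (rule real_dist_normal_dist)
  have "distributed std_normal_distribution lborel (\<lambda>x. x) std_normal_density"
    by (simp add: distributed_def distr_id2)
  from normal_density_affine[OF this, of "sqrt s" 0] False assms
  have "distributed std_normal_distribution lborel (\<lambda>x. sqrt s * x) (normal_density 0 (sqrt s))"
    by simp
  from distributed_distr_eq_density[OF this] False show ?thesis
    by (simp add: normal_law_def cong: distr_cong)
qed

lemma char_normal_law:
  assumes "0 \<le> s" shows "char (normal_law 0 s) t = exp (- s * t\<^sup>2 / 2)"
proof -
  have "char (normal_law 0 s) t = char std_normal_distribution (t * sqrt s)"
    by (simp add: normal_law_eq_distr assms char_def integral_distr mult.assoc)
  then show ?thesis using assms
    by (simp add: char_std_normal_distribution power_mult_distrib mult.commute)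
qed

lemma normal_law_second_moment:
  assumes "0 \<le> s"
  shows "integrable (normal_law 0 s) (\<lambda>x. x\<^sup>2)" "(\<integral>x. x\<^sup>2 \<partial>normal_law 0 s) = s"
proof -
  have *: "(\<integral>x. x\<^sup>2 \<partial>std_normal_distribution) = 1"
    using std_normal_distribution_even_moments[of 1] by (simp add: fact_numeral)
  show "integrable (normal_law 0 s) (\<lambda>x. x\<^sup>2)" "(\<integral>x. x\<^sup>2 \<partial>normal_law 0 s) = s"
    using assms integrable_std_normal_distribution_moment[of 2] *
    by (simp_all add: normal_law_eq_distr integrable_distr_eq integral_distr power_mult_distrib)
qed

text \<open>A law on the line is determined by its characteristic function, so every projection is
  normal. The covariances follow from the second moments of projections by polarisation with the sum
  and the difference of two coordinate vectors.\<close>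

lemma centered_gaussianI:
  fixes \<mu> :: "(real ^ 'p::finite) measure"
  assumes "prob_space \<mu>" and sets: "sets \<mu> = sets borel" and sym: "\<And>i j. C $ i $ j = C $ j $ i"
    and psd: "\<And>v. 0 \<le> v \<bullet> (C *v v)"
    and char: "\<And>v. (\<integral>z. iexp (v \<bullet> z) \<partial>\<mu>) = exp (- (v \<bullet> (C *v v)) / 2)"
  shows "centered_gaussian C \<mu>"
proof -
  interpret prob_space \<mu> by fact
  have [measurable]: "(\<lambda>z. z) \<in> borel_measurable \<mu>" using sets by simp
  have law: "distr \<mu> borel (\<lambda>z. v \<bullet> z) = normal_law 0 (v \<bullet> (C *v v))" for v
  proof (rule Levy_uniqueness)
    show "real_distribution (distr \<mu> borel (\<lambda>z. v \<bullet> z))" by (rule real_distribution_distr) simp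
    show "real_distribution (normal_law 0 (v \<bullet> (C *v v)))"
      unfolding normal_law_eq_distr[OF psd]
      by (intro prob_space.real_distribution_distr real_distribution.axioms(1) real_dist_normal_dist) simp
    show "char (distr \<mu> borel (\<lambda>z. v \<bullet> z)) = char (normal_law 0 (v \<bullet> (C *v v)))"
    proof
      fix t
      have "char (distr \<mu> borel (\<lambda>z. v \<bullet> z)) t = (\<integral>z. iexp ((t *\<^sub>R v) \<bullet> z) \<partial>\<mu>)"
        by (simp add: char_def integral_distr)
      also have "\<dots> = exp (- (v \<bullet> (C *v v)) * t\<^sup>2 / 2)"
        unfolding char by (simp add: matrix_vector_mult_scaleR power2_eq_square mult_ac)
      finally show "char (distr \<mu> borel (\<lambda>z. v \<bullet> z)) t = char (normal_law 0 (v \<bullet> (C *v v))) t"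
        by (simp add: char_normal_law[OF psd])
    qed
  qed
  have m2: "integrable \<mu> (\<lambda>z. (v \<bullet> z)\<^sup>2)" "(\<integral>z. (v \<bullet> z)\<^sup>2 \<partial>\<mu>) = v \<bullet> (C *v v)" for v
    using normal_law_second_moment[OF psd[of v]]
    by (simp_all add: law[symmetric] integrable_distr_eq integral_distr)
  have "(\<integral>z. z $ i * z $ j \<partial>\<mu>) = C $ i $ j" for i j
  proof -
    let ?p = "axis i 1 + axis j 1 :: real ^ 'p" and ?m = "axis i 1 - axis j 1 :: real ^ 'p"
    have "z $ i * z $ j = ((?p \<bullet> z)\<^sup>2 - (?m \<bullet> z)\<^sup>2) / 4" for z :: "real ^ 'p"
      by (simp add: inner_add_left inner_diff_left inner_axis' power2_eq_square field_simps)
    then have "(\<integral>z. z $ i * z $ j \<partial>\<mu>) = (\<integral>z. ((?p \<bullet> z)\<^sup>2 - (?m \<bullet> z)\<^sup>2) / 4 \<partial>\<mu>)"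
      by (rule Bochner_Integration.integral_cong[OF refl])
    also have "\<dots> = (?p \<bullet> (C *v ?p) - ?m \<bullet> (C *v ?m)) / 4"
      by (simp only: integral_divide_zero Bochner_Integration.integral_diff[OF m2(1) m2(1)] m2(2))
    also have "\<dots> = C $ i $ j"
      using sym[of i j]
      by (simp add: matrix_vector_right_distrib matrix_vector_mult_diff_distrib inner_add_left
          inner_diff_left inner_axis' matrix_vector_mul_component algebra_simps inner_axis row_def)
    finally show ?thesis .
  qed
  then show ?thesis using sets law psd unfolding centered_gaussian_def by blast
qed

text \<open>The law is the image of independent standard normal variables under a factor of
  \<open>C\<close>; the columns of that factor are the vectors \<open>A l\<close>, and a singular
  \<open>C\<close> is covered as well.\<close>

lemma gaussian_exists:
  fixes C :: "real ^ 'p::finite ^ 'p"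
  assumes sym: "\<And>i j. C $ i $ j = C $ j $ i" and psd: "\<And>v. 0 \<le> v \<bullet> (C *v v)"
  obtains \<mu> where "prob_space \<mu>" "sets \<mu> = sets borel" "centered_gaussian C \<mu>"
    "\<And>v. (\<integral>z. iexp (v \<bullet> z) \<partial>\<mu>) = exp (- (v \<bullet> (C *v v)) / 2)"
proof -
  have quad: "v \<bullet> (C *v v) = (\<Sum>i\<in>UNIV. \<Sum>j\<in>UNIV. v $ i * v $ j * C $ i $ j)" for v
    by (simp add: inner_vec_def matrix_vector_mult_def sum_distrib_left mult_ac)
  have "\<exists>a. \<forall>i\<in>UNIV. \<forall>j\<in>UNIV. C $ i $ j = (\<Sum>l\<in>(UNIV :: 'p set). a i l * a j l)"
  proof (rule psd_factor)
    fix v :: "'p \<Rightarrow> real"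
    show "0 \<le> (\<Sum>i\<in>UNIV. \<Sum>j\<in>UNIV. v i * v j * C $ i $ j)"
      using psd[of "\<chi> i. v i"] unfolding quad by simp
  qed (simp_all add: sym)
  then obtain a where a: "\<And>i j. C $ i $ j = (\<Sum>l\<in>(UNIV :: 'p set). a i l * a j l)" by blast
  define A where "A l = (\<chi> i. a i l)" for l
  have quadA: "v \<bullet> (C *v v) = (\<Sum>l\<in>UNIV. (v \<bullet> A l)\<^sup>2)" for v
  proof -
    have "v \<bullet> (C *v v) = (\<Sum>i\<in>UNIV. \<Sum>j\<in>UNIV. \<Sum>l\<in>UNIV. v $ i * a i l * (v $ j * a j l))"
      unfolding quad a by (simp add: sum_distrib_left mult_ac)
    also have "\<dots> = (\<Sum>l\<in>UNIV. \<Sum>i\<in>UNIV. \<Sum>j\<in>UNIV. v $ i * a i l * (v $ j * a j l))"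
      by (subst sum.swap, subst (2) sum.swap) (rule refl)
    also have "\<dots> = (\<Sum>l\<in>UNIV. (v \<bullet> A l)\<^sup>2)"
      by (simp add: inner_vec_def A_def power2_eq_square sum_product)
    finally show ?thesis .
  qed
  let ?N = "\<Pi>\<^sub>M l\<in>(UNIV :: 'p set). std_normal_distribution"
  interpret N1: real_distribution std_normal_distribution by (rule real_dist_normal_dist)
  interpret product_prob_space "\<lambda>l :: 'p. std_normal_distribution" ..
  interpret N: prob_space ?N by (rule prob_space_PiM) (rule N1.prob_space_axioms)
  define G where "G x = (\<Sum>l\<in>UNIV. x l *\<^sub>R A l)" for x :: "'p \<Rightarrow> real"
  have comp[measurable]: "(\<lambda>x. x l) \<in> borel_measurable ?N" for l
    using measurable_component_singleton[of l UNIV "\<lambda>_. std_normal_distribution"] by simp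
  have [measurable]: "G \<in> borel_measurable ?N"
    unfolding G_def by (intro borel_measurable_sum borel_measurable_scaleR comp) simp
  define \<mu> where "\<mu> = distr ?N borel G"
  have "prob_space \<mu>" unfolding \<mu>_def by (rule N.prob_space_distr) simp
  moreover have "sets \<mu> = sets borel" by (simp add: \<mu>_def)
  moreover have char: "(\<integral>z. iexp (v \<bullet> z) \<partial>\<mu>) = exp (- (v \<bullet> (C *v v)) / 2)" for v
  proof -
    have "(\<integral>z. iexp (v \<bullet> z) \<partial>\<mu>) = (\<integral>x. (\<Prod>l\<in>UNIV. iexp ((v \<bullet> A l) * x l)) \<partial>?N)"
      unfolding \<mu>_def
      by (simp add: integral_distr G_def inner_sum_right exp_sum[symmetric] sum_distrib_left mult.commute)
    also have "\<dots> = (\<Prod>l\<in>UNIV. char std_normal_distribution (v \<bullet> A l))"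
      unfolding char_def
      by (subst product_integral_prod) (auto intro!: N1.integrable_const_bound[of _ 1])
    also have "\<dots> = exp (- (v \<bullet> (C *v v)) / 2)"
      unfolding char_std_normal_distribution quadA
      by (simp add: exp_sum[symmetric] exp_of_real[symmetric] sum_negf sum_divide_distrib del: of_real_prod)
    finally show ?thesis .
  qed
  ultimately show thesis using that centered_gaussianI[OF _ _ sym psd] by blast
qed

section \<open>Weighted sums of independent variables\<close>

context prob_space
begin

text \<open>Independence removes the cross terms. Integrability and the zero mean of the partial sum
  are carried through the induction because the next cross term asks for them.\<close>

lemma indep_centered_sum_second_moment:
  fixes X :: "'i \<Rightarrow> 'a \<Rightarrow> real"
  assumes "finite J" "indep_vars (\<lambda>_. borel) X J"
    and "\<And>i. i \<in> J \<Longrightarrow> integrable M (\<lambda>\<omega>. (X i \<omega>)\<^sup>2)" "\<And>i. i \<in> J \<Longrightarrow> expectation (X i) = 0"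
  shows "integrable M (\<lambda>\<omega>. (\<Sum>i\<in>J. X i \<omega>)\<^sup>2) \<and> integrable M (\<lambda>\<omega>. \<Sum>i\<in>J. X i \<omega>) \<and>
    expectation (\<lambda>\<omega>. \<Sum>i\<in>J. X i \<omega>) = 0 \<and>
    expectation (\<lambda>\<omega>. (\<Sum>i\<in>J. X i \<omega>)\<^sup>2) = (\<Sum>i\<in>J. expectation (\<lambda>\<omega>. (X i \<omega>)\<^sup>2))"
  using assms
proof (induction J rule: finite_induct)
  case empty
  then show ?case by simp
next
  case (insert q J)
  let ?S = "\<lambda>\<omega>. \<Sum>i\<in>J. X i \<omega>"
  have [measurable]: "X q \<in> borel_measurable M"
    using insert.prems(1) by (auto simp: indep_vars_def)
  have IH: "integrable M (\<lambda>\<omega>. (?S \<omega>)\<^sup>2)" "integrable M ?S" "expectation ?S = 0"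
    "expectation (\<lambda>\<omega>. (?S \<omega>)\<^sup>2) = (\<Sum>i\<in>J. expectation (\<lambda>\<omega>. (X i \<omega>)\<^sup>2))"
    using insert.IH indep_vars_subset[OF insert.prems(1)] insert.prems(2,3) by auto
  have ind: "indep_var borel (X q) borel ?S"
    using insert by (intro indep_vars_sum) auto
  have Xq: "integrable M (\<lambda>\<omega>. (X q \<omega>)\<^sup>2)" "integrable M (X q)" "expectation (X q) = 0"
    using insert.prems square_integrable_imp_integrable[of "X q"] by simp_all
  note cross = indep_var_integrable[OF ind Xq(2) IH(2)] indep_var_lebesgue_integral[OF ind Xq(2) IH(2)]
  have eq: "(\<lambda>\<omega>. (\<Sum>i\<in>insert q J. X i \<omega>)\<^sup>2) = (\<lambda>\<omega>. (X q \<omega>)\<^sup>2 + 2 * (X q \<omega> * ?S \<omega>) + (?S \<omega>)\<^sup>2)"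
    using insert.hyps by (auto simp: power2_sum)
  have "integrable M (\<lambda>\<omega>. (\<Sum>i\<in>insert q J. X i \<omega>)\<^sup>2)"
    unfolding eq by (intro Bochner_Integration.integrable_add integrable_mult_right Xq(1) IH(1) cross(1))
  moreover have "expectation (\<lambda>\<omega>. (\<Sum>i\<in>insert q J. X i \<omega>)\<^sup>2)
     = (\<Sum>i\<in>insert q J. expectation (\<lambda>\<omega>. (X i \<omega>)\<^sup>2))"
    unfolding eq using Xq IH cross insert.hyps by simp
  ultimately show ?case using Xq IH insert.hyps by simp
qed

text \<open>Inverting 1 + x + x^2/2 \<le> exp x is enough for the upper bound on exp (- x), because
  (1 - x + x^2/2) (1 + x + x^2/2) = 1 + x^4/4 \<ge> 1.\<close>

lemma exp_minus_quadratic_bounds: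
  fixes x :: real assumes "0 \<le> x" shows "\<bar>1 - x - exp (- x)\<bar> \<le> x\<^sup>2 / 2"
proof -
  have "1 + x + x\<^sup>2 / 2 \<le> exp x" using exp_lower_Taylor_quadratic[OF assms] by simp
  then have "exp (- x) \<le> inverse (1 + x + x\<^sup>2 / 2)"
    unfolding exp_minus using assms by (intro le_imp_inverse_le) (auto intro!: add_pos_nonneg)
  also have "\<dots> \<le> 1 - x + x\<^sup>2 / 2"
  proof -
    have "(1 - x + x\<^sup>2 / 2) * (1 + x + x\<^sup>2 / 2) = 1 + (x\<^sup>2)\<^sup>2 / 4"
      by (simp add: power2_eq_square algebra_simps)
    moreover have "0 < 1 + x + x\<^sup>2 / 2" using assms by (auto intro!: add_pos_nonneg)
    ultimately show ?thesis by (simp add: inverse_eq_divide divide_le_eq)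
  qed
  finally show ?thesis using exp_ge_add_one_self[of "- x"] by (simp add: abs_le_iff)
qed

text \<open>A quantitative central limit theorem for one finite family, the form suited to
  triangular arrays. All factors lie in the unit disc, so two products differ by at most the sum of
  the factorwise differences. Each of these splits into a third-order Taylor remainder, the
  deviation of the variance from 1, and the error of replacing 1 - y by exp (- y) at y =
  u^2/2.\<close>

theorem char_weighted_sum_approx:
  fixes X :: "'i \<Rightarrow> 'a \<Rightarrow> real" and u :: "'i \<Rightarrow> real"
  assumes J: "finite J" and ind: "indep_vars (\<lambda>_. borel) X J"
    and mean: "\<And>i. i \<in> J \<Longrightarrow> expectation (X i) = 0"
    and sq: "\<And>i. i \<in> J \<Longrightarrow> integrable M (\<lambda>\<omega>. (X i \<omega>)\<^sup>2)"
      "\<And>i. i \<in> J \<Longrightarrow> \<bar>expectation (\<lambda>\<omega>. (X i \<omega>)\<^sup>2) - 1\<bar> \<le> \<epsilon>"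
    and cube: "\<And>i. i \<in> J \<Longrightarrow> integrable M (\<lambda>\<omega>. \<bar>X i \<omega>\<bar> ^ 3)"
      "\<And>i. i \<in> J \<Longrightarrow> expectation (\<lambda>\<omega>. \<bar>X i \<omega>\<bar> ^ 3) \<le> C"
    and u: "\<And>i. i \<in> J \<Longrightarrow> \<bar>u i\<bar> \<le> \<delta>"
  shows "cmod ((\<integral>\<omega>. iexp (\<Sum>i\<in>J. u i * X i \<omega>) \<partial>M) - exp (- (\<Sum>i\<in>J. (u i)\<^sup>2) / 2))
    \<le> (\<Sum>i\<in>J. (u i)\<^sup>2) * (C * \<delta> / 6 + \<epsilon> / 2 + \<delta>\<^sup>2 / 8)"
proof -
  have X[measurable]: "X i \<in> borel_measurable M" if "i \<in> J" for i
    using ind that by (auto simp: indep_vars_def)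
  define \<phi> where "\<phi> i = char (distr M borel (X i)) (u i)" for i
  have ind_u: "indep_vars (\<lambda>_. borel) (\<lambda>i \<omega>. u i * X i \<omega>) J"
    by (rule indep_vars_compose2[OF ind]) simp
  have "(\<integral>\<omega>. iexp (\<Sum>i\<in>J. u i * X i \<omega>) \<partial>M) = char (distr M borel (\<lambda>\<omega>. \<Sum>i\<in>J. u i * X i \<omega>)) 1"
    using X by (simp add: char_def integral_distr)
  also have "\<dots> = (\<Prod>i\<in>J. char (distr M borel (\<lambda>\<omega>. u i * X i \<omega>)) 1)"
    by (rule char_distr_sum[OF ind_u])
  also have "\<dots> = (\<Prod>i\<in>J. \<phi> i)"
    using X by (intro prod.cong) (auto simp: \<phi>_def char_def integral_distr)
  finally have prod: "(\<integral>\<omega>. iexp (\<Sum>i\<in>J. u i * X i \<omega>) \<partial>M) = (\<Prod>i\<in>J. \<phi> i)" .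
  have exps: "complex_of_real (exp (- (\<Sum>i\<in>J. (u i)\<^sup>2) / 2)) = (\<Prod>i\<in>J. of_real (exp (- (u i)\<^sup>2 / 2)))"
  proof -
    have "exp (- (\<Sum>i\<in>J. (u i)\<^sup>2) / 2) = (\<Prod>i\<in>J. exp (- (u i)\<^sup>2 / 2))"
      unfolding exp_sum[OF J, symmetric] by (simp add: sum_negf sum_divide_distrib)
    then show ?thesis by (simp only: of_real_prod)
  qed
  have tri: "cmod (a - d) \<le> cmod (a - b) + cmod (b - c) + cmod (c - d)" for a b c d
    using norm_triangle_ineq[of "a - b" "b - c"] norm_triangle_ineq[of "a - c" "c - d"] by simp
  have single: "cmod (\<phi> i - of_real (exp (- (u i)\<^sup>2 / 2))) \<le> (u i)\<^sup>2 * (C * \<delta> / 6 + \<epsilon> / 2 + \<delta>\<^sup>2 / 8)"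
    if i: "i \<in> J" for i
  proof -
    define s where "s = expectation (\<lambda>\<omega>. (X i \<omega>)\<^sup>2)"
    have int: "integrable M (X i)" using sq(1)[OF i] X[OF i] by (rule square_integrable_imp_integrable[rotated])
    have \<delta>: "0 \<le> \<delta>" using u[OF i] by linarith
    have "cmod (\<phi> i - (1 - (u i)\<^sup>2 * s / 2))
        \<le> (u i)\<^sup>2 / 6 * expectation (\<lambda>\<omega>. min (6 * (X i \<omega>)\<^sup>2) (\<bar>u i\<bar> * \<bar>X i \<omega>\<bar> ^ 3))"
      unfolding \<phi>_def using X[OF i] int sq(1)[OF i] mean[OF i]
      by (intro char_approx3') (auto simp: s_def)
    \<comment> \<open>Keeping only the cubic branch of the minimum trades the Lindeberg form for a
      third-moment bound.\<close>
    also have "\<dots> \<le> (u i)\<^sup>2 / 6 * expectation (\<lambda>\<omega>. \<bar>u i\<bar> * \<bar>X i \<omega>\<bar> ^ 3)"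
      using cube(1)[OF i] sq(1)[OF i] X[OF i]
      by (intro mult_left_mono integral_mono Bochner_Integration.integrable_min integrable_mult_right) auto
    also have "\<dots> = (u i)\<^sup>2 * (\<bar>u i\<bar> * expectation (\<lambda>\<omega>. \<bar>X i \<omega>\<bar> ^ 3) / 6)" by simp
    also have "\<dots> \<le> (u i)\<^sup>2 * (\<delta> * C / 6)"
      using u[OF i] cube(2)[OF i] \<delta>
      by (intro mult_left_mono divide_right_mono mult_mono) (auto intro!: integral_nonneg_AE)
    finally have 1: "cmod (\<phi> i - (1 - (u i)\<^sup>2 * s / 2)) \<le> (u i)\<^sup>2 * (C * \<delta> / 6)" by (simp add: mult.commute)
    have "cmod (complex_of_real (1 - (u i)\<^sup>2 * s / 2) - of_real (1 - (u i)\<^sup>2 / 2)) = \<bar>(u i)\<^sup>2 * ((1 - s) / 2)\<bar>"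
      unfolding of_real_diff[symmetric] norm_of_real by (rule arg_cong[where f = abs]) (simp add: field_simps)
    also have "\<dots> \<le> (u i)\<^sup>2 * (\<epsilon> / 2)"
      using sq(2)[OF i] unfolding abs_mult by (intro mult_mono) (auto simp: s_def)
    finally have 2: "cmod (complex_of_real (1 - (u i)\<^sup>2 * s / 2) - of_real (1 - (u i)\<^sup>2 / 2)) \<le> (u i)\<^sup>2 * (\<epsilon> / 2)" .
    have "cmod (complex_of_real (1 - (u i)\<^sup>2 / 2) - of_real (exp (- (u i)\<^sup>2 / 2)))
        \<le> ((u i)\<^sup>2 / 2)\<^sup>2 / 2"
      using exp_minus_quadratic_bounds[of "(u i)\<^sup>2 / 2"]
      unfolding of_real_diff[symmetric] norm_of_real by simp
    also have "\<dots> = (u i)\<^sup>2 * (\<bar>u i\<bar>\<^sup>2 / 8)" by (simp add: power2_eq_square)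
    also have "\<dots> \<le> (u i)\<^sup>2 * (\<delta>\<^sup>2 / 8)"
      using u[OF i] by (intro mult_left_mono divide_right_mono power_mono) auto
    finally have 3: "cmod (complex_of_real (1 - (u i)\<^sup>2 / 2) - of_real (exp (- (u i)\<^sup>2 / 2))) \<le> (u i)\<^sup>2 * (\<delta>\<^sup>2 / 8)" .
    have "cmod (\<phi> i - of_real (exp (- (u i)\<^sup>2 / 2)))
       \<le> cmod (\<phi> i - of_real (1 - (u i)\<^sup>2 * s / 2)) +
         cmod (complex_of_real (1 - (u i)\<^sup>2 * s / 2) - of_real (1 - (u i)\<^sup>2 / 2)) +
         cmod (complex_of_real (1 - (u i)\<^sup>2 / 2) - of_real (exp (- (u i)\<^sup>2 / 2)))"
      by (rule tri)
    then show ?thesis using 1 2 3 by (simp add: distrib_left)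
  qed
  define w where "w i = complex_of_real (exp (- (u i)\<^sup>2 / 2))" for i
  have "cmod (\<phi> i) \<le> 1" if "i \<in> J" for i
    unfolding \<phi>_def by (rule real_distribution.cmod_char_le_1[OF real_distribution_distr[OF X[OF that]]])
  moreover have "cmod (w i) \<le> 1" for i by (simp add: w_def)
  ultimately have "cmod ((\<Prod>i\<in>J. \<phi> i) - (\<Prod>i\<in>J. w i)) \<le> (\<Sum>i\<in>J. cmod (\<phi> i - w i))"
    by (intro norm_prod_diff)
  also have "\<dots> \<le> (\<Sum>i\<in>J. (u i)\<^sup>2 * (C * \<delta> / 6 + \<epsilon> / 2 + \<delta>\<^sup>2 / 8))"
    unfolding w_def by (rule sum_mono) (rule single)
  finally show ?thesis unfolding prod exps w_def by (simp only: sum_distrib_right)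
qed

end

section \<open>The Poisson process on a rectangle\<close>

context prob_space
begin

text \<open>The layer-cake formula: the power of V is the integral of its derivative over [0, V],
  and exchanging the integrals leaves the tail probabilities inside \<open>A\<close>. The
  antiderivative \<open>F\<close> evaluates what remains.\<close>

lemma moment_eq_tail_integral:
  fixes V q F :: "_ \<Rightarrow> real"
  assumes V[measurable]: "V \<in> borel_measurable M" and A[measurable]: "A \<in> events"
    and range: "\<And>\<omega>. \<omega> \<in> space M \<Longrightarrow> 0 \<le> V \<omega> \<and> V \<omega> \<le> b" and "0 \<le> b"
    and tail: "\<And>u. 0 \<le> u \<Longrightarrow> u \<le> b \<Longrightarrow> prob {\<omega>\<in>A. u \<le> V \<omega>} = q u"
    and q[measurable]: "q \<in> borel_measurable borel"
    and F: "\<And>u. 0 \<le> u \<Longrightarrow> u \<le> b \<Longrightarrow> (F has_real_derivative real (Suc p) * u ^ p * q u) (at u)"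
  shows "has_bochner_integral M (\<lambda>\<omega>. V \<omega> ^ Suc p * indicator A \<omega>) (F b - F 0)"
proof -
  interpret L: pair_sigma_finite M lborel ..
  have q0: "0 \<le> q u" if "0 \<le> u" "u \<le> b" for u using tail[OF that] by (metis measure_nonneg)
  have A_sub: "\<omega> \<in> A \<Longrightarrow> \<omega> \<in> space M" for \<omega> using sets.sets_into_space[OF A] by auto
  have pow: "ennreal (V \<omega> ^ Suc p) = (\<integral>\<^sup>+u. ennreal (real (Suc p) * u ^ p) * indicator {0..V \<omega>} u \<partial>lborel)"
    if "\<omega> \<in> space M" for \<omega>
    by (subst nn_integral_FTC_Icc[where F = "\<lambda>u. u ^ Suc p"])
      (use range[OF that] DERIV_pow[of "Suc p"] in \<open>auto simp del: power_Suc\<close>)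
  have ind[measurable]: "(\<lambda>x. indicator {0..V (fst x)} (snd x) :: ennreal) \<in> borel_measurable (M \<Otimes>\<^sub>M lborel)"
  proof -
    have "(\<lambda>x. indicator {0..V (fst x)} (snd x) :: ennreal)
        = (\<lambda>x. if 0 \<le> snd x \<and> snd x \<le> V (fst x) then 1 else 0)"
      by (auto simp: indicator_def)
    then show ?thesis by simp
  qed
  have "(\<integral>\<^sup>+\<omega>. ennreal (V \<omega> ^ Suc p * indicator A \<omega>) \<partial>M)
      = (\<integral>\<^sup>+\<omega>. (\<integral>\<^sup>+u. ennreal (real (Suc p) * u ^ p) * indicator {0..V \<omega>} u \<partial>lborel) * indicator A \<omega> \<partial>M)"
    by (intro nn_integral_cong) (auto simp: pow indicator_def simp del: power_Suc)
  also have "\<dots> = (\<integral>\<^sup>+\<omega>. \<integral>\<^sup>+u. ennreal (real (Suc p) * u ^ p) * indicator {0..V \<omega>} u * indicator A \<omega> \<partial>lborel \<partial>M)"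
    by (simp add: nn_integral_multc[symmetric])
  also have "\<dots> = (\<integral>\<^sup>+u. \<integral>\<^sup>+\<omega>. ennreal (real (Suc p) * u ^ p) * indicator {0..V \<omega>} u * indicator A \<omega> \<partial>M \<partial>lborel)"
    by (rule L.Fubini'[symmetric]) (simp add: split_beta')
  also have "\<dots> = (\<integral>\<^sup>+u. ennreal (real (Suc p) * u ^ p * q u) * indicator {0..b} u \<partial>lborel)"
  proof (intro nn_integral_cong)
    fix u :: real
    show "(\<integral>\<^sup>+\<omega>. ennreal (real (Suc p) * u ^ p) * indicator {0..V \<omega>} u * indicator A \<omega> \<partial>M)
        = ennreal (real (Suc p) * u ^ p * q u) * indicator {0..b} u"
    proof (cases "0 \<le> u \<and> u \<le> b")
      case True
      have [measurable]: "{\<omega>\<in>A. u \<le> V \<omega>} \<in> events"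
      proof -
        have "{\<omega>\<in>A. u \<le> V \<omega>} = A \<inter> {\<omega>\<in>space M. u \<le> V \<omega>}" using A_sub by auto
        then show ?thesis by simp
      qed
      have "(\<integral>\<^sup>+\<omega>. ennreal (real (Suc p) * u ^ p) * indicator {0..V \<omega>} u * indicator A \<omega> \<partial>M)
          = (\<integral>\<^sup>+\<omega>. ennreal (real (Suc p) * u ^ p) * indicator {\<omega>\<in>A. u \<le> V \<omega>} \<omega> \<partial>M)"
        using True by (intro nn_integral_cong) (auto simp: indicator_def)
      also have "\<dots> = ennreal (real (Suc p) * u ^ p) * ennreal (q u)"
        using True by (simp add: nn_integral_cmult_indicator emeasure_eq_measure tail)
      finally show ?thesis using True q0 by (simp add: ennreal_mult[symmetric])
    next
      case False
      then have "(\<integral>\<^sup>+\<omega>. ennreal (real (Suc p) * u ^ p) * indicator {0..V \<omega>} u * indicator A \<omega> \<partial>M) = (\<integral>\<^sup>+\<omega>. 0 \<partial>M)"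
        using range by (intro nn_integral_cong) (fastforce simp: indicator_def)
      with False show ?thesis by auto
    qed
  qed
  also have "\<dots> = ennreal (F b - F 0)"
    using F q0 \<open>0 \<le> b\<close> by (intro nn_integral_FTC_Icc) auto
  finally have nn: "(\<integral>\<^sup>+\<omega>. ennreal (V \<omega> ^ Suc p * indicator A \<omega>) \<partial>M) = ennreal (F b - F 0)" .
  have "F 0 \<le> F b"
  proof (rule DERIV_nonneg_imp_nondecreasing[OF \<open>0 \<le> b\<close>])
    fix u assume u: "0 \<le> u" "u \<le> b"
    then have "0 \<le> real (Suc p) * u ^ p * q u" using q0 by simp
    with F[OF u] show "\<exists>y. DERIV F u :> y \<and> 0 \<le> y" by blast
  qed
  with nn show ?thesis
    using range by (intro has_bochner_integral_nn_integral) (auto intro!: mult_nonneg_nonneg)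
qed

text \<open>Expectations involving 1 / L are computed on each level set, where this factor is
  constant, and then added by monotone convergence. Nonnegativity makes convergence of the series
  sufficient for integrability.\<close>

lemma has_bochner_integral_sum_levels:
  fixes L X :: "_ \<Rightarrow> real"
  assumes [measurable]: "L \<in> borel_measurable M" "X \<in> borel_measurable M"
    and nat: "AE \<omega> in M. L \<omega> \<in> range real" and pos: "\<And>\<omega>. \<omega> \<in> space M \<Longrightarrow> 0 \<le> X \<omega>"
    and level: "\<And>j. has_bochner_integral M (\<lambda>\<omega>. X \<omega> * indicator {\<omega>\<in>space M. L \<omega> = real j} \<omega>) (c j)"
    and c: "c sums s"
  shows "has_bochner_integral M X s"
proof -
  have c0: "0 \<le> c j" for j
    unfolding has_bochner_integral_integral_eq[OF level[of j], symmetric]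
    using pos by (intro integral_nonneg_AE AE_I2) (auto simp: indicator_def)
  have "(\<integral>\<^sup>+\<omega>. ennreal (X \<omega>) \<partial>M)
      = (\<integral>\<^sup>+\<omega>. (\<Sum>j. ennreal (X \<omega> * indicator {\<omega>\<in>space M. L \<omega> = real j} \<omega>)) \<partial>M)"
  proof (rule nn_integral_cong_AE)
    show "AE \<omega> in M. ennreal (X \<omega>) = (\<Sum>j. ennreal (X \<omega> * indicator {\<omega>\<in>space M. L \<omega> = real j} \<omega>))"
      using nat AE_space
    proof eventually_elim
      case (elim \<omega>)
      then obtain i where i: "L \<omega> = real i" by auto
      show ?case
        using elim(2) i by (subst suminf_finite[of "{i}"]) (auto simp: indicator_def)
    qed
  qed
  also have "\<dots> = (\<Sum>j. \<integral>\<^sup>+\<omega>. ennreal (X \<omega> * indicator {\<omega>\<in>space M. L \<omega> = real j} \<omega>) \<partial>M)"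
    by (intro nn_integral_suminf) simp
  also have "\<dots> = (\<Sum>j. ennreal (c j))"
  proof (intro suminf_cong)
    fix j
    have "(\<integral>\<^sup>+\<omega>. ennreal (X \<omega> * indicator {\<omega>\<in>space M. L \<omega> = real j} \<omega>) \<partial>M)
        = ennreal (\<integral>\<omega>. X \<omega> * indicator {\<omega>\<in>space M. L \<omega> = real j} \<omega> \<partial>M)"
      using pos by (intro nn_integral_eq_integral integrable.intros[OF level] AE_I2)
        (auto simp: indicator_def)
    then show "(\<integral>\<^sup>+\<omega>. ennreal (X \<omega> * indicator {\<omega>\<in>space M. L \<omega> = real j} \<omega>) \<partial>M) = ennreal (c j)"
      by (simp add: has_bochner_integral_integral_eq[OF level])
  qed
  also have "\<dots> = ennreal s"
    using suminf_ennreal2[OF c0 sums_summable[OF c]] sums_unique[OF c] by simp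
  finally show ?thesis
    using pos sums_le[OF c0 sums_zero c] by (intro has_bochner_integral_nn_integral AE_I2) auto
qed

end

text \<open>
  The law of the number \<open>L\<close> of points of a Poisson process of unit rate on a rectangle with area \<open>l\<close>
  and of the area \<open>U\<close> above the highest point (all of \<open>l\<close> if there is none).
\<close>

locale poisson_rectangle = prob_space +
  fixes L U :: "'a \<Rightarrow> real" and l :: real
  assumes L[measurable]: "L \<in> borel_measurable M" and U[measurable]: "U \<in> borel_measurable M"
    and U_range: "\<And>\<omega>. \<omega> \<in> space M \<Longrightarrow> 0 \<le> U \<omega> \<and> U \<omega> \<le> l" and l_pos: "0 < l"
    and joint: "\<And>j u. 0 \<le> u \<Longrightarrow> u \<le> l \<Longrightarrow>
      prob {\<omega>\<in>space M. L \<omega> = real j \<and> u \<le> U \<omega>} = exp (- l) * (l - u) ^ j / fact j"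
begin

definition p :: "nat \<Rightarrow> real" where "p j = exp (- l) * l ^ j / fact j"

lemma p_Suc: "real (Suc j) * p (Suc j) = l * p j"
  by (simp add: p_def del: of_nat_Suc)

lemma p_nonneg: "0 \<le> p j" using l_pos by (simp add: p_def)

text \<open>Summing the joint law over all counts gives the tail of the gap; u = 0 gives the total
  mass of the Poisson weights.\<close>

lemma exp_sums_tail: "(\<lambda>j. exp (- l) * (l - u) ^ j / fact j) sums exp (- u)"
  using sums_mult[OF exp_converges[of "l - u"], of "exp (- l)"]
  by (simp add: exp_add[symmetric] scaleR_conv_of_real divide_inverse mult_ac)

lemma p_sums: "p sums 1"
  using exp_sums_tail[of 0] by (simp add: p_def[abs_def])

lemma p_shift_sums: "(\<lambda>j. p (j + i)) sums (1 - (\<Sum>j<i. p j))"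
  using sums_split_initial_segment[OF p_sums] .

lemma prob_level: "prob {\<omega>\<in>space M. L \<omega> = real j} = p j"
proof -
  have "{\<omega>\<in>space M. L \<omega> = real j} = {\<omega>\<in>space M. L \<omega> = real j \<and> 0 \<le> U \<omega>}" using U_range by auto
  then show ?thesis using joint[of 0 j] l_pos by (simp add: p_def)
qed

lemma disjoint_levels: "disjoint_family (\<lambda>j::nat. {\<omega>\<in>space M. L \<omega> = real j \<and> Q \<omega>})"
  by (auto simp: disjoint_family_on_def)

text \<open>\<open>L\<close> is only assumed to be a real variable, but the masses of the integer
  levels already add up to 1.\<close>

lemma AE_nat: "AE \<omega> in M. L \<omega> \<in> range real"
proof -
  have "(\<lambda>j. prob {\<omega>\<in>space M. L \<omega> = real j \<and> True}) sums prob (\<Union>j. {\<omega>\<in>space M. L \<omega> = real j \<and> True})"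
    by (intro finite_measure_UNION disjoint_levels) auto
  then have "prob (\<Union>j. {\<omega>\<in>space M. L \<omega> = real j}) = 1"
    using sums_unique2[OF p_sums] by (simp add: prob_level)
  then have "AE \<omega> in M. \<omega> \<in> (\<Union>j. {\<omega>\<in>space M. L \<omega> = real j})"
    by (intro AE_in_set_eq_1[THEN iffD2]) auto
  then show ?thesis by eventually_elim auto
qed

lemma tail: assumes "0 \<le> u" "u \<le> l" shows "prob {\<omega>\<in>space M. u \<le> U \<omega>} = exp (- u)"
proof -
  have "(\<lambda>j. prob {\<omega>\<in>space M. L \<omega> = real j \<and> u \<le> U \<omega>}) sums prob (\<Union>j. {\<omega>\<in>space M. L \<omega> = real j \<and> u \<le> U \<omega>})"
    by (intro finite_measure_UNION disjoint_levels) auto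
  then have "prob (\<Union>j. {\<omega>\<in>space M. L \<omega> = real j \<and> u \<le> U \<omega>}) = exp (- u)"
    using sums_unique2[OF exp_sums_tail] by (simp add: joint assms)
  moreover have "prob (\<Union>j. {\<omega>\<in>space M. L \<omega> = real j \<and> u \<le> U \<omega>}) = prob {\<omega>\<in>space M. u \<le> U \<omega>}"
    by (rule finite_measure_eq_AE) (use AE_nat in \<open>auto elim: eventually_mono\<close>)
  ultimately show ?thesis by simp
qed

text \<open>The tail exp (- u) stops at l, so the moments 1, 2 and 6 of the unit exponential law
  lose the boundary terms at l.\<close>

lemma
  shows U1: "has_bochner_integral M U (1 - exp (- l))"
    and U2: "has_bochner_integral M (\<lambda>\<omega>. (U \<omega>)\<^sup>2) (2 * (1 - (1 + l) * exp (- l)))"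
    and U3: "has_bochner_integral M (\<lambda>\<omega>. U \<omega> ^ 3) (6 - 3 * (l\<^sup>2 + 2 * l + 2) * exp (- l))"
proof -
  have l0: "0 \<le> l" using l_pos by simp
  have drop: "has_bochner_integral M (\<lambda>\<omega>. V \<omega> * indicator (space M) \<omega>) x \<longleftrightarrow> has_bochner_integral M V x"
    for V :: "'a \<Rightarrow> real" and x
    by (rule has_bochner_integral_cong) auto
  show "has_bochner_integral M U (1 - exp (- l))"
  proof -
    have "has_bochner_integral M (\<lambda>\<omega>. U \<omega> ^ Suc 0 * indicator (space M) \<omega>) (- exp (- l) - - exp (- 0))"
      by (rule moment_eq_tail_integral[OF U sets.top U_range l0 tail])
        (auto intro!: derivative_eq_intros)
    then show ?thesis by (simp add: drop)
  qed
  have "has_bochner_integral M (\<lambda>\<omega>. U \<omega> ^ Suc 1 * indicator (space M) \<omega>)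
     (- 2 * (l + 1) * exp (- l) - - 2 * (0 + 1) * exp (- 0))"
    by (rule moment_eq_tail_integral[OF U sets.top U_range l0 tail])
      (auto intro!: derivative_eq_intros simp: algebra_simps)
  then show "has_bochner_integral M (\<lambda>\<omega>. (U \<omega>)\<^sup>2) (2 * (1 - (1 + l) * exp (- l)))"
    unfolding drop by (simp add: power2_eq_square algebra_simps)
  have "has_bochner_integral M (\<lambda>\<omega>. U \<omega> ^ Suc 2 * indicator (space M) \<omega>)
     (- 3 * (l\<^sup>2 + 2 * l + 2) * exp (- l) - - 3 * (0\<^sup>2 + 2 * 0 + 2) * exp (- 0))"
    by (rule moment_eq_tail_integral[OF U sets.top U_range l0 tail])
      (auto intro!: derivative_eq_intros simp: algebra_simps power2_eq_square)
  then show "has_bochner_integral M (\<lambda>\<omega>. U \<omega> ^ 3) (6 - 3 * (l\<^sup>2 + 2 * l + 2) * exp (- l))"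
    unfolding drop by (simp add: numeral_3_eq_3 algebra_simps)
qed

text \<open>On the level L = j the tail is exp (- l) (l - u)^j / j!, and each integration in u
  raises the power by one, so the moments are later Poisson weights. This shift of the index is
  behind the bias cancellation in \<open>corrected_mean\<close>.\<close>

lemma U_level_moments:
  defines "I \<equiv> \<lambda>j. indicator {\<omega>\<in>space M. L \<omega> = real j} :: 'a \<Rightarrow> real"
  shows "has_bochner_integral M (\<lambda>\<omega>. U \<omega> * I j \<omega>) (p (j + 1))"
    and "has_bochner_integral M (\<lambda>\<omega>. (U \<omega>)\<^sup>2 * I j \<omega>) (2 * p (j + 2))"
proof -
  have l0: "0 \<le> l" using l_pos by simp
  have t: "prob {\<omega> \<in> {\<omega>\<in>space M. L \<omega> = real j}. u \<le> U \<omega>} = exp (- l) * (l - u) ^ j / fact j"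
    if "0 \<le> u" "u \<le> l" for u using joint[OF that, of j] by (simp add: conj_assoc)
  \<comment> \<open>Powers are normalised so that differentiation only lowers the index and changes
    the sign.\<close>
  define g where "g k u = (l - u) ^ k / fact k" for k and u :: real
  have dg: "(g (Suc k) has_real_derivative - g k u) (at u)" for k u
  proof -
    have "((\<lambda>u. (l - u) ^ Suc k) has_real_derivative - (real (Suc k) * (l - u) ^ k)) (at u)"
      by (rule derivative_eq_intros refl)+ (simp del: of_nat_Suc)
    from DERIV_cdivide[OF this, of "fact (Suc k)"] show ?thesis
      unfolding g_def[abs_def] by (simp del: of_nat_Suc power_Suc)
  qed
  have tg: "prob {\<omega> \<in> {\<omega>\<in>space M. L \<omega> = real j}. u \<le> U \<omega>} = exp (- l) * g j u"
    if "0 \<le> u" "u \<le> l" for u using t[OF that] by (simp add: g_def)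
  have [measurable]: "g k \<in> borel_measurable borel" for k unfolding g_def by measurable
  have gl: "g (Suc k) l = 0" for k by (simp add: g_def)
  have p_g: "p k = exp (- l) * g k 0" for k by (simp add: p_def g_def)
  have "has_bochner_integral M (\<lambda>\<omega>. U \<omega> ^ Suc 0 * I j \<omega>)
     (- exp (- l) * g (Suc j) l - - exp (- l) * g (Suc j) 0)"
    unfolding I_def by (rule moment_eq_tail_integral[OF U _ U_range l0 tg])
      (auto intro!: derivative_eq_intros dg simp: algebra_simps)
  then show "has_bochner_integral M (\<lambda>\<omega>. U \<omega> * I j \<omega>) (p (j + 1))"
    by (simp add: p_g gl)
  \<comment> \<open>Integration by parts of 2 u g j gives the antiderivative - 2 (u g (j + 1) + g (j
    + 2)).\<close>
  have "has_bochner_integral M (\<lambda>\<omega>. U \<omega> ^ Suc 1 * I j \<omega>)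
     ((- 2 * exp (- l) * (l * g (Suc j) l + g (Suc (Suc j)) l))
      - (- 2 * exp (- l) * (0 * g (Suc j) 0 + g (Suc (Suc j)) 0)))"
    unfolding I_def by (rule moment_eq_tail_integral[OF U _ U_range l0 tg])
      (auto intro!: derivative_eq_intros dg simp: algebra_simps)
  then show "has_bochner_integral M (\<lambda>\<omega>. (U \<omega>)\<^sup>2 * I j \<omega>) (2 * p (j + 2))"
    by (simp add: p_g gl power2_eq_square mult.assoc)
qed

text \<open>What the factor 1 + 1 / L adds to the height l - U. At L = 0 the quotient is 0, in
  agreement with the convention for an empty cell.\<close>

definition b :: "'a \<Rightarrow> real" where "b \<omega> = (l - U \<omega>) / L \<omega>"

lemma b_measurable[measurable]: "b \<in> borel_measurable M"
  unfolding b_def by measurable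

text \<open>After insertion of the moments of U, the recursion of the Poisson weights turns the
  numerators into j p (j + 1) and j (j + 1) p (j + 2), so the division by j or its square is
  explicit.\<close>

lemma b_level: 
  defines "I \<equiv> \<lambda>j. indicator {\<omega>\<in>space M. L \<omega> = real j} :: 'a \<Rightarrow> real"
  shows "has_bochner_integral M (\<lambda>\<omega>. b \<omega> * I j \<omega>) (if j = 0 then 0 else p (j + 1))"
    and "has_bochner_integral M (\<lambda>\<omega>. (b \<omega>)\<^sup>2 * I j \<omega>) (if j = 0 then 0 else p (j + 2) * (1 + 1 / real j))"
proof -
  have pj: "has_bochner_integral M (I j) (p j)"
    unfolding I_def using has_bochner_integral_real_indicator[of "{\<omega>\<in>space M. L \<omega> = real j}" M]
    by (simp add: prob_level less_top[symmetric])
  have Uj: "has_bochner_integral M (\<lambda>\<omega>. U \<omega> * I j \<omega>) (p (j + 1))"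
    "has_bochner_integral M (\<lambda>\<omega>. (U \<omega>)\<^sup>2 * I j \<omega>) (2 * p (j + 2))"
    using U_level_moments[of j] by (simp_all add: I_def)
  have e1: "b \<omega> * I j \<omega> = (l * I j \<omega> - U \<omega> * I j \<omega>) / real j" for \<omega>
    by (auto simp: I_def b_def indicator_def)
  have e2: "(b \<omega>)\<^sup>2 * I j \<omega> = (l\<^sup>2 * I j \<omega> - (2 * l) * (U \<omega> * I j \<omega>) + (U \<omega>)\<^sup>2 * I j \<omega>) / (real j)\<^sup>2" for \<omega>
    by (auto simp: I_def b_def indicator_def power_divide power2_diff)
  have h1: "has_bochner_integral M (\<lambda>\<omega>. b \<omega> * I j \<omega>) ((l * p j - p (j + 1)) / real j)"
    unfolding e1 by (intro has_bochner_integral_divide_zero has_bochner_integral_diff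
        has_bochner_integral_mult_right pj Uj)
  have h2: "has_bochner_integral M (\<lambda>\<omega>. (b \<omega>)\<^sup>2 * I j \<omega>)
      ((l\<^sup>2 * p j - (2 * l) * p (j + 1) + 2 * p (j + 2)) / (real j)\<^sup>2)"
    unfolding e2 by (intro has_bochner_integral_divide_zero has_bochner_integral_diff
        has_bochner_integral_add has_bochner_integral_mult_right pj Uj)
  have r1: "l * p j = real (j + 1) * p (j + 1)" and r2: "l * p (j + 1) = real (j + 2) * p (j + 2)"
    using p_Suc[of j] p_Suc[of "Suc j"] by simp_all
  show "has_bochner_integral M (\<lambda>\<omega>. b \<omega> * I j \<omega>) (if j = 0 then 0 else p (j + 1))"
    using h1 unfolding r1 by (auto simp: algebra_simps split: if_splits)
  have "l\<^sup>2 * p j - (2 * l) * p (j + 1) + 2 * p (j + 2)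
      = real (j + 1) * (l * p (j + 1)) - 2 * (l * p (j + 1)) + 2 * p (j + 2)"
    using r1 by (simp add: power2_eq_square algebra_simps)
  also have "\<dots> = p (j + 2) * ((real j)\<^sup>2 + real j)"
    unfolding r2 by (simp add: power2_eq_square algebra_simps)
  finally have "(l\<^sup>2 * p j - (2 * l) * p (j + 1) + 2 * p (j + 2)) / (real j)\<^sup>2
      = (if j = 0 then 0 else p (j + 2) * (1 + 1 / real j))"
    by (simp add: power2_eq_square field_simps)
  with h2 show "has_bochner_integral M (\<lambda>\<omega>. (b \<omega>)\<^sup>2 * I j \<omega>)
      (if j = 0 then 0 else p (j + 2) * (1 + 1 / real j))"
    by simp
qed

text \<open>The weights p (j + 1) over j \<ge> 1 exhaust the total mass except p 0 and p 1.\<close>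

lemma b_mean: "has_bochner_integral M b (1 - (1 + l) * exp (- l))"
proof -
  have "AE \<omega> in M. 0 \<le> b \<omega>"
    using AE_nat AE_space by eventually_elim (use U_range in \<open>auto simp: b_def\<close>)
  \<comment> \<open>\<open>L\<close> may be negative on a null set, whereas the summation over
    levels asks for a pointwise nonnegative variable; hence the detour through the absolute
    value.\<close>
  have "has_bochner_integral M (\<lambda>\<omega>. \<bar>b \<omega>\<bar>) (1 - (1 + l) * exp (- l))"
  proof (rule has_bochner_integral_sum_levels[OF L _ AE_nat])
    show "has_bochner_integral M (\<lambda>\<omega>. \<bar>b \<omega>\<bar> * indicator {\<omega>\<in>space M. L \<omega> = real j} \<omega>)
        (if j = 0 then 0 else p (j + 1))" for j
      by (rule has_bochner_integral_cong[THEN iffD1, OF refl _ refl b_level(1)])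
        (use U_range in \<open>auto simp: b_def indicator_def\<close>)
    \<comment> \<open>\<open>b\<close> contributes nothing on the level 0, so the term p 1 of the
      shifted series is added here and subtracted afterwards.\<close>
    have "(\<lambda>j. (if j = 0 then p 1 else 0) + (if j = 0 then 0 else p (j + 1))) sums (1 - (\<Sum>j<1. p j))"
      using p_shift_sums[of 1] by (rule sums_cong[THEN iffD1, rotated]) auto
    from sums_diff[OF this sums_single[of 0 "\<lambda>_. p 1"]]
    have "(\<lambda>j. if j = 0 then 0 else p (j + 1)) sums (1 - (\<Sum>j<1. p j) - p 1)"
      by (rule sums_cong[THEN iffD1, rotated]) auto
    then show "(\<lambda>j. if j = 0 then 0 else p (j + 1)) sums (1 - (1 + l) * exp (- l))"
      by (simp add: p_def algebra_simps)
  qed auto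
  moreover have "AE \<omega> in M. b \<omega> = \<bar>b \<omega>\<bar>"
    using \<open>AE \<omega> in M. 0 \<le> b \<omega>\<close> by eventually_elim simp
  ultimately show ?thesis
    using has_bochner_integral_cong_AE[of b M "\<lambda>\<omega>. \<bar>b \<omega>\<bar>"] by simp
qed

lemma b_square: "integrable M (\<lambda>\<omega>. (b \<omega>)\<^sup>2)" "(\<integral>\<omega>. (b \<omega>)\<^sup>2 \<partial>M) \<le> 1 + 4 / l"
proof -
  define c where "c j = (if j = 0 then 0 else p (j + 2) * (1 + 1 / real j))" for j
  \<comment> \<open>For j \<ge> 1 one has 1 / j \<le> 4 / (j + 3), with equality at j = 1, and p (j
    + 2) / (j + 3) = p (j + 3) / l. Two shifted Poisson series thus dominate
    \<open>c\<close>.\<close>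
  define d where "d j = p (j + 2) + 4 / l * p (j + 3)" for j
  have c0: "0 \<le> c j" for j using p_nonneg by (simp add: c_def)
  have cd: "c j \<le> d j" for j
  proof (cases "j = 0")
    case True then show ?thesis using p_nonneg l_pos by (simp add: c_def d_def)
  next
    case False
    have "p (j + 2) * l = real (j + 3) * p (j + 3)" using p_Suc[of "j + 2"] by (simp add: mult.commute eval_nat_numeral)
    then have "4 / l * p (j + 3) = p (j + 2) * (4 / real (j + 3))" using l_pos by (simp add: field_simps)
    moreover have "1 / real j \<le> 4 / real (j + 3)" using False by (simp add: field_simps)
    ultimately show ?thesis
      using False mult_left_mono[OF _ p_nonneg[of "j + 2"], of "1 / real j" "4 / real (j + 3)"]
      by (simp add: c_def d_def distrib_left)
  qed
  have d: "d sums ((1 - (\<Sum>j<2. p j)) + 4 / l * (1 - (\<Sum>j<3. p j)))"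
    unfolding d_def by (intro sums_add sums_mult p_shift_sums)
  have sc: "summable c" by (rule summable_comparison_test'[OF sums_summable[OF d], of 0]) (use c0 cd in auto)
  have B: "has_bochner_integral M (\<lambda>\<omega>. (b \<omega>)\<^sup>2) (suminf c)"
    by (rule has_bochner_integral_sum_levels[OF L _ AE_nat _ _ summable_sums[OF sc]])
      (auto simp only: c_def intro!: b_level(2) zero_le_power2 borel_measurable_power b_measurable)
  then show "integrable M (\<lambda>\<omega>. (b \<omega>)\<^sup>2)" by (rule integrable.intros)
  have "suminf c \<le> suminf d" by (rule suminf_le[OF cd sc sums_summable[OF d]])
  also have "\<dots> = (1 - (\<Sum>j<2. p j)) + 4 / l * (1 - (\<Sum>j<3. p j))" by (rule sums_unique[OF d, symmetric])
  also have "\<dots> \<le> 1 + 4 / l * 1"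
    using l_pos by (intro add_mono mult_left_mono) (auto intro: sum_nonneg p_nonneg)
  finally show "(\<integral>\<omega>. (b \<omega>)\<^sup>2 \<partial>M) \<le> 1 + 4 / l" using has_bochner_integral_integral_eq[OF B] by simp
qed

text \<open>Exponentially small terms are weakened to order 1 / l, the order of the remaining
  errors.\<close>

lemma exp_minus_bounds: "exp (- l) \<le> 1 / l" "l * exp (- l) \<le> 2 / l"
proof -
  have e: "1 + l + l\<^sup>2 / 2 \<le> exp l" using exp_lower_Taylor_quadratic[of l] l_pos by simp
  then have "l \<le> exp l" "l\<^sup>2 \<le> 2 * exp l" using l_pos zero_le_power2[of l] by linarith+
  then show "exp (- l) \<le> 1 / l" "l * exp (- l) \<le> 2 / l"
    using l_pos by (simp_all add: exp_minus power2_eq_square field_simps)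
qed

lemma has_bochner_integral_constant: "has_bochner_integral M (\<lambda>_. x) (x :: real)"
  by (simp add: has_bochner_integral_iff prob_space)

text \<open>The product equals l - U + b, and the means of U and of b differ only by l exp (-
  l).\<close>

lemma corrected_mean: "has_bochner_integral M (\<lambda>\<omega>. (1 + 1 / L \<omega>) * (l - U \<omega>)) (l * (1 - exp (- l)))"
proof -
  have "has_bochner_integral M (\<lambda>\<omega>. l - U \<omega> + b \<omega>) (l - (1 - exp (- l)) + (1 - (1 + l) * exp (- l)))"
    using has_bochner_integral_constant[of l]
    by (intro has_bochner_integral_add has_bochner_integral_diff U1 b_mean)
  then show ?thesis by (simp add: b_def field_simps)
qed

text \<open>The variance is exactly 1 - 2 l exp (- l) - exp (- 2 l), which leaves 4 / l + 1 / l. The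
  centring e lies in [0, 1], so |e - U| \<le> max U 1 and the third moment is at most 6 + 1.\<close>

lemma U_centered:
  defines "e \<equiv> 1 - exp (- l)"
  shows "integrable M (\<lambda>\<omega>. (e - U \<omega>)\<^sup>2)" "\<bar>(\<integral>\<omega>. (e - U \<omega>)\<^sup>2 \<partial>M) - 1\<bar> \<le> 5 / l"
    "integrable M (\<lambda>\<omega>. \<bar>e - U \<omega>\<bar> ^ 3)" "(\<integral>\<omega>. \<bar>e - U \<omega>\<bar> ^ 3 \<partial>M) \<le> 7"
proof -
  have e: "0 \<le> e" "e \<le> 1" using l_pos by (auto simp: e_def)
  have "has_bochner_integral M (\<lambda>\<omega>. e\<^sup>2 - (2 * e) * U \<omega> + (U \<omega>)\<^sup>2)
      (e\<^sup>2 - (2 * e) * (1 - exp (- l)) + 2 * (1 - (1 + l) * exp (- l)))"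
    using has_bochner_integral_constant[of "e\<^sup>2"]
    by (intro has_bochner_integral_add has_bochner_integral_diff has_bochner_integral_mult_right U1 U2)
  then have B: "has_bochner_integral M (\<lambda>\<omega>. (e - U \<omega>)\<^sup>2) (1 - 2 * (l * exp (- l)) - (exp (- l))\<^sup>2)"
    by (simp add: power2_diff e_def power2_eq_square algebra_simps)
  then show "integrable M (\<lambda>\<omega>. (e - U \<omega>)\<^sup>2)" by (rule integrable.intros)
  have "(exp (- l))\<^sup>2 \<le> exp (- l) * 1" using l_pos unfolding power2_eq_square by (intro mult_left_mono) auto
  moreover have "0 \<le> l * exp (- l)" using l_pos by simp
  moreover have "exp (- l) \<le> 1 / l" "l * exp (- l) \<le> 2 * (1 / l)" "5 / l = 5 * (1 / l)" "0 \<le> (exp (- l))\<^sup>2"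
    using exp_minus_bounds by auto
  ultimately show "\<bar>(\<integral>\<omega>. (e - U \<omega>)\<^sup>2 \<partial>M) - 1\<bar> \<le> 5 / l"
    unfolding has_bochner_integral_integral_eq[OF B] abs_le_iff by linarith
  have le: "\<bar>e - U \<omega>\<bar> ^ 3 \<le> U \<omega> ^ 3 + 1" if "\<omega> \<in> space M" for \<omega>
  proof -
    have "\<bar>e - U \<omega>\<bar> \<le> max (U \<omega>) 1" using e U_range[OF that] by auto
    then have "\<bar>e - U \<omega>\<bar> ^ 3 \<le> (max (U \<omega>) 1) ^ 3" by (intro power_mono) auto
    also have "\<dots> \<le> U \<omega> ^ 3 + 1" using U_range[OF that] by (auto simp: max_def)
    finally show ?thesis .
  qed
  have iU: "integrable M (\<lambda>\<omega>. U \<omega> ^ 3)" by (rule integrable.intros[OF U3])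
  show i3: "integrable M (\<lambda>\<omega>. \<bar>e - U \<omega>\<bar> ^ 3)"
    by (rule Bochner_Integration.integrable_bound[of M "\<lambda>\<omega>. U \<omega> ^ 3 + 1"])
      (use iU le U_range in \<open>auto intro!: AE_I2\<close>)
  have "(\<integral>\<omega>. \<bar>e - U \<omega>\<bar> ^ 3 \<partial>M) \<le> (\<integral>\<omega>. U \<omega> ^ 3 + 1 \<partial>M)"
    using iU i3 le by (intro integral_mono) auto
  also have "\<dots> = 6 - 3 * (l\<^sup>2 + 2 * l + 2) * exp (- l) + 1"
    using iU has_bochner_integral_integral_eq[OF U3] by (simp add: prob_space)
  also have "\<dots> \<le> 7" using l_pos by simp
  finally show "(\<integral>\<omega>. \<bar>e - U \<omega>\<bar> ^ 3 \<partial>M) \<le> 7" .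
qed

text \<open>With x = (1 + l) exp (- l) the squared mean is (1 - x)^2 \<ge> 1 - 2 x, and x \<le> 3 /
  l. Together with the bound on the second moment this gives 4 / l + 6 / l.\<close>

lemma b_centered:
  defines "e \<equiv> 1 - (1 + l) * exp (- l)"
  shows "integrable M (\<lambda>\<omega>. (b \<omega> - e)\<^sup>2)" "(\<integral>\<omega>. (b \<omega> - e)\<^sup>2 \<partial>M) \<le> 10 / l"
proof -
  note ib = integrable.intros[OF b_mean] and mb = has_bochner_integral_integral_eq[OF b_mean, folded e_def]
  show "integrable M (\<lambda>\<omega>. (b \<omega> - e)\<^sup>2)" using ib b_square(1) by (simp add: power2_diff)
  have "(\<integral>\<omega>. (b \<omega> - e)\<^sup>2 \<partial>M) = (\<integral>\<omega>. (b \<omega>)\<^sup>2 \<partial>M) - e\<^sup>2"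
    using ib b_square(1) by (simp add: power2_diff mb prob_space power2_eq_square[of e])
  also have "\<dots> \<le> 1 + 4 / l - e\<^sup>2" using b_square(2) by simp
  also have "\<dots> \<le> 4 / l + 2 * ((1 + l) * exp (- l))"
    by (simp add: e_def power2_diff)
  also have "\<dots> \<le> 4 / l + 2 * (1 / l + 2 / l)"
    using exp_minus_bounds by (simp add: distrib_right)
  finally show "(\<integral>\<omega>. (b \<omega> - e)\<^sup>2 \<partial>M) \<le> 10 / l" by simp
qed

end

section \<open>Poisson processes under a graph\<close>

locale graph_process = prob_space P for P :: "'w measure" +
  fixes \<nu> :: "'a measure" and f :: "'a \<Rightarrow> real" and c :: real and n :: nat
    and N :: "'w \<Rightarrow> ('a \<times> real) measure" and X :: "'w \<Rightarrow> nat \<Rightarrow> 'a" and Y :: "'w \<Rightarrow> nat \<Rightarrow> real"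
  assumes \<nu>: "prob_space \<nu>"
    and f[measurable]: "f \<in> borel_measurable \<nu>" and f_nonneg: "\<And>x. x \<in> space \<nu> \<Longrightarrow> 0 \<le> f x"
    and c: "0 < c" and n: "1 \<le> n"
    and ppp: "poisson_point_process P (intensity \<nu> f c n) N"
    and pts: "\<And>\<omega>. \<omega> \<in> space P \<Longrightarrow> has_points (N \<omega>) (subgraph f (space \<nu>)) (X \<omega>) (Y \<omega>)"
begin

definition \<kappa> :: real where "\<kappa> = real n * c"

lemma \<kappa>: "0 < \<kappa>" using n c by (simp add: \<kappa>_def)

abbreviation "S \<equiv> subgraph f (space \<nu>)"

abbreviation "Z \<equiv> \<nu> \<Otimes>\<^sub>M restrict_space lborel {0::real..}"

abbreviation count :: "('a \<times> real) set \<Rightarrow> 'w \<Rightarrow> ennreal" where "count B \<omega> \<equiv> emeasure (N \<omega>) B"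

abbreviation idx :: "('a \<times> real) set \<Rightarrow> 'w \<Rightarrow> nat set" where
  "idx B \<omega> \<equiv> point_indices S (N \<omega>) (X \<omega>) (Y \<omega>) B"

text \<open>Stated for an arbitrary set, so that one notion serves the whole cell, where it is
  \<open>cell_max\<close>, and the rectangle inside it.\<close>

definition peak :: "('a \<times> real) set \<Rightarrow> 'w \<Rightarrow> real" where
  "peak B \<omega> = (if count B \<omega> = 0 then 0 else (SUP i\<in>idx B \<omega>. Y \<omega> i))"

text \<open>Open below and closed above, so that cutting at a height gives disjoint bands; the lower
  end -1 admits points of height 0.\<close>

definition band :: "'a set \<Rightarrow> real \<Rightarrow> real \<Rightarrow> ('a \<times> real) set" where
  "band I a b = {(x, y). x \<in> I \<and> 0 \<le> y \<and> a < y \<and> y \<le> f x \<and> y \<le> b}"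

definition band_above :: "'a set \<Rightarrow> real \<Rightarrow> ('a \<times> real) set" where
  "band_above I a = {(x, y). x \<in> I \<and> 0 \<le> y \<and> a < y \<and> y \<le> f x}"

lemma sets_intensity: "sets (intensity \<nu> f c n) = sets Z" by (simp add: intensity_def)

lemma sets_N: "\<omega> \<in> space P \<Longrightarrow> sets (N \<omega>) = sets Z"
  using ppp[unfolded poisson_point_process_def, THEN conjunct1] by (simp add: sets_intensity)

lemma snd_Z[measurable]: "snd \<in> borel_measurable Z"
  by (rule measurable_compose[OF measurable_snd]) (simp add: measurable_restrict_space1)

lemma band_above_sets[measurable]: assumes [measurable]: "I \<in> sets \<nu>" shows "band_above I a \<in> sets Z"
proof -
  have "band_above I a = {z \<in> space Z. fst z \<in> I \<and> a < snd z \<and> snd z \<le> f (fst z)}"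
    using sets.sets_into_space[OF assms]
    by (auto simp: band_above_def space_pair_measure space_restrict_space)
  then show ?thesis by simp
qed

lemma band_sets[measurable]: assumes [measurable]: "I \<in> sets \<nu>" shows "band I a b \<in> sets Z"
proof -
  have "band I a b = band_above I a \<inter> {z \<in> space Z. snd z \<le> b}"
    using sets.sets_into_space[OF assms]
    by (auto simp: band_above_def band_def space_pair_measure space_restrict_space)
  then show ?thesis by simp
qed

lemma subgraph_eq_band_above: "subgraph f I = band_above I (-1)"
  by (auto simp: subgraph_def band_above_def)

lemma subgraph_sets[measurable]: "I \<in> sets \<nu> \<Longrightarrow> subgraph f I \<in> sets Z"
  by (simp add: subgraph_eq_band_above)

lemma count_measurable[measurable]: "B \<in> sets Z \<Longrightarrow> count B \<in> borel_measurable P"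
  using ppp[unfolded poisson_point_process_def, THEN conjunct2, THEN conjunct1] by (simp add: sets_intensity)

lemma count_idx: "\<omega> \<in> space P \<Longrightarrow> B \<in> sets Z \<Longrightarrow> count B \<omega> = emeasure (count_space UNIV) (idx B \<omega>)"
  using pts[of \<omega>] sets_N[of \<omega>] by (auto simp: has_points_def)

lemma count_eq_0_iff: "\<omega> \<in> space P \<Longrightarrow> B \<in> sets Z \<Longrightarrow> count B \<omega> = 0 \<longleftrightarrow> idx B \<omega> = {}"
  by (simp add: count_idx emeasure_count_space_eq_0)

lemma count_Un: "\<omega> \<in> space P \<Longrightarrow> A \<in> sets Z \<Longrightarrow> B \<in> sets Z \<Longrightarrow> A \<inter> B = {} \<Longrightarrow>
    count (A \<union> B) \<omega> = count A \<omega> + count B \<omega>"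
  using sets_N[of \<omega>] by (simp add: plus_emeasure)

text \<open>Expresses the peak through counts, which are measurable, although the enumeration
  \<open>Y\<close> comes without measurability. Thresholds t \<ge> 0 are compatible with the default
  peak 0 of an empty band.\<close>

lemma peak_le_iff:
  assumes "\<omega> \<in> space P" "I \<in> sets \<nu>" "0 \<le> t"
  shows "peak (band I a b) \<omega> \<le> t \<longleftrightarrow> count (band I (max a t) b) \<omega> = 0"
proof (cases "idx (band I a b) \<omega> = {}")
  case True
  then have "idx (band I (max a t) b) \<omega> = {}" by (auto simp: point_indices_def band_def)
  with True show ?thesis using assms by (simp add: peak_def count_eq_0_iff)
next
  case False
  have bdd: "bdd_above (Y \<omega> ` idx (band I a b) \<omega>)"
    by (rule bdd_aboveI[of _ b]) (auto simp: point_indices_def band_def)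
  have "peak (band I a b) \<omega> \<le> t \<longleftrightarrow> (\<forall>i\<in>idx (band I a b) \<omega>. Y \<omega> i \<le> t)"
    using False assms bdd by (simp add: peak_def count_eq_0_iff cSUP_le_iff)
  also have "\<dots> \<longleftrightarrow> idx (band I (max a t) b) \<omega> = {}"
    by (force simp: point_indices_def band_def)
  finally show ?thesis using assms by (simp add: count_eq_0_iff)
qed

lemma peak_range:
  assumes "\<omega> \<in> space P" "I \<in> sets \<nu>" "0 \<le> b"
  shows "0 \<le> peak (band I a b) \<omega>" "peak (band I a b) \<omega> \<le> b"
proof -
  show "peak (band I a b) \<omega> \<le> b"
  proof -
    have "band I (max a b) b = {}" by (auto simp: band_def)
    then show ?thesis using peak_le_iff[OF assms] by simp
  qed
  show "0 \<le> peak (band I a b) \<omega>"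
  proof (cases "idx (band I a b) \<omega> = {}")
    case True
    then show ?thesis using assms by (simp add: peak_def count_eq_0_iff)
  next
    case False
    then obtain i where i: "i \<in> idx (band I a b) \<omega>" by blast
    have "bdd_above (Y \<omega> ` idx (band I a b) \<omega>)"
      by (rule bdd_aboveI[of _ b]) (auto simp: point_indices_def band_def)
    from cSUP_upper[OF i this] show ?thesis
      using i False assms by (auto simp: peak_def count_eq_0_iff point_indices_def band_def)
  qed
qed

lemma peak_measurable[measurable]:
  assumes [measurable]: "I \<in> sets \<nu>" and "0 \<le> b" shows "peak (band I a b) \<in> borel_measurable P"
proof (subst borel_measurable_iff_le, intro allI)
  fix t
  show "{\<omega> \<in> space P. peak (band I a b) \<omega> \<le> t} \<in> sets P"
  proof (cases "0 \<le> t")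
    case True
    then have "{\<omega> \<in> space P. peak (band I a b) \<omega> \<le> t} = {\<omega> \<in> space P. count (band I (max a t) b) \<omega> = 0}"
      using peak_le_iff[OF _ assms(1)] by blast
    then show ?thesis by simp
  next
    case False
    have "\<not> peak (band I a b) \<omega> \<le> t" if "\<omega> \<in> space P" for \<omega>
      using peak_range(1)[OF that assms, of a] False by linarith
    then have "{\<omega> \<in> space P. peak (band I a b) \<omega> \<le> t} = {}" by blast
    then show ?thesis by (simp only: sets.empty_sets)
  qed
qed

text \<open>
  The heights of the points in a subgraph may be unbounded when there are infinitely many points; the
  supremum is then the constant \<open>Sup UNIV\<close>.
\<close>

lemma peak_subgraph_measurable[measurable]:
  assumes [measurable]: "I \<in> sets \<nu>" shows "peak (subgraph f I) \<in> borel_measurable P"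
proof -
  let ?D = "subgraph f I"
  \<comment> \<open>The event that the heights are bounded, written with counts above integer
    thresholds to keep it measurable.\<close>
  define Bd where "Bd = (\<Union>j::nat. {\<omega> \<in> space P. count (band_above I (real j)) \<omega> = 0})"
  have Bd[measurable]: "Bd \<in> sets P" unfolding Bd_def by measurable
  have D: "?D \<in> sets Z" by simp
  have above: "count (band_above I t) \<omega> = 0 \<longleftrightarrow> (\<forall>i\<in>idx ?D \<omega>. Y \<omega> i \<le> t)"
    if "\<omega> \<in> space P" for t \<omega>
    using that unfolding count_eq_0_iff[OF that band_above_sets[OF assms]]
    by (force simp: point_indices_def band_above_def subgraph_def)
  have bdd: "bdd_above (Y \<omega> ` idx ?D \<omega>) \<longleftrightarrow> \<omega> \<in> Bd" if "\<omega> \<in> space P" for \<omega>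
  proof
    assume "bdd_above (Y \<omega> ` idx ?D \<omega>)"
    then obtain t where t: "\<forall>i\<in>idx ?D \<omega>. Y \<omega> i \<le> t" by (auto simp: bdd_above_def)
    obtain j :: nat where "t \<le> real j" using real_arch_simple by blast
    with t have "\<forall>i\<in>idx ?D \<omega>. Y \<omega> i \<le> real j" by fastforce
    then show "\<omega> \<in> Bd" using that above by (auto simp: Bd_def)
  qed (use that above in \<open>auto simp: Bd_def bdd_above_def\<close>)
  have nonneg: "0 \<le> Y \<omega> i" if "i \<in> idx ?D \<omega>" for i \<omega>
    using that by (auto simp: point_indices_def subgraph_def)
  \<comment> \<open>\<open>Sup\<close> on the reals is defined by \<open>LEAST\<close> over upper
    bounds. Two sets without upper bound satisfy the same predicate there and so share one
    unspecified value.\<close>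
  have unb: "Sup A = Sup (UNIV :: real set)" if "\<not> bdd_above A" for A :: "real set"
  proof -
    have "\<not> (\<forall>x\<in>A. x \<le> z)" "\<not> (\<forall>x\<in>UNIV. x \<le> z)" for z :: real
      using that gt_ex[of z] by (auto simp: bdd_above_def not_le)
    then have "(\<forall>x\<in>A. x \<le> z) = (\<forall>x\<in>UNIV. x \<le> z)" for z :: real by blast
    then show ?thesis by (simp only: Sup_real_def)
  qed
  have "(\<lambda>\<omega>. if \<omega> \<in> Bd then peak ?D \<omega> else Sup UNIV) \<in> borel_measurable P"
  proof (subst borel_measurable_iff_le, intro allI)
    fix t
    have "{\<omega> \<in> space P. (if \<omega> \<in> Bd then peak ?D \<omega> else Sup UNIV) \<le> t}
      = (Bd \<inter> (if 0 \<le> t then {\<omega> \<in> space P. count (band_above I t) \<omega> = 0} else {}))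
        \<union> (if Sup UNIV \<le> t then space P - Bd else {})"
    proof -
      have "peak ?D \<omega> \<le> t \<longleftrightarrow> 0 \<le> t \<and> count (band_above I t) \<omega> = 0" if "\<omega> \<in> Bd" for \<omega>
      proof -
        have \<omega>: "\<omega> \<in> space P" using that by (auto simp: Bd_def)
        show ?thesis
        proof (cases "idx ?D \<omega> = {}")
          case True
          then show ?thesis using \<omega> above[OF \<omega>, of t] by (simp add: peak_def count_eq_0_iff)
        next
          case False
          then have "peak ?D \<omega> \<le> t \<longleftrightarrow> (\<forall>i\<in>idx ?D \<omega>. Y \<omega> i \<le> t)"
            using \<omega> bdd[OF \<omega>] that by (simp add: peak_def count_eq_0_iff cSUP_le_iff)
          moreover have "0 \<le> t" if "\<forall>i\<in>idx ?D \<omega>. Y \<omega> i \<le> t"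
            using False nonneg that by (meson all_not_in_conv order_trans)
          ultimately show ?thesis using above[OF \<omega>] by blast
        qed
      qed
      then show ?thesis using sets.sets_into_space[OF Bd] by auto
    qed
    also have "\<dots> \<in> sets P" by simp
    finally show "{\<omega> \<in> space P. (if \<omega> \<in> Bd then peak ?D \<omega> else Sup UNIV) \<le> t} \<in> sets P" .
  qed
  moreover have "peak ?D \<omega> = (if \<omega> \<in> Bd then peak ?D \<omega> else Sup UNIV)" if "\<omega> \<in> space P" for \<omega>
  proof (cases "\<omega> \<in> Bd")
    case False
    then have "\<not> bdd_above (Y \<omega> ` idx ?D \<omega>)" using bdd[OF that] by simp
    moreover from this have "idx ?D \<omega> \<noteq> {}" by auto
    ultimately show ?thesis using unb that False by (simp add: peak_def count_eq_0_iff)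
  qed simp
  ultimately show ?thesis by (simp cong: measurable_cong)
qed

lemma cell_max_eq_peak: "cell_max \<nu> f (N \<omega>) (X \<omega>) (Y \<omega>) I = peak (subgraph f I) \<omega>"
  by (simp add: cell_max_def peak_def)

lemma measure_measurable[measurable]: "B \<in> sets Z \<Longrightarrow> (\<lambda>\<omega>. measure (N \<omega>) B) \<in> borel_measurable P"
  unfolding measure_def by (rule measurable_compose[OF count_measurable borel_measurable_enn2real]) auto

lemma corrected_max_measurable[measurable]:
  assumes [measurable]: "I \<in> sets \<nu>"
  shows "(\<lambda>\<omega>. corrected_max \<nu> f (N \<omega>) (X \<omega>) (Y \<omega>) I) \<in> borel_measurable P"
  unfolding corrected_max_def cell_max_eq_peak
  by (intro borel_measurable_times borel_measurable_add borel_measurable_divide borel_measurable_const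
      measure_measurable subgraph_sets peak_subgraph_measurable assms)

section \<open>Intensity of bands and the law of their counts\<close>

abbreviation "E \<equiv> intensity \<nu> f c n"

text \<open>Integration over the heights first. For a set inside \<open>S\<close> the indicator of
  \<open>S\<close> disappears, and all slices lie in the nonnegative half line, so Lebesgue measure
  on the whole line can be used.\<close>

lemma emeasure_intensity:
  assumes B: "B \<in> sets Z" "B \<subseteq> S"
  shows "emeasure E B = (\<integral>\<^sup>+x. ennreal \<kappa> * emeasure lborel (Pair x -` B) \<partial>\<nu>)"
proof -
  interpret \<nu>: prob_space \<nu> by (rule \<nu>)
  interpret R: sigma_finite_measure "restrict_space lborel {0::real..}"
    by (rule sigma_finite_measure_restrict_space[OF sigma_finite_lborel]) simp
  have S[measurable]: "S \<in> sets Z" by simp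
  have slice: "Pair x -` B \<in> sets borel" "Pair x -` B \<subseteq> {0..}" for x
  proof -
    show "Pair x -` B \<subseteq> {0..}" using B(2) by (auto simp: subgraph_def)
    have "Pair x -` B \<in> sets (restrict_space lborel {0::real..})"
      by (rule sets_Pair1[OF B(1)])
    then show "Pair x -` B \<in> sets borel" by (auto simp: sets_restrict_space_iff)
  qed
  have "emeasure E B = (\<integral>\<^sup>+z. ennreal \<kappa> * indicator S z * indicator B z \<partial>Z)"
    unfolding intensity_def \<kappa>_def using B(1) by (subst emeasure_density) auto
  also have "\<dots> = (\<integral>\<^sup>+z. ennreal \<kappa> * indicator B z \<partial>Z)"
    using B(2) by (intro nn_integral_cong) (auto simp: indicator_def)
  also have "\<dots> = ennreal \<kappa> * emeasure Z B"
    using B(1) by (rule nn_integral_cmult_indicator)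
  also have "emeasure Z B = (\<integral>\<^sup>+x. emeasure (restrict_space lborel {0..}) (Pair x -` B) \<partial>\<nu>)"
    by (rule R.emeasure_pair_measure_alt[OF B(1)])
  also have "\<dots> = (\<integral>\<^sup>+x. emeasure lborel (Pair x -` B) \<partial>\<nu>)"
    using slice by (intro nn_integral_cong) (simp add: emeasure_restrict_space)
  also have "ennreal \<kappa> * \<dots> = (\<integral>\<^sup>+x. ennreal \<kappa> * emeasure lborel (Pair x -` B) \<partial>\<nu>)"
  proof (rule nn_integral_cmult[symmetric])
    have "(\<lambda>x. emeasure (restrict_space lborel {0..}) (Pair x -` B)) \<in> borel_measurable \<nu>"
      by (rule R.measurable_emeasure_Pair[OF B(1)])
    then show "(\<lambda>x. emeasure lborel (Pair x -` B)) \<in> borel_measurable \<nu>"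
      using slice by (simp add: emeasure_restrict_space)
  qed
  finally show ?thesis .
qed

lemma band_subset: "I \<in> sets \<nu> \<Longrightarrow> band I a b \<subseteq> S" "I \<in> sets \<nu> \<Longrightarrow> band_above I a \<subseteq> S"
  using sets.sets_into_space[of I \<nu>] by (auto simp: band_def band_above_def subgraph_def)

lemma band_slice:
  "Pair x -` band I a b \<subseteq> (if x \<in> I then {max 0 a..b} else {})"
  "x \<in> I \<Longrightarrow> b \<le> f x \<Longrightarrow> {max 0 a<..b} \<subseteq> Pair x -` band I a b"
  by (auto simp: band_def)

lemma band_slice_sets: "I \<in> sets \<nu> \<Longrightarrow> Pair x -` band I a b \<in> sets borel"
proof -
  have "Pair x -` band I a b = (if x \<in> I then {0..} \<inter> {a<..} \<inter> {..f x} \<inter> {..b} else {})"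
    by (auto simp: band_def)
  then show ?thesis by simp
qed

lemma nn_integral_indicator_const:
  "I \<in> sets \<nu> \<Longrightarrow> 0 \<le> t \<Longrightarrow> (\<integral>\<^sup>+x. ennreal \<kappa> * (ennreal t * indicator I x) \<partial>\<nu>) = ennreal (\<kappa> * t * measure \<nu> I)"
proof -
  interpret \<nu>: prob_space \<nu> by (rule \<nu>)
  assume I: "I \<in> sets \<nu>" "0 \<le> t"
  then show ?thesis
    using \<kappa> by (simp add: nn_integral_cmult nn_integral_cmult_indicator \<nu>.emeasure_eq_measure ennreal_mult mult.assoc)
qed

lemma emeasure_band_le:
  assumes I: "I \<in> sets \<nu>" and ab: "max 0 a \<le> b"
  shows "emeasure E (band I a b) \<le> ennreal (\<kappa> * (b - max 0 a) * measure \<nu> I)"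
proof -
  have "emeasure E (band I a b) = (\<integral>\<^sup>+x. ennreal \<kappa> * emeasure lborel (Pair x -` band I a b) \<partial>\<nu>)"
    using I by (intro emeasure_intensity band_subset) auto
  also have "\<dots> \<le> (\<integral>\<^sup>+x. ennreal \<kappa> * (ennreal (b - max 0 a) * indicator I x) \<partial>\<nu>)"
  proof (intro nn_integral_mono mult_left_mono)
    fix x
    have "emeasure lborel (Pair x -` band I a b) \<le> emeasure lborel (if x \<in> I then {max 0 a..b} else {})"
      by (intro emeasure_mono band_slice(1)) auto
    also have "\<dots> = ennreal (b - max 0 a) * indicator I x" using ab by (auto simp: indicator_def)
    finally show "emeasure lborel (Pair x -` band I a b) \<le> ennreal (b - max 0 a) * indicator I x" .
  qed simp
  also have "\<dots> = ennreal (\<kappa> * (b - max 0 a) * measure \<nu> I)"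
    using I ab by (intro nn_integral_indicator_const) auto
  finally show ?thesis .
qed

text \<open>Slices are never longer than b - max 0 a. If b lies below f almost everywhere on I,
  almost every slice over I contains the half-open interval of that length, and the band has the
  area of a rectangle.\<close>

lemma emeasure_band:
  assumes I: "I \<in> sets \<nu>" and ab: "max 0 a \<le> b" and above: "AE x in \<nu>. x \<in> I \<longrightarrow> b \<le> f x"
  shows "emeasure E (band I a b) = ennreal (\<kappa> * (b - max 0 a) * measure \<nu> I)"
proof (rule antisym[OF emeasure_band_le[OF I ab]])
  have "ennreal (\<kappa> * (b - max 0 a) * measure \<nu> I) = (\<integral>\<^sup>+x. ennreal \<kappa> * (ennreal (b - max 0 a) * indicator I x) \<partial>\<nu>)"
    using I ab by (intro nn_integral_indicator_const[symmetric]) auto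
  also have "\<dots> \<le> (\<integral>\<^sup>+x. ennreal \<kappa> * emeasure lborel (Pair x -` band I a b) \<partial>\<nu>)"
  proof (rule nn_integral_mono_AE)
    show "AE x in \<nu>. ennreal \<kappa> * (ennreal (b - max 0 a) * indicator I x) \<le> ennreal \<kappa> * emeasure lborel (Pair x -` band I a b)"
      using above
    proof eventually_elim
      case (elim x)
      have "ennreal (b - max 0 a) * indicator I x \<le> emeasure lborel (Pair x -` band I a b)"
      proof (cases "x \<in> I")
        case True
        have "ennreal (b - max 0 a) = emeasure lborel {max 0 a<..b}" using ab by simp
        also have "\<dots> \<le> emeasure lborel (Pair x -` band I a b)"
          using True elim band_slice_sets[OF I] by (intro emeasure_mono band_slice(2)) auto
        finally show ?thesis using True by simp
      qed simp
      then show ?case by (intro mult_left_mono) auto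
    qed
  qed
  also have "\<dots> = emeasure E (band I a b)"
    using I by (intro emeasure_intensity[symmetric] band_subset) auto
  finally show "ennreal (\<kappa> * (b - max 0 a) * measure \<nu> I) \<le> emeasure E (band I a b)" .
qed

lemma emeasure_band_above_null:
  assumes I: "I \<in> sets \<nu>" and below: "AE x in \<nu>. x \<in> I \<longrightarrow> f x \<le> a"
  shows "emeasure E (band_above I a) = 0"
proof -
  have "emeasure E (band_above I a) = (\<integral>\<^sup>+x. ennreal \<kappa> * emeasure lborel (Pair x -` band_above I a) \<partial>\<nu>)"
    using I by (intro emeasure_intensity band_subset) auto
  also have "\<dots> = (\<integral>\<^sup>+x. 0 \<partial>\<nu>)"
  proof (rule nn_integral_cong_AE)
    show "AE x in \<nu>. ennreal \<kappa> * emeasure lborel (Pair x -` band_above I a) = 0"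
      using below
    proof eventually_elim
      case (elim x)
      then have "Pair x -` band_above I a = {}" by (auto simp: band_above_def)
      then show ?case by (simp only: emeasure_empty mult_zero_right)
    qed
  qed
  finally show ?thesis by simp
qed

lemma emeasure_S:
  assumes "integrable \<nu> f" shows "emeasure E S = ennreal (\<kappa> * (\<integral>x. f x \<partial>\<nu>))"
proof -
  have "emeasure E S = (\<integral>\<^sup>+x. ennreal \<kappa> * emeasure lborel (Pair x -` S) \<partial>\<nu>)"
    by (intro emeasure_intensity) auto
  also have "\<dots> = (\<integral>\<^sup>+x. ennreal \<kappa> * ennreal (f x) \<partial>\<nu>)"
  proof (intro nn_integral_cong)
    fix x assume "x \<in> space \<nu>"
    then have "Pair x -` S = {0..f x}" by (auto simp: subgraph_def)
    then show "ennreal \<kappa> * emeasure lborel (Pair x -` S) = ennreal \<kappa> * ennreal (f x)"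
      using f_nonneg[OF \<open>x \<in> space \<nu>\<close>] by simp
  qed
  also have "\<dots> = ennreal \<kappa> * ennreal (\<integral>x. f x \<partial>\<nu>)"
    using assms f_nonneg by (simp add: nn_integral_cmult nn_integral_eq_integral)
  finally show ?thesis using \<kappa> f_nonneg by (simp add: ennreal_mult integral_nonneg_AE)
qed

lemma prob_count:
  assumes "B \<in> sets Z" "emeasure E B = ennreal \<mu>" "0 \<le> \<mu>"
  shows "prob {\<omega> \<in> space P. count B \<omega> = of_nat j} = exp (- \<mu>) * \<mu> ^ j / fact j"
proof -
  have "measure E B = \<mu>" using assms by (simp add: measure_def)
  then show ?thesis
    using ppp[unfolded poisson_point_process_def, THEN conjunct2, THEN conjunct2, THEN conjunct1] assms
    by (simp add: sets_intensity)
qed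

text \<open>The Poisson weights add up to 1, so an infinite count has probability 0.\<close>

lemma AE_count_nat:
  assumes B: "B \<in> sets Z" and fin: "emeasure E B < \<infinity>"
  shows "AE \<omega> in P. \<exists>j::nat. count B \<omega> = of_nat j"
proof -
  obtain \<mu> where \<mu>: "emeasure E B = ennreal \<mu>" "0 \<le> \<mu>" using fin by (cases "emeasure E B") auto
  note [measurable] = B
  have "(\<lambda>j. prob {\<omega> \<in> space P. count B \<omega> = of_nat j}) sums prob (\<Union>j. {\<omega> \<in> space P. count B \<omega> = of_nat j})"
    by (intro finite_measure_UNION) (auto simp: disjoint_family_on_def)
  moreover have "(\<lambda>j. prob {\<omega> \<in> space P. count B \<omega> = of_nat j}) sums 1"
    using sums_mult[OF exp_converges[of \<mu>], of "exp (- \<mu>)"]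
    by (simp add: prob_count[OF B \<mu>] exp_add[symmetric] divide_inverse mult_ac)
  ultimately have "prob (\<Union>j. {\<omega> \<in> space P. count B \<omega> = of_nat j}) = 1" by (rule sums_unique2)
  then have "AE \<omega> in P. \<omega> \<in> (\<Union>j. {\<omega> \<in> space P. count B \<omega> = of_nat j})"
    by (intro AE_in_set_eq_1[THEN iffD2]) auto
  then show ?thesis by eventually_elim auto
qed

section \<open>Independence of counts and peaks over disjoint bands\<close>

lemma indep_counts:
  assumes "finite J" "\<And>j. j \<in> J \<Longrightarrow> A j \<in> sets Z" "disjoint_family_on A J"
  shows "indep_vars (\<lambda>_. borel) (\<lambda>j::nat. count (A j)) J"
  using ppp[unfolded poisson_point_process_def, THEN conjunct2, THEN conjunct2, THEN conjunct2, THEN conjunct2] assms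
  by (simp add: sets_intensity)

lemma count_band_split:
  assumes "\<omega> \<in> space P" "I \<in> sets \<nu>"
  shows "count (band I a b) \<omega> = count (band I a (min b t)) \<omega> + count (band I (max a t) b) \<omega>"
proof -
  have "band I a b = band I a (min b t) \<union> band I (max a t) b" by (auto simp: band_def)
  moreover have "band I a (min b t) \<inter> band I (max a t) b = {}" by (auto simp: band_def)
  ultimately show ?thesis
    using assms count_Un[OF assms(1), of "band I a (min b t)" "band I (max a t) b"] by simp
qed

text \<open>If nothing lies above t, all points of the band are in its lower part. Joint events of
  count and peak thus become events of two counts over disjoint sets.\<close>

lemma joint_event_eq:
  assumes "I \<in> sets \<nu>" "0 \<le> t"
  shows "{\<omega> \<in> space P. count (band I a b) \<omega> \<in> A \<and> peak (band I a b) \<omega> \<le> t}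
    = {\<omega> \<in> space P. count (band I a (min b t)) \<omega> \<in> A \<and> count (band I (max a t) b) \<omega> = 0}"
proof -
  have "count (band I a b) \<omega> \<in> A \<and> peak (band I a b) \<omega> \<le> t \<longleftrightarrow>
      count (band I a (min b t)) \<omega> \<in> A \<and> count (band I (max a t) b) \<omega> = 0" if "\<omega> \<in> space P" for \<omega>
    unfolding peak_le_iff[OF that assms] count_band_split[OF that assms(1), of a b t] by auto
  then show ?thesis by blast
qed

text \<open>
  The events \<open>count \<in> A \<and> peak \<le> t\<close> are stable under intersection and depend only on the counts of the
  two parts of the band below and above \<open>t\<close>.
\<close>

lemma indep_bands:
  fixes J :: "nat set" and I :: "nat \<Rightarrow> 'a set" and a b :: "nat \<Rightarrow> real"
  assumes J: "finite J" and I: "\<And>j. j \<in> J \<Longrightarrow> I j \<in> sets \<nu>" and b: "\<And>j. j \<in> J \<Longrightarrow> 0 \<le> b j"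
    and disj: "disjoint_family_on (\<lambda>j. band (I j) (a j) (b j)) J"
  defines "R \<equiv> \<lambda>j \<omega>. (count (band (I j) (a j) (b j)) \<omega>, peak (band (I j) (a j) (b j)) \<omega>)"
  shows "indep_vars (\<lambda>_. borel \<Otimes>\<^sub>M borel) R J"
proof -
  let ?B = "\<lambda>j. band (I j) (a j) (b j)"
  define G where "G j = {{\<omega> \<in> space P. count (?B j) \<omega> \<in> A \<and> peak (?B j) \<omega> \<le> t} |A t. A \<in> sets borel \<and> 0 \<le> t}" for j
  have Bs[measurable]: "?B j \<in> sets Z" if "j \<in> J" for j using I that by simp
  have peak_m[measurable]: "peak (?B j) \<in> borel_measurable P" if "j \<in> J" for j
    using I b that by simp
  have G_events: "G j \<subseteq> events" if "j \<in> J" for j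
  proof -
    note [measurable] = count_measurable[OF Bs[OF that]] peak_m[OF that]
    have "{\<omega> \<in> space P. count (?B j) \<omega> \<in> A \<and> peak (?B j) \<omega> \<le> t} \<in> events"
      if [measurable]: "A \<in> sets borel" for A t
      by measurable
    then show ?thesis unfolding G_def by blast
  qed
  have "indep_sets G J"
  proof (rule indep_setsI[OF G_events])
    fix Q K assume K: "K \<noteq> {}" "K \<subseteq> J" "finite K" "\<forall>j\<in>K. Q j \<in> G j"
    then have "\<forall>j\<in>K. \<exists>q. Q j = {\<omega> \<in> space P. count (?B j) \<omega> \<in> fst q \<and> peak (?B j) \<omega> \<le> snd q}
        \<and> fst q \<in> sets borel \<and> 0 \<le> snd q"
      by (simp add: G_def)
    from bchoice[OF this] obtain q where q: "\<forall>j\<in>K. Q j = {\<omega> \<in> space P. count (?B j) \<omega> \<in> fst (q j) \<and> peak (?B j) \<omega> \<le> snd (q j)}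
        \<and> fst (q j) \<in> sets borel \<and> 0 \<le> snd (q j)" ..
    define A where "A j = fst (q j)" for j
    define t where "t j = snd (q j)" for j
    have Q: "Q j = {\<omega> \<in> space P. count (?B j) \<omega> \<in> A j \<and> peak (?B j) \<omega> \<le> t j}"
      and A: "A j \<in> sets borel" and t: "0 \<le> t j" if "j \<in> K" for j
      using q that by (simp_all add: A_def t_def)
    \<comment> \<open>The two parts of every band are listed in one family over the naturals, index
      2 j for the part up to t j and 2 j + 1 for the part above, because the independence of counts
      is stated for such families. The blocks \<open>L j\<close> regroup them.\<close>
    define C where "C i = (if even i then band (I (i div 2)) (a (i div 2)) (min (b (i div 2)) (t (i div 2)))
        else band (I (i div 2)) (max (a (i div 2)) (t (i div 2))) (b (i div 2)))" for i
    define L where "L j = {2 * j, Suc (2 * j)}" for j :: nat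
    have L: "disjoint_family_on L K" by (auto simp: disjoint_family_on_def L_def)
    have C_sub: "C i \<subseteq> ?B (i div 2)" for i by (auto simp: C_def band_def)
    have "indep_vars (\<lambda>_. borel) (\<lambda>i. count (C i)) (\<Union>j\<in>K. L j)"
    proof (rule indep_counts)
      show "finite (\<Union>j\<in>K. L j)" using K by (simp add: L_def)
      show "C i \<in> sets Z" if "i \<in> (\<Union>j\<in>K. L j)" for i
        using that I K by (auto simp: C_def L_def)
      show "disjoint_family_on C (\<Union>j\<in>K. L j)"
        unfolding disjoint_family_on_def
      proof (intro ballI impI)
        fix i i' assume i: "i \<in> (\<Union>j\<in>K. L j)" "i' \<in> (\<Union>j\<in>K. L j)" "i \<noteq> i'"
        then have d: "i div 2 \<in> J" "i' div 2 \<in> J" using K by (auto simp: L_def)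
        show "C i \<inter> C i' = {}"
        proof (cases "i div 2 = i' div 2")
          case False
          then have "?B (i div 2) \<inter> ?B (i' div 2) = {}"
            using disj d unfolding disjoint_family_on_def by blast
          with C_sub[of i] C_sub[of i'] show ?thesis by blast
        next
          case True
          with \<open>i \<noteq> i'\<close> have "even i \<noteq> even i'" by (metis odd_two_times_div_two_succ even_two_times_div_two)
          with True show ?thesis by (auto simp: C_def band_def)
        qed
      qed
    qed
    from indep_vars_restrict[OF this _ L]
    have ind: "indep_vars (\<lambda>j. PiM (L j) (\<lambda>_. borel)) (\<lambda>j \<omega>. restrict (\<lambda>i. count (C i) \<omega>) (L j)) K"
      by blast
    define W where "W j = {w \<in> space (PiM (L j) (\<lambda>_. borel)). w (2 * j) \<in> A j \<and> w (Suc (2 * j)) = (0 :: ennreal)}" for j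
    have W: "W j \<in> sets (PiM (L j) (\<lambda>_. borel))" if "j \<in> K" for j
    proof -
      have [measurable]: "(\<lambda>w. w (2 * j)) \<in> measurable (PiM (L j) (\<lambda>_. borel)) borel"
        "(\<lambda>w. w (Suc (2 * j)) :: ennreal) \<in> borel_measurable (PiM (L j) (\<lambda>_. borel))"
        by (auto simp: L_def intro!: measurable_component_singleton)
      show ?thesis unfolding W_def using A[OF that] by measurable
    qed
    have Q': "Q j = {\<omega> \<in> space P. count (C (2 * j)) \<omega> \<in> A j \<and> count (C (Suc (2 * j))) \<omega> = 0}"
      if "j \<in> K" for j
    proof -
      have "j \<in> J" using that K by blast
      then show ?thesis unfolding Q[OF that] joint_event_eq[OF I[OF \<open>j \<in> J\<close>] t[OF that]] by (simp add: C_def)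
    qed
    have pre: "(\<lambda>\<omega>. restrict (\<lambda>i. count (C i) \<omega>) (L j)) -` W j \<inter> space P = Q j" if "j \<in> K" for j
      unfolding Q'[OF that] by (auto simp: W_def L_def space_PiM)
    have "prob (\<Inter>j\<in>K. Q j) = prob (\<Inter>j\<in>K. (\<lambda>\<omega>. restrict (\<lambda>i. count (C i) \<omega>) (L j)) -` W j \<inter> space P)"
      by (intro arg_cong[where f = prob] INF_cong refl pre[symmetric])
    also have "\<dots> = (\<Prod>j\<in>K. prob ((\<lambda>\<omega>. restrict (\<lambda>i. count (C i) \<omega>) (L j)) -` W j \<inter> space P))"
      by (rule indep_varsD_finite[OF ind K(1,3) W])
    also have "\<dots> = (\<Prod>j\<in>K. prob (Q j))"
      by (intro prod.cong refl arg_cong[where f = prob] pre)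
    finally show "prob (\<Inter>j\<in>K. Q j) = (\<Prod>j\<in>K. prob (Q j))" .
  qed
  moreover have "Int_stable (G j)" for j
  proof (rule Int_stableI)
    fix Q Q' assume "Q \<in> G j" "Q' \<in> G j"
    then obtain A t A' t' where
      "Q = {\<omega> \<in> space P. count (?B j) \<omega> \<in> A \<and> peak (?B j) \<omega> \<le> t}" "A \<in> sets borel" "0 \<le> t"
      "Q' = {\<omega> \<in> space P. count (?B j) \<omega> \<in> A' \<and> peak (?B j) \<omega> \<le> t'}" "A' \<in> sets borel" "0 \<le> t'"
      by (auto simp: G_def)
    then have "Q \<inter> Q' = {\<omega> \<in> space P. count (?B j) \<omega> \<in> A \<inter> A' \<and> peak (?B j) \<omega> \<le> min t t'}"
      "A \<inter> A' \<in> sets borel" "0 \<le> min t t'" by auto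
    then show "Q \<inter> Q' \<in> G j" unfolding G_def by blast
  qed
  ultimately have ind: "indep_sets (\<lambda>j. sigma_sets (space P) (G j)) J"
    by (intro indep_sets_sigma)
  \<comment> \<open>Once count and peak are measurable for the sigma-algebra generated by
    \<open>G j\<close>, the independence of these sigma-algebras passes to the pairs.\<close>
  have Rm: "R j \<in> measurable (sigma (space P) (G j)) (borel \<Otimes>\<^sub>M borel)" if j: "j \<in> J" for j
  proof -
    have Gs: "G j \<subseteq> Pow (space P)" by (auto simp: G_def)
    have basic: "{\<omega> \<in> space P. count (?B j) \<omega> \<in> A \<and> peak (?B j) \<omega> \<le> t} \<in> sets (sigma (space P) (G j))"
      if "A \<in> sets borel" "0 \<le> t" for A t
      using that Gs by (auto simp: G_def intro!: in_measure_of)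
    have "count (?B j) \<in> borel_measurable (sigma (space P) (G j))"
    proof (rule measurableI)
      fix A :: "ennreal set" assume "A \<in> sets borel"
      \<comment> \<open>The threshold b j imposes nothing on the peak, so events of the count alone
        are in the generator.\<close>
      moreover have "count (?B j) -` A \<inter> space (sigma (space P) (G j))
          = {\<omega> \<in> space P. count (?B j) \<omega> \<in> A \<and> peak (?B j) \<omega> \<le> b j}"
        using peak_range(2)[OF _ I[OF j] b[OF j]] Gs by (auto simp: space_measure_of)
      ultimately show "count (?B j) -` A \<inter> space (sigma (space P) (G j)) \<in> sets (sigma (space P) (G j))"
        using basic b[OF j] by simp
    qed simp
    moreover have "peak (?B j) \<in> borel_measurable (sigma (space P) (G j))"
    proof (subst borel_measurable_iff_le, intro allI)
      fix t
      show "{\<omega> \<in> space (sigma (space P) (G j)). peak (?B j) \<omega> \<le> t} \<in> sets (sigma (space P) (G j))"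
      proof (cases "0 \<le> t")
        case True
        then show ?thesis using basic[of UNIV t] Gs by (simp add: space_measure_of)
      next
        case False
        have "\<not> peak (?B j) \<omega> \<le> t" if "\<omega> \<in> space P" for \<omega>
          using peak_range(1)[OF that I[OF j] b[OF j], of "a j"] False by linarith
        then have "{\<omega> \<in> space (sigma (space P) (G j)). peak (?B j) \<omega> \<le> t} = {}"
          using Gs by (auto simp: space_measure_of)
        then show ?thesis by (simp only: sets.empty_sets)
      qed
    qed
    ultimately show ?thesis unfolding R_def by (rule measurable_Pair)
  qed
  show ?thesis
    unfolding indep_vars_def
  proof (intro conjI ballI)
    fix j assume j: "j \<in> J"
    show "R j \<in> measurable P (borel \<Otimes>\<^sub>M borel)"
      unfolding R_def using count_measurable[OF Bs[OF j]] peak_m[OF j] by (rule measurable_Pair)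
  next
    show "indep_sets (\<lambda>j. sigma_sets (space P) {R j -` A \<inter> space P |A. A \<in> sets (borel \<Otimes>\<^sub>M borel)}) J"
    proof (rule indep_sets_mono_sets[OF ind])
      fix j assume j: "j \<in> J"
      have Gs: "G j \<subseteq> Pow (space P)" by (auto simp: G_def)
      show "sigma_sets (space P) {R j -` A \<inter> space P |A. A \<in> sets (borel \<Otimes>\<^sub>M borel)} \<subseteq> sigma_sets (space P) (G j)"
      proof (rule sigma_sets_mono, safe)
        fix A :: "(ennreal \<times> real) set" assume "A \<in> sets (borel \<Otimes>\<^sub>M borel)"
        from measurable_sets[OF Rm[OF j] this]
        show "R j -` A \<inter> space P \<in> sigma_sets (space P) (G j)"
          using Gs by (simp add: space_measure_of sets_measure_of)
      qed
    qed
  qed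
qed

end

section \<open>A single cell and the rectangle below its essential infimum\<close>

locale graph_cell = graph_process P \<nu> f c n N X Y
  for P :: "'w measure" and \<nu> :: "'a measure" and f c n N X Y +
  fixes I :: "'a set" and h H :: real
  assumes I[measurable]: "I \<in> sets \<nu>" and I_pos: "0 < measure \<nu> I"
    and h_pos: "0 < h" and hH: "h \<le> H"
    and lower: "AE x in \<nu>. x \<in> I \<longrightarrow> h \<le> f x" and upper: "AE x in \<nu>. x \<in> I \<longrightarrow> f x \<le> H"
begin

definition \<theta> :: real where "\<theta> = \<kappa> * measure \<nu> I"

lemma \<theta>: "0 < \<theta>" using \<kappa> I_pos by (simp add: \<theta>_def)

abbreviation "rect \<equiv> band I (-1) h"

definition num :: "'w \<Rightarrow> real" where "num \<omega> = measure (N \<omega>) rect"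

definition gap :: "'w \<Rightarrow> real" where "gap \<omega> = \<theta> * (h - peak rect \<omega>)"

lemma num_measurable[measurable]: "num \<in> borel_measurable P"
  unfolding num_def[abs_def] by (rule measure_measurable[OF band_sets[OF I]])

lemma gap_measurable[measurable]: "gap \<in> borel_measurable P"
  unfolding gap_def[abs_def] using peak_measurable[OF I less_imp_le[OF h_pos]] by measurable

lemma AE_above: "t \<le> h \<Longrightarrow> AE x in \<nu>. x \<in> I \<longrightarrow> t \<le> f x"
  using lower by eventually_elim auto

text \<open>With t = h - u / \<theta>, the gap is at least u exactly when nothing lies above t. The
  bands below and above t have intensities \<theta> t and u and independent counts, and the two
  exponential factors combine to exp (- \<theta> h).\<close>

lemma joint_law:
  assumes u: "0 \<le> u" "u \<le> \<theta> * h"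
  shows "prob {\<omega>\<in>space P. num \<omega> = real j \<and> u \<le> gap \<omega>} = exp (- (\<theta> * h)) * (\<theta> * h - u) ^ j / fact j"
proof -
  define t where "t = h - u / \<theta>"
  have t: "0 \<le> t" "t \<le> h" using u \<theta> by (auto simp: t_def field_simps)
  have gap_iff: "u \<le> gap \<omega> \<longleftrightarrow> peak rect \<omega> \<le> t" for \<omega>
    using \<theta> by (auto simp: gap_def t_def field_simps)
  define B where "B i = (if i = 0 then band I (-1) t else band I t h)" for i :: nat
  have B: "B i \<in> sets Z" for i by (simp add: B_def)
  have e0: "emeasure E (B 0) = ennreal (\<theta> * t)"
    using emeasure_band[OF I _ AE_above, of "-1" t] t by (simp add: B_def \<theta>_def mult_ac)
  have e1: "emeasure E (B 1) = ennreal (\<theta> * (h - t))"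
    using emeasure_band[OF I _ AE_above, of t h] t by (simp add: B_def \<theta>_def mult_ac)
  have "emeasure E rect = ennreal (\<theta> * h)"
    using emeasure_band[OF I _ AE_above, of "-1" h] h_pos by (simp add: \<theta>_def mult_ac)
  \<comment> \<open>\<open>measure\<close> sends an infinite count to 0, so infinite counts have to
    be excluded before \<open>num\<close> = 0 can be read as an empty rectangle.\<close>
  then have "AE \<omega> in P. \<exists>i::nat. count rect \<omega> = of_nat i"
    by (intro AE_count_nat) auto
  then have "prob {\<omega>\<in>space P. num \<omega> = real j \<and> u \<le> gap \<omega>}
      = prob {\<omega> \<in> space P. count rect \<omega> \<in> {of_nat j} \<and> peak rect \<omega> \<le> t}"
  proof (intro finite_measure_eq_AE, goal_cases)
    case 1
    then show ?case
      by eventually_elim (auto simp: gap_iff num_def measure_def enn2real_of_nat ennreal_of_nat_eq_real_of_nat)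
  next
    case 2
    show ?case by measurable
  next
    case 3
    show ?case using count_measurable[OF band_sets[OF I]] peak_measurable[OF I less_imp_le[OF h_pos]] by measurable
  qed
  also have "{\<omega> \<in> space P. count rect \<omega> \<in> {of_nat j} \<and> peak rect \<omega> \<le> t}
      = {\<omega> \<in> space P. count (B 0) \<omega> \<in> {of_nat j} \<and> count (B 1) \<omega> = 0}"
    unfolding joint_event_eq[OF I t(1)] using t by (simp add: B_def min_absorb2 max_absorb2)
  also have "\<dots> = (\<Inter>i\<in>{0, 1}. count (B i) -` {of_nat (if i = 0 then j else 0)} \<inter> space P)"
    by auto
  also have "prob \<dots> = (\<Prod>i\<in>{0, 1}. prob (count (B i) -` {of_nat (if i = 0 then j else 0)} \<inter> space P))"
  proof (rule indep_varsD_finite[where M' = "\<lambda>_. borel"])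
    show "indep_vars (\<lambda>_. borel) (\<lambda>i. count (B i)) {0, 1}"
      by (rule indep_counts) (use B in \<open>auto simp: disjoint_family_on_def B_def band_def\<close>)
  qed auto
  also have "\<dots> = prob {\<omega>\<in>space P. count (B 0) \<omega> = of_nat j} * prob {\<omega>\<in>space P. count (B 1) \<omega> = of_nat 0}"
    by (simp add: vimage_def Int_def conj_commute)
  also have "\<dots> = exp (- (\<theta> * t)) * (\<theta> * t) ^ j / fact j * exp (- (\<theta> * (h - t)))"
    using prob_count[OF B e0, of j] prob_count[OF B e1, of 0] t \<theta> by simp
  also have "\<dots> = (exp (- (\<theta> * t)) * exp (- (\<theta> * (h - t)))) * (\<theta> * t) ^ j / fact j" by simp
  also have "exp (- (\<theta> * t)) * exp (- (\<theta> * (h - t))) = exp (- (\<theta> * h))"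
    by (simp add: exp_add[symmetric] algebra_simps)
  also have "\<theta> * t = \<theta> * h - u" using \<theta> by (simp add: t_def field_simps)
  finally show ?thesis .
qed

sublocale poisson_rectangle P num gap "\<theta> * h"
proof unfold_locales
  show "0 \<le> gap \<omega> \<and> gap \<omega> \<le> \<theta> * h" if "\<omega> \<in> space P" for \<omega>
    using peak_range[OF that I less_imp_le[OF h_pos], of "-1"] \<theta> by (auto simp: gap_def)
qed (use joint_law \<theta> h_pos in auto)

lemma peak_rect: "\<theta> * peak rect \<omega> = \<theta> * h - gap \<omega>"
  by (simp add: gap_def algebra_simps)

end

text \<open>\<open>Y'\<close> and \<open>i\<close> belong to the rectangle, \<open>Y\<close> and
  \<open>i + e\<close> to the whole cell. The higher peak and the larger denominator act in opposite
  directions, so the difference is A - B with A and B nonnegative, and each is bounded separately.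
  For i = 0 the quotients by i are 0.\<close>

lemma corrected_difference_bound:
  fixes Y Y' h H :: real and i e :: nat
  assumes "0 \<le> Y'" "Y' \<le> h" "h \<le> H" "Y' \<le> Y" "Y \<le> H" "1 \<le> e" "i = 0 \<Longrightarrow> Y' = 0"
  shows "\<bar>(1 + 1 / real (i + e)) * Y - (1 + 1 / real i) * Y'\<bar> \<le> 2 * (H - h) + 2 * (h - Y') + Y' / real i"
proof (cases "i = 0")
  case True
  have "1 / real e \<le> 1" using assms by simp
  then have "(1 + 1 / real e) * Y \<le> 2 * Y" using assms by (intro mult_right_mono) auto
  moreover have "0 \<le> (1 + 1 / real e) * Y" using assms by simp
  ultimately show ?thesis using True assms by simp
next
  case False
  have ne: "1 / real (i + e) \<le> 1" "1 / real (i + e) \<le> 1 / real i" using False assms by (auto simp: field_simps)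
  define A where "A = (1 + 1 / real (i + e)) * (Y - Y')"
  define B where "B = (1 / real i - 1 / real (i + e)) * Y'"
  have "A \<le> 2 * (Y - Y')" unfolding A_def using ne assms by (intro mult_right_mono) auto
  moreover have "0 \<le> A" unfolding A_def using assms by simp
  moreover have "B \<le> 1 / real i * Y'" unfolding B_def using assms by (intro mult_right_mono) auto
  moreover have "0 \<le> B" unfolding B_def using ne assms by simp
  moreover have "(1 + 1 / real (i + e)) * Y - (1 + 1 / real i) * Y' = A - B"
    by (simp add: A_def B_def algebra_simps diff_divide_distrib)
  ultimately show ?thesis using assms(1-5) by (simp add: abs_le_iff)
qed

section \<open>From the whole cell to its rectangle\<close>

context graph_cell
begin

abbreviation "extra \<equiv> band I h H"

definition W :: "'w \<Rightarrow> real" where "W \<omega> = corrected_max \<nu> f (N \<omega>) (X \<omega>) (Y \<omega>) I"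

lemma W_measurable[measurable]: "W \<in> borel_measurable P"
  unfolding W_def[abs_def] using I by (rule corrected_max_measurable)

lemma W_eq: "W \<omega> = (1 + 1 / measure (N \<omega>) (subgraph f I)) * peak (subgraph f I) \<omega>"
  by (simp add: W_def corrected_max_def cell_max_eq_peak)

definition W' :: "'w \<Rightarrow> real" where "W' \<omega> = (1 + 1 / num \<omega>) * peak rect \<omega>"

lemma W'_measurable[measurable]: "W' \<in> borel_measurable P"
  unfolding W'_def[abs_def] using peak_measurable[OF I less_imp_le[OF h_pos]] by measurable

text \<open>Bounds the change caused by points above h, yet depends on the rectangle alone; it is
  therefore independent of whether such points exist.\<close>

definition slack :: "'w \<Rightarrow> real" where "slack \<omega> = 2 * (H - h) + 2 * (h - peak rect \<omega>) + peak rect \<omega> / num \<omega>"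

text \<open>Without points above h the two corrected maxima coincide; with such points
  \<open>corrected_difference_bound\<close> applies. Points above H are excluded, as they have
  intensity 0.\<close>

lemma W_close_pointwise:
  assumes \<omega>: "\<omega> \<in> space P" and i: "count rect \<omega> = of_nat i" and e: "count extra \<omega> = of_nat e"
    and over: "count (band_above I H) \<omega> = 0"
  shows "\<bar>W \<omega> - W' \<omega>\<bar> \<le> of_bool (count extra \<omega> \<noteq> 0) * slack \<omega>"
proof -
  let ?D = "subgraph f I"
  have D: "?D = rect \<union> extra \<union> band_above I H"
    using hH h_pos by (auto simp: subgraph_def band_def band_above_def)
  have disj: "(rect \<union> extra) \<inter> band_above I H = {}" "rect \<inter> extra = {}"
    using hH by (auto simp: band_def band_above_def)
  have "count ?D \<omega> = of_nat (i + e)"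
    unfolding D using \<omega> disj I i e over by (subst count_Un) (simp_all add: count_Un)
  then have cD: "measure (N \<omega>) ?D = real (i + e)" "count ?D \<omega> = of_nat (i + e)"
    by (simp_all only: measure_def enn2real_of_nat)
  have num: "num \<omega> = real i" using i by (simp add: num_def measure_def)
  have idxD: "idx ?D \<omega> = idx rect \<omega> \<union> idx extra \<omega>"
  proof -
    have "idx (band_above I H) \<omega> = {}" using over \<omega> I by (simp add: count_eq_0_iff)
    moreover have "idx ?D \<omega> = idx rect \<omega> \<union> idx extra \<omega> \<union> idx (band_above I H) \<omega>"
      unfolding D by (auto simp: point_indices_def)
    ultimately show ?thesis by simp
  qed
  have Yb: "0 \<le> Y \<omega> j \<and> Y \<omega> j \<le> H" if "j \<in> idx ?D \<omega>" for j
    using that hH unfolding idxD by (auto simp: point_indices_def band_def)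
  have bdd: "bdd_above (Y \<omega> ` idx ?D \<omega>)" using Yb by (intro bdd_aboveI2[where M = H]) blast
  have rng: "0 \<le> peak rect \<omega>" "peak rect \<omega> \<le> h"
    using peak_range[OF \<omega> I less_imp_le[OF h_pos], of "-1"] by auto
  show ?thesis
  proof (cases "e = 0")
    case True
    then have "idx extra \<omega> = {}" using e \<omega> I by (simp add: count_eq_0_iff)
    then have "peak ?D \<omega> = peak rect \<omega>"
      using idxD cD True i by (simp add: peak_def)
    then show ?thesis using True e by (simp add: W_eq W'_def cD num)
  next
    case False
    then have ne: "idx ?D \<omega> \<noteq> {}" "count ?D \<omega> \<noteq> 0"
      using cD(2) \<omega> by (auto simp: count_eq_0_iff[symmetric] I)
    have pD: "peak ?D \<omega> = (SUP j\<in>idx ?D \<omega>. Y \<omega> j)" using ne by (simp add: peak_def)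
    have "peak ?D \<omega> \<le> H" unfolding pD using Yb by (intro cSUP_least[OF ne(1)]) blast
    moreover have "peak rect \<omega> \<le> peak ?D \<omega>"
    proof (cases "count rect \<omega> = 0")
      case True
      obtain j where j: "j \<in> idx ?D \<omega>" using ne by blast
      have "0 \<le> peak ?D \<omega>" unfolding pD using Yb[OF j] cSUP_upper[OF j bdd] by linarith
      with True show ?thesis by (simp add: peak_def)
    next
      case False
      then have "idx rect \<omega> \<noteq> {}" using \<omega> by (simp add: count_eq_0_iff[symmetric] I)
      then have "(SUP j\<in>idx rect \<omega>. Y \<omega> j) \<le> (SUP j\<in>idx ?D \<omega>. Y \<omega> j)"
        using bdd idxD by (intro cSUP_subset_mono) auto
      with False show ?thesis unfolding pD by (simp add: peak_def)
    qed
    moreover have "peak rect \<omega> = 0" if "i = 0" using that i by (simp add: peak_def)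
    ultimately have "\<bar>(1 + 1 / real (i + e)) * peak ?D \<omega> - (1 + 1 / real i) * peak rect \<omega>\<bar>
        \<le> 2 * (H - h) + 2 * (h - peak rect \<omega>) + peak rect \<omega> / real i"
      using False rng hH by (intro corrected_difference_bound) auto
    then show ?thesis using False e by (simp add: W_eq W'_def cD num slack_def)
  qed
qed

lemma AE_counts: "AE \<omega> in P. (\<exists>i::nat. count rect \<omega> = of_nat i) \<and> (\<exists>e::nat. count extra \<omega> = of_nat e)
    \<and> count (band_above I H) \<omega> = 0"
proof -
  have "AE \<omega> in P. \<exists>i::nat. count rect \<omega> = of_nat i"
    using emeasure_band_le[OF I, of "-1" h] h_pos by (intro AE_count_nat) (auto simp: less_top[symmetric] top_unique)
  moreover have "AE \<omega> in P. \<exists>e::nat. count extra \<omega> = of_nat e"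
    using emeasure_band_le[OF I, of h H] h_pos hH by (intro AE_count_nat) (auto simp: less_top[symmetric] top_unique)
  moreover have "AE \<omega> in P. count (band_above I H) \<omega> = 0"
  proof -
    have "emeasure E (band_above I H) = ennreal 0" using emeasure_band_above_null[OF I upper] by simp
    from prob_count[OF band_above_sets[OF I] this, of 0]
    have "prob {\<omega> \<in> space P. count (band_above I H) \<omega> = 0} = 1" by simp
    then have "AE \<omega> in P. \<omega> \<in> {\<omega> \<in> space P. count (band_above I H) \<omega> = 0}"
      by (intro AE_in_set_eq_1[THEN iffD2]) auto
    then show ?thesis by eventually_elim auto
  qed
  ultimately show ?thesis by eventually_elim auto
qed

lemma slack_eq: "slack \<omega> = 2 * (H - h) + (2 * gap \<omega> + b \<omega>) / \<theta>"
proof -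
  have "gap \<omega> / \<theta> = h - peak rect \<omega>" using \<theta> by (simp add: gap_def)
  moreover have "b \<omega> / \<theta> = peak rect \<omega> / num \<omega>"
    using \<theta> unfolding b_def peak_rect[symmetric] by simp
  ultimately show ?thesis by (simp add: slack_def add_divide_distrib)
qed

text \<open>\<open>gap\<close> and \<open>b\<close> have mean at most 1 each, and 3 = 2 + 1.\<close>

lemma slack_mean: "integrable P slack" "expectation slack \<le> 2 * (H - h) + 3 / \<theta>"
proof -
  have "integrable P (\<lambda>\<omega>. 2 * (H - h) + (2 * gap \<omega> + b \<omega>) / \<theta>)"
    using integrable.intros[OF U1] integrable.intros[OF b_mean] by simp
  then show "integrable P slack" by (simp add: slack_eq[abs_def])
  have "expectation slack = expectation (\<lambda>\<omega>. 2 * (H - h) + (2 * gap \<omega> + b \<omega>) / \<theta>)"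
    by (intro Bochner_Integration.integral_cong) (auto simp: slack_eq)
  also have "\<dots> = 2 * (H - h) + (2 * (1 - exp (- (\<theta> * h))) + (1 - (1 + \<theta> * h) * exp (- (\<theta> * h)))) / \<theta>"
    using integrable.intros[OF U1] integrable.intros[OF b_mean]
    by (simp add: has_bochner_integral_integral_eq[OF U1] has_bochner_integral_integral_eq[OF b_mean] prob_space)
  also have "\<dots> \<le> 2 * (H - h) + 3 / \<theta>"
  proof (intro add_left_mono divide_right_mono)
    have "2 * (1 - x) + (1 - y) \<le> 3" if "0 \<le> x" "0 \<le> y" for x y :: real
      using that by simp
    moreover have "0 \<le> (1 + \<theta> * h) * exp (- (\<theta> * h))" using \<theta> h_pos by simp
    ultimately show "2 * (1 - exp (- (\<theta> * h))) + (1 - (1 + \<theta> * h) * exp (- (\<theta> * h))) \<le> 3"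
      by (meson exp_ge_zero)
  qed (use \<theta> in simp)
  finally show "expectation slack \<le> 2 * (H - h) + 3 / \<theta>" .
qed

text \<open>The intensity \<mu> of the upper band is at most \<theta> (H - h), and 1 - exp (- \<mu>)
  \<le> \<mu>.\<close>

lemma prob_extra: "prob {\<omega> \<in> space P. count extra \<omega> \<noteq> 0} \<le> \<theta> * (H - h)"
proof -
  have le: "emeasure E extra \<le> ennreal (\<theta> * (H - h))"
    using emeasure_band_le[OF I, of h H] h_pos hH by (simp add: \<theta>_def mult_ac)
  then obtain \<mu> where \<mu>: "emeasure E extra = ennreal \<mu>" "0 \<le> \<mu>"
    by (cases "emeasure E extra") (auto simp: top_unique)
  then have "\<mu> \<le> \<theta> * (H - h)" using le \<theta> hH by simp
  moreover have "prob {\<omega> \<in> space P. count extra \<omega> = 0} = exp (- \<mu>)"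
    using prob_count[OF band_sets[OF I] \<mu>, of 0] by simp
  moreover have "prob {\<omega> \<in> space P. count extra \<omega> \<noteq> 0} = 1 - prob {\<omega> \<in> space P. count extra \<omega> = 0}"
    using prob_neg[of "\<lambda>\<omega>. count extra \<omega> = 0"] count_measurable[OF band_sets[OF I]] by simp
  ultimately show ?thesis using exp_ge_add_one_self[of "- \<mu>"] by linarith
qed

text \<open>Points above h are rare and the slack is small in mean. Independence of the two disjoint
  bands multiplies the bounds, and the factor \<theta> in the probability cancels the 1 / \<theta>
  in the slack.\<close>

lemma W_close:
  shows "integrable P (\<lambda>\<omega>. W \<omega> - W' \<omega>)"
    and "expectation (\<lambda>\<omega>. \<bar>W \<omega> - W' \<omega>\<bar>) \<le> (H - h) * (3 + 2 * \<theta> * (H - h))"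
proof -
  define bl where "bl i = (if i = 0 then rect else extra)" for i :: nat
  define V where "V i \<omega> = (if i = 0 then slack \<omega> else of_bool (count extra \<omega> \<noteq> 0))" for i :: nat and \<omega>
  have "indep_vars (\<lambda>_. borel \<Otimes>\<^sub>M borel) (\<lambda>j \<omega>. (count (band I (if j = 0 then - 1 else h) (if j = 0 then h else H)) \<omega>,
      peak (band I (if j = 0 then - 1 else h) (if j = 0 then h else H)) \<omega>)) {0, 1 :: nat}"
    by (rule indep_bands) (use h_pos hH in \<open>auto simp: disjoint_family_on_def band_def\<close>)
  \<comment> \<open>The slack is a function of count and peak of the lower band, the existence of
    extra points one of the count of the upper band.\<close>
  from indep_vars_compose2[OF this, of "\<lambda>j z. if j = 0 then 2 * (H - h) + 2 * (h - snd z) + snd z / enn2real (fst z)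
       else of_bool (fst z \<noteq> 0)" "\<lambda>_. borel"]
  have "indep_vars (\<lambda>_. borel) (\<lambda>j \<omega>. if j = 0 then slack \<omega> else of_bool (count extra \<omega> \<noteq> 0)) {0, 1 :: nat}"
    by (rule indep_vars_cong[THEN iffD1, rotated 3]) (auto simp: slack_def num_def measure_def)
  then have ind: "indep_vars (\<lambda>_. borel) V {0, 1}" by (simp add: V_def[abs_def])
  have em: "{\<omega> \<in> space P. count extra \<omega> \<noteq> 0} \<in> events" using count_measurable[OF band_sets[OF I]] by measurable
  have Vi: "integrable P (V i)" for i
  proof (cases "i = 0")
    case True
    then show ?thesis using slack_mean(1) by (simp add: V_def[abs_def])
  next
    case False
    have "V i \<in> borel_measurable P"
      using False count_measurable[OF band_sets[OF I, of h H]] unfolding V_def[abs_def] by simp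
    then show ?thesis using False by (intro integrable_const_bound[of _ 1]) (auto simp: V_def)
  qed
  have prodV: "(\<Prod>i\<in>{0, 1}. V i \<omega>) = of_bool (count extra \<omega> \<noteq> 0) * slack \<omega>" for \<omega>
    by (simp add: V_def)
  have iP: "integrable P (\<lambda>\<omega>. of_bool (count extra \<omega> \<noteq> 0) * slack \<omega>)"
    using indep_vars_integrable[OF _ ind Vi] unfolding prodV by simp
  have "expectation (\<lambda>\<omega>. of_bool (count extra \<omega> \<noteq> 0) * slack \<omega>) = (\<Prod>i\<in>{0, 1}. expectation (V i))"
    using indep_vars_lebesgue_integral[OF _ ind Vi] unfolding prodV by simp
  also have "\<dots> = expectation slack * prob {\<omega> \<in> space P. count extra \<omega> \<noteq> 0}"
  proof -
    have "expectation (V 1) = expectation (indicator {\<omega> \<in> space P. count extra \<omega> \<noteq> 0})"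
      by (intro Bochner_Integration.integral_cong) (auto simp: V_def indicator_def)
    then show ?thesis using em by (simp add: V_def[abs_def])
  qed
  also have "\<dots> \<le> (2 * (H - h) + 3 / \<theta>) * (\<theta> * (H - h))"
    using slack_mean(2) prob_extra hH \<theta> by (intro mult_mono) auto
  also have "\<dots> = (H - h) * (3 + 2 * \<theta> * (H - h))" using \<theta> by (simp add: field_simps)
  finally have bound: "expectation (\<lambda>\<omega>. of_bool (count extra \<omega> \<noteq> 0) * slack \<omega>) \<le> (H - h) * (3 + 2 * \<theta> * (H - h))" .
  have ae: "AE \<omega> in P. \<bar>W \<omega> - W' \<omega>\<bar> \<le> of_bool (count extra \<omega> \<noteq> 0) * slack \<omega>"
    using AE_counts AE_space by eventually_elim (use W_close_pointwise in blast)
  show i: "integrable P (\<lambda>\<omega>. W \<omega> - W' \<omega>)"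
    by (rule Bochner_Integration.integrable_bound[OF iP]) (use ae in \<open>auto elim!: eventually_mono\<close>)
  show "expectation (\<lambda>\<omega>. \<bar>W \<omega> - W' \<omega>\<bar>) \<le> (H - h) * (3 + 2 * \<theta> * (H - h))"
    using integral_mono_AE[OF integrable_abs[OF i] iP ae] bound by linarith
qed

lemma W'_mean: "has_bochner_integral P W' (h * (1 - exp (- (\<theta> * h))))"
proof -
  have "W' = (\<lambda>\<omega>. (1 + 1 / num \<omega>) * (\<theta> * h - gap \<omega>) / \<theta>)"
    using \<theta> by (simp add: W'_def[abs_def] peak_rect[symmetric])
  moreover have "has_bochner_integral P (\<lambda>\<omega>. (1 + 1 / num \<omega>) * (\<theta> * h - gap \<omega>) / \<theta>) (\<theta> * h * (1 - exp (- (\<theta> * h))) / \<theta>)"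
    by (intro has_bochner_integral_divide_zero corrected_mean)
  ultimately show ?thesis using \<theta> by simp
qed

lemma W'_decomp: "\<theta> * W' \<omega> = \<theta> * h - gap \<omega> + b \<omega>"
proof -
  have "\<theta> * W' \<omega> = (1 + 1 / num \<omega>) * (\<theta> * peak rect \<omega>)" by (simp add: W'_def)
  then show ?thesis unfolding peak_rect b_def by (simp add: distrib_right)
qed

end

section \<open>Estimators on a partition\<close>

text \<open>Jensen's inequality, read off from the nonnegative variance of |X|.\<close>

lemma (in prob_space) abs_mean_le_sqrt:
  fixes X :: "'a \<Rightarrow> real"
  assumes "X \<in> borel_measurable M" "integrable M (\<lambda>\<omega>. (X \<omega>)\<^sup>2)"
  shows "integrable M X" "expectation (\<lambda>\<omega>. \<bar>X \<omega>\<bar>) \<le> sqrt (expectation (\<lambda>\<omega>. (X \<omega>)\<^sup>2))"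
proof -
  show i: "integrable M X" by (rule square_integrable_imp_integrable[OF assms])
  have "variance (\<lambda>\<omega>. \<bar>X \<omega>\<bar>) = expectation (\<lambda>\<omega>. (X \<omega>)\<^sup>2) - (expectation (\<lambda>\<omega>. \<bar>X \<omega>\<bar>))\<^sup>2"
    using i assms by (subst variance_eq) auto
  then have "(expectation (\<lambda>\<omega>. \<bar>X \<omega>\<bar>))\<^sup>2 \<le> expectation (\<lambda>\<omega>. (X \<omega>)\<^sup>2)"
    using variance_positive[of "\<lambda>\<omega>. \<bar>X \<omega>\<bar>"] by linarith
  then show "expectation (\<lambda>\<omega>. \<bar>X \<omega>\<bar>) \<le> sqrt (expectation (\<lambda>\<omega>. (X \<omega>)\<^sup>2))"
    by (rule real_le_rsqrt)
qed

text \<open>The recursion (j + 1) p (j + 1) = \<mu> p j reduces the first and second moment series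
  to the total mass.\<close>

lemma poisson_second_moment_sums:
  fixes \<mu> :: real
  defines "p \<equiv> \<lambda>j. exp (- \<mu>) * \<mu> ^ j / fact j"
  shows "(\<lambda>j. (real j - \<mu>)\<^sup>2 * p j) sums \<mu>"
proof -
  have s0: "p sums 1"
    using sums_mult[OF exp_converges[of \<mu>], of "exp (- \<mu>)"]
    by (simp add: p_def exp_add[symmetric] divide_inverse mult_ac)
  have step: "real (Suc j) * p (Suc j) = \<mu> * p j" for j by (simp add: p_def del: of_nat_Suc)
  have s1: "(\<lambda>j. real j * p j) sums \<mu>"
  proof -
    have "(\<lambda>j. real (Suc j) * p (Suc j)) sums (\<mu> * 1)" unfolding step by (rule sums_mult[OF s0])
    from sums_Suc[OF this] show ?thesis by simp
  qed
  have s2: "(\<lambda>j. (real j)\<^sup>2 * p j) sums (\<mu> * \<mu> + \<mu>)"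
  proof -
    have "(real (Suc j))\<^sup>2 * p (Suc j) = \<mu> * (real j * p j) + \<mu> * p j" for j
      unfolding power2_eq_square mult.assoc step by (simp add: algebra_simps)
    moreover have "(\<lambda>j. \<mu> * (real j * p j) + \<mu> * p j) sums (\<mu> * \<mu> + \<mu> * 1)"
      by (intro sums_add sums_mult s0 s1)
    ultimately have "(\<lambda>j. (real (Suc j))\<^sup>2 * p (Suc j)) sums (\<mu> * \<mu> + \<mu>)" by simp
    from sums_Suc[OF this] show ?thesis by simp
  qed
  have "(\<lambda>j. (real j)\<^sup>2 * p j - 2 * \<mu> * (real j * p j) + \<mu>\<^sup>2 * p j) sums (\<mu> * \<mu> + \<mu> - 2 * \<mu> * \<mu> + \<mu>\<^sup>2 * 1)"
    by (intro sums_add sums_diff sums_mult s0 s1 s2)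
  then show ?thesis by (simp add: power2_diff algebra_simps power2_eq_square)
qed

text \<open>The variance of a Poisson variable is its mean \<mu>. This drives the consistency of the
  estimator of c.\<close>

lemma (in graph_process) count_L1:
  assumes B[measurable]: "B \<in> sets Z" and \<mu>: "emeasure E B = ennreal \<mu>" "0 \<le> \<mu>"
  shows "integrable P (\<lambda>\<omega>. measure (N \<omega>) B)" "expectation (\<lambda>\<omega>. \<bar>measure (N \<omega>) B - \<mu>\<bar>) \<le> sqrt \<mu>"
proof -
  let ?L = "\<lambda>\<omega>. measure (N \<omega>) B"
  have Lm[measurable]: "?L \<in> borel_measurable P" using B by (rule measure_measurable)
  have ae: "AE \<omega> in P. \<exists>j::nat. count B \<omega> = of_nat j"
    by (rule AE_count_nat[OF B]) (simp add: \<mu> less_top[symmetric])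
  have prob_L: "prob {\<omega>\<in>space P. ?L \<omega> = real j} = exp (- \<mu>) * \<mu> ^ j / fact j" for j
  proof -
    have "prob {\<omega>\<in>space P. ?L \<omega> = real j} = prob {\<omega> \<in> space P. count B \<omega> = of_nat j}"
    proof (rule finite_measure_eq_AE)
      show "AE \<omega> in P. (\<omega> \<in> {\<omega>\<in>space P. ?L \<omega> = real j}) = (\<omega> \<in> {\<omega> \<in> space P. count B \<omega> = of_nat j})"
        using ae by eventually_elim (auto simp: measure_def ennreal_of_nat_eq_real_of_nat)
      show "{\<omega> \<in> space P. count B \<omega> = of_nat j} \<in> events"
        using count_measurable[OF B] by measurable
    qed measurable
    then show ?thesis using prob_count[OF B \<mu>] by simp
  qed
  have "has_bochner_integral P (\<lambda>\<omega>. (?L \<omega> - \<mu>)\<^sup>2) \<mu>"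
  proof (rule has_bochner_integral_sum_levels[OF Lm])
    show "AE \<omega> in P. ?L \<omega> \<in> range real"
      using ae by eventually_elim (auto simp: measure_def)
    show "has_bochner_integral P (\<lambda>\<omega>. (?L \<omega> - \<mu>)\<^sup>2 * indicator {\<omega> \<in> space P. ?L \<omega> = real j} \<omega>)
        ((real j - \<mu>)\<^sup>2 * (exp (- \<mu>) * \<mu> ^ j / fact j))" for j
    proof -
      have "(\<lambda>\<omega>. (?L \<omega> - \<mu>)\<^sup>2 * indicator {\<omega> \<in> space P. ?L \<omega> = real j} \<omega>)
          = (\<lambda>\<omega>. (real j - \<mu>)\<^sup>2 * indicator {\<omega> \<in> space P. ?L \<omega> = real j} \<omega>)"
        by (auto simp: indicator_def)
      moreover have "has_bochner_integral P (indicator {\<omega> \<in> space P. ?L \<omega> = real j} :: 'w \<Rightarrow> real) (prob {\<omega> \<in> space P. ?L \<omega> = real j})"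
        by (rule has_bochner_integral_real_indicator) (auto simp: less_top[symmetric])
      ultimately show ?thesis
        unfolding prob_L[symmetric] by (simp only:) (rule has_bochner_integral_mult_right)
    qed
    show "(\<lambda>j. (real j - \<mu>)\<^sup>2 * (exp (- \<mu>) * \<mu> ^ j / fact j)) sums \<mu>"
      by (rule poisson_second_moment_sums)
  qed simp_all
  then have i: "integrable P (\<lambda>\<omega>. (?L \<omega> - \<mu>)\<^sup>2)" "expectation (\<lambda>\<omega>. (?L \<omega> - \<mu>)\<^sup>2) = \<mu>"
    by (auto simp: has_bochner_integral_iff)
  have m: "(\<lambda>\<omega>. ?L \<omega> - \<mu>) \<in> borel_measurable P" by measurable
  show "expectation (\<lambda>\<omega>. \<bar>?L \<omega> - \<mu>\<bar>) \<le> sqrt \<mu>"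
    using abs_mean_le_sqrt(2)[OF m i(1)] i(2) by simp
  have "integrable P (\<lambda>\<omega>. (?L \<omega> - \<mu>) + \<mu>)"
    using abs_mean_le_sqrt(1)[OF m i(1)] by (intro Bochner_Integration.integrable_add) auto
  then show "integrable P ?L" by simp
qed

locale cell_partition = prob_space \<nu> for \<nu> :: "'a measure" +
  fixes k :: nat and I :: "nat \<Rightarrow> 'a set"
  assumes k: "1 \<le> k"
    and I: "\<And>r. r \<in> {1..k} \<Longrightarrow> I r \<in> sets \<nu>" and I_disj: "disjoint_family_on I {1..k}"
    and I_Un: "(\<Union>r\<in>{1..k}. I r) = space \<nu>"
    and I_measure: "\<And>r. r \<in> {1..k} \<Longrightarrow> measure \<nu> (I r) = 1 / real k"
begin

text \<open>Integrating against this function turns a weighted sum of cell integrals into a single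
  integral, where pointwise estimates apply.\<close>

definition step :: "(nat \<Rightarrow> real) \<Rightarrow> 'a \<Rightarrow> real" where "step a x = (\<Sum>r = 1..k. a r * indicator (I r) x)"

lemma in_cell: assumes "x \<in> space \<nu>" obtains r where "r \<in> {1..k}" "x \<in> I r"
  using assms I_Un by blast

lemma step_eq: "r \<in> {1..k} \<Longrightarrow> x \<in> I r \<Longrightarrow> step a x = a r"
proof -
  assume r: "r \<in> {1..k}" "x \<in> I r"
  then have "indicator (I i) x = (if i = r then 1 else 0 :: real)" if "i \<in> {1..k}" for i
    using disjoint_family_onD[OF I_disj that r(1)] r(2) by (auto simp: indicator_def)
  then have "step a x = (\<Sum>i = 1..k. if i = r then a i else 0)"
    unfolding step_def by (intro sum.cong) auto
  then show ?thesis using r by simp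
qed

lemma step_measurable[measurable]: "step a \<in> borel_measurable \<nu>"
  unfolding step_def[abs_def]
proof (intro borel_measurable_sum borel_measurable_times borel_measurable_const borel_measurable_indicator)
qed (rule I)

lemma set_integrable_cell: "integrable \<nu> g \<Longrightarrow> r \<in> {1..k} \<Longrightarrow> integrable \<nu> (\<lambda>x. indicator (I r) x * g x :: real)"
  using integrable_mult_indicator[OF I, of r g] by simp

lemma sum_cell_integrals:
  assumes g: "integrable \<nu> (g :: 'a \<Rightarrow> real)"
  shows "integrable \<nu> (\<lambda>x. g x * step a x)"
    and "(\<Sum>r = 1..k. (LINT t:I r|\<nu>. g t) * a r) = (\<integral>x. g x * step a x \<partial>\<nu>)"
proof -
  have eq: "(\<lambda>x. g x * step a x) = (\<lambda>x. \<Sum>r = 1..k. (indicator (I r) x * g x) * a r)"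
    unfolding step_def sum_distrib_left by (intro ext sum.cong refl) (simp only: mult_ac)
  have i: "integrable \<nu> (\<lambda>x. (indicator (I r) x * g x) * a r)" if "r \<in> {1..k}" for r
    using set_integrable_cell[OF g that] by simp
  show "integrable \<nu> (\<lambda>x. g x * step a x)"
    unfolding eq by (rule Bochner_Integration.integrable_sum) (rule i)
  have "(\<integral>x. g x * step a x \<partial>\<nu>) = (\<Sum>r = 1..k. \<integral>x. (indicator (I r) x * g x) * a r \<partial>\<nu>)"
    unfolding eq by (rule Bochner_Integration.integral_sum) (rule i)
  also have "\<dots> = (\<Sum>r = 1..k. (LINT t:I r|\<nu>. g t) * a r)"
    by (simp add: set_lebesgue_integral_def)
  finally show "(\<Sum>r = 1..k. (LINT t:I r|\<nu>. g t) * a r) = (\<integral>x. g x * step a x \<partial>\<nu>)" by simp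
qed

end

section \<open>All cells together: main term and remainders\<close>

locale graph_partition = graph_process P \<nu> f c n N X Y + nu: cell_partition \<nu> k I
  for P :: "'w measure" and \<nu> :: "'a measure" and f c n N X Y and k :: nat and I :: "nat \<Rightarrow> 'a set" +
  fixes h H :: "nat \<Rightarrow> real" and m M \<Delta> :: real
  assumes m_pos: "0 < m"
    and bounds: "\<And>r. r \<in> {1..k} \<Longrightarrow> m \<le> h r \<and> h r \<le> H r \<and> H r \<le> M \<and> H r - h r \<le> \<Delta>"
    and lower: "\<And>r. r \<in> {1..k} \<Longrightarrow> AE x in \<nu>. x \<in> I r \<longrightarrow> h r \<le> f x"
    and upper: "\<And>r. r \<in> {1..k} \<Longrightarrow> AE x in \<nu>. x \<in> I r \<longrightarrow> f x \<le> H r"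
begin

lemmas k = nu.k and I = nu.I and I_disj = nu.I_disj and I_Un = nu.I_Un and I_measure = nu.I_measure

definition \<theta> :: real where "\<theta> = \<kappa> / real k"

lemma \<theta>: "0 < \<theta>" using \<kappa> k by (simp add: \<theta>_def)

lemma cell: "r \<in> {1..k} \<Longrightarrow> graph_cell P \<nu> f c n N X Y (I r) (h r) (H r)"
  using I I_measure bounds[of r] lower upper k m_pos
  by unfold_locales (auto intro: order.strict_trans2)

lemma cell_\<theta>: "r \<in> {1..k} \<Longrightarrow> graph_cell.\<theta> \<nu> c n (I r) = \<theta>"
  using graph_cell.\<theta>_def[OF cell] I_measure by (simp add: \<theta>_def)

abbreviation "W r \<equiv> graph_cell.W \<nu> f N X Y (I r)"
abbreviation "W' r \<equiv> graph_cell.W' \<nu> f N X Y (I r) (h r)"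
text \<open>Restated outside the locale of a single cell, so that the cells form one family indexed
  by r to which independence can be applied.\<close>

definition "gap r \<omega> = \<theta> * (h r - peak (band (I r) (-1) (h r)) \<omega>)"
definition "b r \<omega> = (\<theta> * h r - gap r \<omega>) / measure (N \<omega>) (band (I r) (-1) (h r))"

lemma rectangle:
  assumes r: "r \<in> {1..k}"
  shows "poisson_rectangle P (\<lambda>\<omega>. measure (N \<omega>) (band (I r) (-1) (h r))) (gap r) (\<theta> * h r)"
proof -
  interpret C: graph_cell P \<nu> f c n N X Y "I r" "h r" "H r" by (rule cell[OF r])
  have "C.num = (\<lambda>\<omega>. measure (N \<omega>) (band (I r) (-1) (h r)))" "C.gap = gap r"
    by (auto simp: C.num_def C.gap_def gap_def cell_\<theta>[OF r])
  then show ?thesis using C.poisson_rectangle_axioms by (simp add: cell_\<theta>[OF r])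
qed

lemma b_eq: "b r = poisson_rectangle.b (\<lambda>\<omega>. measure (N \<omega>) (band (I r) (-1) (h r))) (gap r) (\<theta> * h r)" if "r \<in> {1..k}"
  using poisson_rectangle.b_def[OF rectangle[OF that]] by (auto simp: b_def)

lemma W'_decomp: "r \<in> {1..k} \<Longrightarrow> \<theta> * W' r \<omega> = \<theta> * h r - gap r \<omega> + b r \<omega>"
proof -
  assume r: "r \<in> {1..k}"
  interpret C: graph_cell P \<nu> f c n N X Y "I r" "h r" "H r" by (rule cell[OF r])
  have "C.gap = gap r" "C.num = (\<lambda>\<omega>. measure (N \<omega>) (band (I r) (-1) (h r)))"
    by (auto simp: C.gap_def gap_def cell_\<theta>[OF r] C.num_def)
  then show ?thesis using C.W'_decomp[of \<omega>] b_eq[OF r] by (simp add: cell_\<theta>[OF r])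
qed

lemma W_close:
  assumes r: "r \<in> {1..k}"
  shows "integrable P (\<lambda>\<omega>. W r \<omega> - W' r \<omega>)" "expectation (\<lambda>\<omega>. \<bar>W r \<omega> - W' r \<omega>\<bar>) \<le> \<Delta> * (3 + 2 * \<theta> * \<Delta>)"
proof -
  interpret C: graph_cell P \<nu> f c n N X Y "I r" "h r" "H r" by (rule cell[OF r])
  show "integrable P (\<lambda>\<omega>. W r \<omega> - W' r \<omega>)" by (rule C.W_close(1))
  have "expectation (\<lambda>\<omega>. \<bar>W r \<omega> - W' r \<omega>\<bar>) \<le> (H r - h r) * (3 + 2 * \<theta> * (H r - h r))"
    using C.W_close(2) by (simp add: cell_\<theta>[OF r])
  also have "\<dots> \<le> \<Delta> * (3 + 2 * \<theta> * \<Delta>)"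
    using bounds[OF r] \<theta> by (intro mult_mono add_left_mono mult_left_mono) auto
  finally show "expectation (\<lambda>\<omega>. \<bar>W r \<omega> - W' r \<omega>\<bar>) \<le> \<Delta> * (3 + 2 * \<theta> * \<Delta>)" .
qed

lemma W'_mean:
  assumes r: "r \<in> {1..k}"
  shows "integrable P (W' r)" "expectation (\<lambda>\<omega>. \<bar>W' r \<omega>\<bar>) \<le> M"
proof -
  interpret C: graph_cell P \<nu> f c n N X Y "I r" "h r" "H r" by (rule cell[OF r])
  show "integrable P (W' r)" using C.W'_mean by (rule integrable.intros)
  have "0 \<le> W' r \<omega>" if "\<omega> \<in> space P" for \<omega>
    using peak_range(1)[OF that I[OF r], of "h r" "-1"] C.h_pos by (simp add: C.W'_def C.num_def)
  then have "expectation (\<lambda>\<omega>. \<bar>W' r \<omega>\<bar>) = expectation (W' r)"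
    by (intro Bochner_Integration.integral_cong) auto
  also have "\<dots> = h r * (1 - exp (- (\<theta> * h r)))"
    using has_bochner_integral_integral_eq[OF C.W'_mean] by (simp add: cell_\<theta>[OF r])
  also have "\<dots> \<le> h r * 1" using C.h_pos by (intro mult_left_mono) auto
  finally show "expectation (\<lambda>\<omega>. \<bar>W' r \<omega>\<bar>) \<le> M" using bounds[OF r] by simp
qed

text \<open>Bands over different cells are disjoint, and both variables are functions of the count
  and the peak of one band.\<close>

lemma indep_gap_b:
  "indep_vars (\<lambda>_. borel) gap {1..k}" "indep_vars (\<lambda>_. borel) b {1..k}"
proof -
  have disj: "disjoint_family_on (\<lambda>r. band (I r) (-1) (h r)) {1..k}"
    using I_disj by (fastforce simp: disjoint_family_on_def band_def)
  have "0 \<le> h r" if "r \<in> {1..k}" for r using bounds[OF that] m_pos by linarith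
  from indep_bands[OF _ I this disj]
  have ind: "indep_vars (\<lambda>_. borel \<Otimes>\<^sub>M borel)
      (\<lambda>r \<omega>. (count (band (I r) (-1) (h r)) \<omega>, peak (band (I r) (-1) (h r)) \<omega>)) {1..k}" by simp
  have "indep_vars (\<lambda>_. borel) (\<lambda>r \<omega>. \<theta> * (h r - snd (count (band (I r) (-1) (h r)) \<omega>, peak (band (I r) (-1) (h r)) \<omega>))) {1..k}"
    by (rule indep_vars_compose2[OF ind]) simp
  then show "indep_vars (\<lambda>_. borel) gap {1..k}" by (simp add: gap_def[abs_def])
  have "indep_vars (\<lambda>_. borel) (\<lambda>r \<omega>. (\<lambda>z. (\<theta> * h r - \<theta> * (h r - snd z)) / enn2real (fst z))
      (count (band (I r) (-1) (h r)) \<omega>, peak (band (I r) (-1) (h r)) \<omega>)) {1..k}"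
    by (rule indep_vars_compose2[OF ind]) simp
  then show "indep_vars (\<lambda>_. borel) b {1..k}" by (simp add: b_def[abs_def] gap_def measure_def)
qed

text \<open>The mean of \<open>gap r\<close>, which centres the main term.\<close>

definition e :: "nat \<Rightarrow> real" where "e r = 1 - exp (- (\<theta> * h r))"

definition main_term :: "(nat \<Rightarrow> real) \<Rightarrow> 'w \<Rightarrow> real" where
  "main_term w \<omega> = (\<Sum>r = 1..k. w r * (e r - gap r \<omega>))"

lemma centered_gap:
  assumes r: "r \<in> {1..k}"
  shows "expectation (\<lambda>\<omega>. e r - gap r \<omega>) = 0" "integrable P (\<lambda>\<omega>. (e r - gap r \<omega>)\<^sup>2)"
    "\<bar>expectation (\<lambda>\<omega>. (e r - gap r \<omega>)\<^sup>2) - 1\<bar> \<le> 5 / (\<theta> * m)"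
    "integrable P (\<lambda>\<omega>. \<bar>e r - gap r \<omega>\<bar> ^ 3)" "expectation (\<lambda>\<omega>. \<bar>e r - gap r \<omega>\<bar> ^ 3) \<le> 7"
proof -
  note R = rectangle[OF r]
  note U1 = poisson_rectangle.U1[OF R] and Uc = poisson_rectangle.U_centered[OF R]
  show "expectation (\<lambda>\<omega>. e r - gap r \<omega>) = 0"
    using integrable.intros[OF U1] has_bochner_integral_integral_eq[OF U1] by (simp add: prob_space e_def)
  show "integrable P (\<lambda>\<omega>. (e r - gap r \<omega>)\<^sup>2)" "integrable P (\<lambda>\<omega>. \<bar>e r - gap r \<omega>\<bar> ^ 3)"
    "expectation (\<lambda>\<omega>. \<bar>e r - gap r \<omega>\<bar> ^ 3) \<le> 7"
    using Uc(1,3,4) by (simp_all only: e_def)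
  have "5 / (\<theta> * h r) \<le> 5 / (\<theta> * m)"
    using bounds[OF r] \<theta> m_pos by (intro divide_left_mono mult_left_mono) (auto intro!: mult_pos_pos)
  then show "\<bar>expectation (\<lambda>\<omega>. (e r - gap r \<omega>)\<^sup>2) - 1\<bar> \<le> 5 / (\<theta> * m)"
    using Uc(2) by (simp add: e_def)
qed

lemma indep_centered_gap: "indep_vars (\<lambda>_. borel) (\<lambda>r \<omega>. e r - gap r \<omega>) {1..k}"
  by (rule indep_vars_compose2[OF indep_gap_b(1)]) simp

text \<open>The constants 7 and 5 / (\<theta> m) are the bounds on the third moment and on the
  variance defect of a single gap, uniform over the cells because m \<le> h r.\<close>

lemma main_term_char:
  assumes "\<And>r. r \<in> {1..k} \<Longrightarrow> \<bar>w r\<bar> \<le> \<delta>"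
  shows "cmod ((\<integral>\<omega>. iexp (main_term w \<omega>) \<partial>P) - exp (- (\<Sum>r = 1..k. (w r)\<^sup>2) / 2))
    \<le> (\<Sum>r = 1..k. (w r)\<^sup>2) * (7 * \<delta> / 6 + 5 / (\<theta> * m) / 2 + \<delta>\<^sup>2 / 8)"
  unfolding main_term_def
  by (rule char_weighted_sum_approx[OF _ indep_centered_gap centered_gap]) (use assms in auto)

lemma main_term_L1:
  shows "integrable P (main_term w)"
    and "expectation (\<lambda>\<omega>. \<bar>main_term w \<omega>\<bar>) \<le> sqrt ((\<Sum>r = 1..k. (w r)\<^sup>2) * (1 + 5 / (\<theta> * m)))"
proof -
  let ?X = "\<lambda>r \<omega>. w r * (e r - gap r \<omega>)"
  have ind: "indep_vars (\<lambda>_. borel) ?X {1..k}"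
    by (rule indep_vars_compose2[OF indep_centered_gap]) simp
  have sq: "integrable P (\<lambda>\<omega>. (?X r \<omega>)\<^sup>2)" "expectation (?X r) = 0" if "r \<in> {1..k}" for r
    using centered_gap(1,2)[OF that] by (simp_all add: power_mult_distrib)
  note S = indep_centered_sum_second_moment[OF _ ind sq]
  have i: "integrable P (\<lambda>\<omega>. (main_term w \<omega>)\<^sup>2)" and m: "main_term w \<in> borel_measurable P"
    using S borel_measurable_integrable[of P "main_term w"] by (simp_all add: main_term_def[abs_def])
  show "integrable P (main_term w)" by (rule abs_mean_le_sqrt(1)[OF m i])
  have "expectation (\<lambda>\<omega>. (main_term w \<omega>)\<^sup>2) = (\<Sum>r = 1..k. (w r)\<^sup>2 * expectation (\<lambda>\<omega>. (e r - gap r \<omega>)\<^sup>2))"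
    using S by (simp add: main_term_def power_mult_distrib)
  also have "\<dots> \<le> (\<Sum>r = 1..k. (w r)\<^sup>2 * (1 + 5 / (\<theta> * m)))"
    using centered_gap(3) by (intro sum_mono mult_left_mono) (force simp: abs_le_iff)+
  finally have "expectation (\<lambda>\<omega>. (main_term w \<omega>)\<^sup>2) \<le> (\<Sum>r = 1..k. (w r)\<^sup>2) * (1 + 5 / (\<theta> * m))"
    by (simp add: sum_distrib_right)
  then show "expectation (\<lambda>\<omega>. \<bar>main_term w \<omega>\<bar>) \<le> sqrt ((\<Sum>r = 1..k. (w r)\<^sup>2) * (1 + 5 / (\<theta> * m)))"
    using abs_mean_le_sqrt(2)[OF m i] by (meson order_trans real_sqrt_le_mono)
qed

lemma \<Delta>_nonneg: "0 \<le> \<Delta>" using bounds[of 1] k by auto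

text \<open>Three remainders: the passage from cell to rectangle, the fluctuation of
  \<open>b\<close>, and the mismatch of the means. The first is not centred and costs the sum of |w
  r|; the second is centred and independent over the cells, so it costs only a root of the sum of
  squares; the third is deterministic and exponentially small.\<close>

lemma weighted_sum_close:
  shows "integrable P (\<lambda>\<omega>. (\<Sum>r = 1..k. w r * (\<theta> * W r \<omega> - \<theta> * h r)) - main_term w \<omega>)" (is "integrable P ?D")
    and "expectation (\<lambda>\<omega>. \<bar>(\<Sum>r = 1..k. w r * (\<theta> * W r \<omega> - \<theta> * h r)) - main_term w \<omega>\<bar>)
      \<le> (\<theta> * \<Delta> * (3 + 2 * \<theta> * \<Delta>) + \<theta> * M * exp (- (\<theta> * m))) * (\<Sum>r = 1..k. \<bar>w r\<bar>)
        + sqrt ((\<Sum>r = 1..k. (w r)\<^sup>2) * (10 / (\<theta> * m)))"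
proof -
  \<comment> \<open>The mean of \<open>b r\<close>.\<close>
  define e' where "e' r = 1 - (1 + \<theta> * h r) * exp (- (\<theta> * h r))" for r
  let ?X = "\<lambda>r \<omega>. w r * (b r \<omega> - e' r)"
  let ?A = "\<lambda>\<omega>. \<Sum>r = 1..k. w r * (\<theta> * (W r \<omega> - W' r \<omega>))"
  let ?B = "\<lambda>\<omega>. \<Sum>r = 1..k. ?X r \<omega>"
  let ?C = "\<Sum>r = 1..k. w r * (e' r - e r)"
  have D: "?D \<omega> = ?A \<omega> + ?B \<omega> + ?C" for \<omega>
    unfolding main_term_def sum_subtractf[symmetric] sum.distrib[symmetric]
  proof (intro sum.cong refl)
    fix r assume "r \<in> {1..k}"
    from W'_decomp[OF this, of \<omega>]
    have *: "\<theta> * W r \<omega> - \<theta> * h r = \<theta> * (W r \<omega> - W' r \<omega>) - gap r \<omega> + b r \<omega>"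
      by (simp add: right_diff_distrib)
    show "w r * (\<theta> * W r \<omega> - \<theta> * h r) - w r * (e r - gap r \<omega>)
        = w r * (\<theta> * (W r \<omega> - W' r \<omega>)) + w r * (b r \<omega> - e' r) + w r * (e' r - e r)"
      unfolding * by (simp add: algebra_simps)
  qed
  have iA: "integrable P ?A"
    using W_close(1) by (intro Bochner_Integration.integrable_sum integrable_mult_right) auto
  have EA: "expectation (\<lambda>\<omega>. \<bar>?A \<omega>\<bar>) \<le> \<theta> * \<Delta> * (3 + 2 * \<theta> * \<Delta>) * (\<Sum>r = 1..k. \<bar>w r\<bar>)"
  proof -
    have "expectation (\<lambda>\<omega>. \<bar>?A \<omega>\<bar>) \<le> expectation (\<lambda>\<omega>. \<Sum>r = 1..k. \<bar>w r\<bar> * \<theta> * \<bar>W r \<omega> - W' r \<omega>\<bar>)"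
    proof (rule integral_mono[OF integrable_abs[OF iA]])
      show "integrable P (\<lambda>\<omega>. \<Sum>r = 1..k. \<bar>w r\<bar> * \<theta> * \<bar>W r \<omega> - W' r \<omega>\<bar>)"
        using W_close(1) by (intro Bochner_Integration.integrable_sum integrable_mult_right integrable_abs) auto
      show "\<bar>?A \<omega>\<bar> \<le> (\<Sum>r = 1..k. \<bar>w r\<bar> * \<theta> * \<bar>W r \<omega> - W' r \<omega>\<bar>)" for \<omega>
        using \<theta> by (intro order_trans[OF sum_abs] sum_mono) (simp add: abs_mult)
    qed
    also have "\<dots> = (\<Sum>r = 1..k. \<bar>w r\<bar> * \<theta> * expectation (\<lambda>\<omega>. \<bar>W r \<omega> - W' r \<omega>\<bar>))"
      using W_close(1) by (subst Bochner_Integration.integral_sum) auto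
    also have "\<dots> \<le> (\<Sum>r = 1..k. \<bar>w r\<bar> * \<theta> * (\<Delta> * (3 + 2 * \<theta> * \<Delta>)))"
      using W_close(2) \<theta> by (intro sum_mono mult_left_mono) auto
    finally show ?thesis by (simp add: sum_distrib_right sum_distrib_left mult_ac)
  qed
  have cb: "integrable P (\<lambda>\<omega>. (b r \<omega> - e' r)\<^sup>2)" "expectation (\<lambda>\<omega>. (b r \<omega> - e' r)\<^sup>2) \<le> 10 / (\<theta> * m)"
    "expectation (\<lambda>\<omega>. b r \<omega> - e' r) = 0" if r: "r \<in> {1..k}" for r
  proof -
    note R = rectangle[OF r]
    show "integrable P (\<lambda>\<omega>. (b r \<omega> - e' r)\<^sup>2)"
      using poisson_rectangle.b_centered(1)[OF R] by (simp add: b_eq[OF r] e'_def)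
    have "10 / (\<theta> * h r) \<le> 10 / (\<theta> * m)"
      using bounds[OF r] \<theta> m_pos by (intro divide_left_mono mult_left_mono) (auto intro!: mult_pos_pos)
    then show "expectation (\<lambda>\<omega>. (b r \<omega> - e' r)\<^sup>2) \<le> 10 / (\<theta> * m)"
      using poisson_rectangle.b_centered(2)[OF R] by (simp add: b_eq[OF r] e'_def)
    show "expectation (\<lambda>\<omega>. b r \<omega> - e' r) = 0"
      using poisson_rectangle.b_mean[OF R]
      by (simp add: has_bochner_integral_iff b_eq[OF r, symmetric] e'_def prob_space)
  qed
  have ind: "indep_vars (\<lambda>_. borel) ?X {1..k}"
    by (rule indep_vars_compose2[OF indep_gap_b(2)]) simp
  have sq: "integrable P (\<lambda>\<omega>. (?X r \<omega>)\<^sup>2)" "expectation (?X r) = 0" if "r \<in> {1..k}" for r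
    using cb[OF that] by (simp_all add: power_mult_distrib)
  note S = indep_centered_sum_second_moment[OF _ ind sq]
  have iB2: "integrable P (\<lambda>\<omega>. (?B \<omega>)\<^sup>2)" and iB: "integrable P ?B" using S by simp_all
  have "expectation (\<lambda>\<omega>. (?B \<omega>)\<^sup>2) = (\<Sum>r = 1..k. (w r)\<^sup>2 * expectation (\<lambda>\<omega>. (b r \<omega> - e' r)\<^sup>2))"
    using S by (simp add: power_mult_distrib)
  also have "\<dots> \<le> (\<Sum>r = 1..k. (w r)\<^sup>2 * (10 / (\<theta> * m)))"
    using cb(2) by (intro sum_mono mult_left_mono) auto
  finally have "expectation (\<lambda>\<omega>. (?B \<omega>)\<^sup>2) \<le> (\<Sum>r = 1..k. (w r)\<^sup>2) * (10 / (\<theta> * m))"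
    by (simp only: sum_distrib_right)
  then have EB: "expectation (\<lambda>\<omega>. \<bar>?B \<omega>\<bar>) \<le> sqrt ((\<Sum>r = 1..k. (w r)\<^sup>2) * (10 / (\<theta> * m)))"
    using abs_mean_le_sqrt(2)[OF borel_measurable_integrable[OF iB] iB2] by (meson order_trans real_sqrt_le_mono)
  have C: "\<bar>?C\<bar> \<le> \<theta> * M * exp (- (\<theta> * m)) * (\<Sum>r = 1..k. \<bar>w r\<bar>)"
  proof -
    have "\<bar>e' r - e r\<bar> \<le> \<theta> * M * exp (- (\<theta> * m))" if r: "r \<in> {1..k}" for r
    proof -
      \<comment> \<open>With y = \<theta> h r the two means differ by exactly y exp (- y).\<close>
      have "\<bar>e' r - e r\<bar> = \<theta> * h r * exp (- (\<theta> * h r))"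
        using bounds[OF r] m_pos \<theta> by (simp add: e'_def e_def algebra_simps abs_mult)
      also have "\<dots> \<le> \<theta> * M * exp (- (\<theta> * m))"
        using bounds[OF r] m_pos \<theta> by (intro mult_mono) (auto intro: mult_left_mono)
      finally show ?thesis .
    qed
    then have "\<bar>?C\<bar> \<le> (\<Sum>r = 1..k. \<bar>w r\<bar> * (\<theta> * M * exp (- (\<theta> * m))))"
      by (intro order_trans[OF sum_abs] sum_mono) (auto simp: abs_mult intro!: mult_left_mono)
    then show ?thesis by (simp add: sum_distrib_right mult.commute)
  qed
  show iD: "integrable P ?D" unfolding D using iA iB by simp
  have "expectation (\<lambda>\<omega>. \<bar>?D \<omega>\<bar>) \<le> expectation (\<lambda>\<omega>. \<bar>?A \<omega>\<bar> + \<bar>?B \<omega>\<bar> + \<bar>?C\<bar>)"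
    unfolding D using iA iB
    by (intro integral_mono Bochner_Integration.integrable_add integrable_abs) auto
  also have "\<dots> = expectation (\<lambda>\<omega>. \<bar>?A \<omega>\<bar>) + expectation (\<lambda>\<omega>. \<bar>?B \<omega>\<bar>) + \<bar>?C\<bar>"
    using iA iB by (simp add: prob_space)
  finally show "expectation (\<lambda>\<omega>. \<bar>?D \<omega>\<bar>)
      \<le> (\<theta> * \<Delta> * (3 + 2 * \<theta> * \<Delta>) + \<theta> * M * exp (- (\<theta> * m))) * (\<Sum>r = 1..k. \<bar>w r\<bar>)
        + sqrt ((\<Sum>r = 1..k. (w r)\<^sup>2) * (10 / (\<theta> * m)))"
    using EA EB C by (simp add: distrib_right)
qed

lemma W_mean:
  assumes r: "r \<in> {1..k}"
  shows "integrable P (W r)" "expectation (\<lambda>\<omega>. \<bar>W r \<omega>\<bar>) \<le> \<Delta> * (3 + 2 * \<theta> * \<Delta>) + M"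
proof -
  have "integrable P (\<lambda>\<omega>. (W r \<omega> - W' r \<omega>) + W' r \<omega>)"
    using W_close(1)[OF r] W'_mean(1)[OF r] by (rule Bochner_Integration.integrable_add)
  then show i: "integrable P (W r)" by simp
  have "expectation (\<lambda>\<omega>. \<bar>W r \<omega>\<bar>) \<le> expectation (\<lambda>\<omega>. \<bar>W r \<omega> - W' r \<omega>\<bar> + \<bar>W' r \<omega>\<bar>)"
    using i W_close(1)[OF r] W'_mean(1)[OF r] by (intro integral_mono) auto
  then show "expectation (\<lambda>\<omega>. \<bar>W r \<omega>\<bar>) \<le> \<Delta> * (3 + 2 * \<theta> * \<Delta>) + M"
    using W_close[OF r] W'_mean[OF r] by simp
qed

text \<open>A crude bound, enough for the consistency of \<open>a_hat\<close>: \<open>gap\<close>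
  and \<open>b\<close> are nonnegative with mean at most 1, and their difference divided by \<theta>
  separates \<open>W'\<close> from h.\<close>

lemma W_deviation:
  assumes r: "r \<in> {1..k}"
  shows "expectation (\<lambda>\<omega>. \<bar>W r \<omega> - h r\<bar>) \<le> \<Delta> * (3 + 2 * \<theta> * \<Delta>) + 2 / \<theta>"
proof -
  note R = rectangle[OF r]
  have g: "integrable P (gap r)" "expectation (gap r) \<le> 1"
    using poisson_rectangle.U1[OF R] by (auto simp: has_bochner_integral_iff)
  have bb: "integrable P (b r)" "expectation (b r) \<le> 1"
    using poisson_rectangle.b_mean[OF R] bounds[OF r] m_pos \<theta>
    by (auto simp: has_bochner_integral_iff b_eq[OF r, symmetric])
  have gr: "0 \<le> gap r \<omega> \<and> gap r \<omega> \<le> \<theta> * h r" if "\<omega> \<in> space P" for \<omega>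
    using poisson_rectangle.U_range[OF R that] .
  have "expectation (\<lambda>\<omega>. \<bar>W r \<omega> - h r\<bar>) \<le> expectation (\<lambda>\<omega>. \<bar>W r \<omega> - W' r \<omega>\<bar> + (gap r \<omega> + b r \<omega>) / \<theta>)"
  proof (rule integral_mono)
    fix \<omega> assume \<omega>: "\<omega> \<in> space P"
    have "W' r \<omega> - h r = (b r \<omega> - gap r \<omega>) / \<theta>"
      using W'_decomp[OF r, of \<omega>] \<theta> by (simp add: field_simps)
    then have "\<bar>W' r \<omega> - h r\<bar> = \<bar>b r \<omega> - gap r \<omega>\<bar> / \<theta>" using \<theta> by simp
    also have "\<dots> \<le> (gap r \<omega> + b r \<omega>) / \<theta>"
      using gr[OF \<omega>] \<theta> by (intro divide_right_mono) (auto simp: b_def abs_le_iff)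
    finally show "\<bar>W r \<omega> - h r\<bar> \<le> \<bar>W r \<omega> - W' r \<omega>\<bar> + (gap r \<omega> + b r \<omega>) / \<theta>" by linarith
  qed (use W_mean(1)[OF r] W_close(1)[OF r] g(1) bb(1) in auto)
  also have "\<dots> = expectation (\<lambda>\<omega>. \<bar>W r \<omega> - W' r \<omega>\<bar>) + (expectation (gap r) + expectation (b r)) / \<theta>"
    using W_close(1)[OF r] g(1) bb(1) by simp
  also have "\<dots> \<le> \<Delta> * (3 + 2 * \<theta> * \<Delta>) + 2 / \<theta>"
    using W_close(2)[OF r] g(2) bb(2) \<theta> by (intro add_mono divide_right_mono) auto
  finally show ?thesis .
qed

section \<open>Replacing f by its cell infima; consistency of the total mass\<close>

lemma AE_step: "AE x in \<nu>. \<bar>nu.step h x - f x\<bar> \<le> \<Delta> \<and> 0 \<le> f x \<and> f x \<le> M"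
proof -
  have "AE x in \<nu>. \<forall>r\<in>{1..k}. (x \<in> I r \<longrightarrow> h r \<le> f x) \<and> (x \<in> I r \<longrightarrow> f x \<le> H r)"
    using lower upper by (intro AE_finite_allI) auto
  then show ?thesis
    using AE_space
  proof eventually_elim
    case (elim x)
    then obtain r where r: "r \<in> {1..k}" "x \<in> I r" using I_Un by blast
    then show ?case using elim bounds[OF r(1)] nu.step_eq[OF r, of h] f_nonneg by force
  qed
qed

lemma integrable_mult_f:
  assumes g: "integrable \<nu> g" shows "integrable \<nu> (\<lambda>x. g x * f x)"
proof (rule Bochner_Integration.integrable_bound[of \<nu> "\<lambda>x. \<bar>g x\<bar> * M"])
  have [measurable]: "g \<in> borel_measurable \<nu>" using g by simp
  show "(\<lambda>x. g x * f x) \<in> borel_measurable \<nu>" by simp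
  show "integrable \<nu> (\<lambda>x. \<bar>g x\<bar> * M)" using g by simp
  have M: "0 \<le> M" using bounds[of 1] k m_pos by auto
  show "AE x in \<nu>. norm (g x * f x) \<le> norm (\<bar>g x\<bar> * M)"
    using AE_step by eventually_elim (use M in \<open>auto simp: abs_mult intro!: mult_left_mono\<close>)
qed

text \<open>Almost everywhere f and the step function of the infima lie in the same interval
  [h r, H r], so exchanging them costs at most \<Delta> against |g|.\<close>

lemma cell_sum_close:
  assumes g: "integrable \<nu> (g :: 'a \<Rightarrow> real)"
  shows "\<bar>(\<Sum>r = 1..k. (LINT t:I r|\<nu>. g t) * h r) - (\<integral>x. g x * f x \<partial>\<nu>)\<bar> \<le> \<Delta> * norm1 \<nu> g"
proof -
  note i = integrable_mult_f[OF g] nu.sum_cell_integrals(1)[OF g, of h]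
  have "\<bar>(\<integral>x. g x * nu.step h x \<partial>\<nu>) - (\<integral>x. g x * f x \<partial>\<nu>)\<bar> = \<bar>\<integral>x. g x * nu.step h x - g x * f x \<partial>\<nu>\<bar>"
    using i by simp
  also have "\<dots> \<le> (\<integral>x. \<bar>g x * nu.step h x - g x * f x\<bar> \<partial>\<nu>)" by (rule integral_abs_bound)
  also have "\<dots> \<le> (\<integral>x. \<Delta> * \<bar>g x\<bar> \<partial>\<nu>)"
  proof (rule integral_mono_AE)
    show "AE x in \<nu>. \<bar>g x * nu.step h x - g x * f x\<bar> \<le> \<Delta> * \<bar>g x\<bar>"
      using AE_step
    proof eventually_elim
      case (elim x)
      have "\<bar>g x * nu.step h x - g x * f x\<bar> = \<bar>nu.step h x - f x\<bar> * \<bar>g x\<bar>"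
        by (simp add: abs_mult[symmetric] algebra_simps)
      then show ?case using elim by (simp add: mult_right_mono)
    qed
  qed (use i g in auto)
  finally show ?thesis unfolding nu.sum_cell_integrals(2)[OF g] norm1_def by simp
qed

lemma integrable_f: "integrable \<nu> f"
  using integrable_mult_f[of "\<lambda>_. 1"] by simp

text \<open>Averages \<open>W_deviation\<close> over the cells; a further \<Delta> comes from
  replacing the mean of the infima by the integral of f.\<close>

lemma a_hat_L1:
  shows "integrable P (\<lambda>\<omega>. a_hat \<nu> f k I (N \<omega>) (X \<omega>) (Y \<omega>))"
    and "expectation (\<lambda>\<omega>. \<bar>a_hat \<nu> f k I (N \<omega>) (X \<omega>) (Y \<omega>) - (\<integral>x. f x \<partial>\<nu>)\<bar>) \<le> \<Delta> * (4 + 2 * \<theta> * \<Delta>) + 2 / \<theta>"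
proof -
  have a: "a_hat \<nu> f k I (N \<omega>) (X \<omega>) (Y \<omega>) = (\<Sum>r = 1..k. W r \<omega> / real k)" for \<omega>
    unfolding a_hat_def using graph_cell.W_def[OF cell] I_measure by (intro sum.cong) auto
  show i: "integrable P (\<lambda>\<omega>. a_hat \<nu> f k I (N \<omega>) (X \<omega>) (Y \<omega>))"
    unfolding a using W_mean(1) by (intro Bochner_Integration.integrable_sum) auto
  have avg: "\<bar>(\<Sum>r = 1..k. h r / real k) - (\<integral>x. f x \<partial>\<nu>)\<bar> \<le> \<Delta>"
  proof -
    have "(LINT t:I r|\<nu>. (1::real)) = 1 / real k" if "r \<in> {1..k}" for r
      using I[OF that] I_measure[OF that] by (simp add: set_lebesgue_integral_def)
    then have "(\<Sum>r = 1..k. h r / real k) = (\<Sum>r = 1..k. (LINT t:I r|\<nu>. (1::real)) * h r)"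
      by (intro sum.cong) auto
    then show ?thesis using cell_sum_close[of "\<lambda>_. 1"] by (simp add: norm1_def nu.prob_space)
  qed
  have "expectation (\<lambda>\<omega>. \<bar>a_hat \<nu> f k I (N \<omega>) (X \<omega>) (Y \<omega>) - (\<integral>x. f x \<partial>\<nu>)\<bar>)
      \<le> expectation (\<lambda>\<omega>. (\<Sum>r = 1..k. \<bar>W r \<omega> - h r\<bar> / real k) + \<Delta>)"
  proof (rule integral_mono)
    show "integrable P (\<lambda>\<omega>. \<bar>a_hat \<nu> f k I (N \<omega>) (X \<omega>) (Y \<omega>) - (\<integral>x. f x \<partial>\<nu>)\<bar>)" using i by simp
    show "integrable P (\<lambda>\<omega>. (\<Sum>r = 1..k. \<bar>W r \<omega> - h r\<bar> / real k) + \<Delta>)"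
      using W_mean(1) by (intro Bochner_Integration.integrable_add Bochner_Integration.integrable_sum) auto
    fix \<omega>
    have "\<bar>(\<Sum>r = 1..k. W r \<omega> / real k) - (\<Sum>r = 1..k. h r / real k)\<bar> \<le> (\<Sum>r = 1..k. \<bar>W r \<omega> - h r\<bar> / real k)"
      unfolding sum_subtractf[symmetric] diff_divide_distrib[symmetric]
      by (rule order_trans[OF sum_abs]) simp
    then show "\<bar>a_hat \<nu> f k I (N \<omega>) (X \<omega>) (Y \<omega>) - (\<integral>x. f x \<partial>\<nu>)\<bar> \<le> (\<Sum>r = 1..k. \<bar>W r \<omega> - h r\<bar> / real k) + \<Delta>"
      unfolding a using avg by linarith
  qed
  also have "\<dots> = (\<Sum>r = 1..k. expectation (\<lambda>\<omega>. \<bar>W r \<omega> - h r\<bar>) / real k) + \<Delta>"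
  proof -
    have "integrable P (\<lambda>\<omega>. \<bar>W r \<omega> - h r\<bar> / real k)" if "r \<in> {1..k}" for r using W_mean(1)[OF that] by simp
    note i = this
    have "integrable P (\<lambda>\<omega>. \<Sum>r = 1..k. \<bar>W r \<omega> - h r\<bar> / real k)"
      by (rule Bochner_Integration.integrable_sum) (rule i)
    then have "expectation (\<lambda>\<omega>. (\<Sum>r = 1..k. \<bar>W r \<omega> - h r\<bar> / real k) + \<Delta>)
        = expectation (\<lambda>\<omega>. \<Sum>r = 1..k. \<bar>W r \<omega> - h r\<bar> / real k) + \<Delta>"
      by (subst Bochner_Integration.integral_add) (simp_all add: prob_space)
    also have "expectation (\<lambda>\<omega>. \<Sum>r = 1..k. \<bar>W r \<omega> - h r\<bar> / real k)
        = (\<Sum>r = 1..k. expectation (\<lambda>\<omega>. \<bar>W r \<omega> - h r\<bar> / real k))"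
      by (rule Bochner_Integration.integral_sum) (rule i)
    finally show ?thesis by simp
  qed
  also have "\<dots> \<le> (\<Sum>r = 1..k. (\<Delta> * (3 + 2 * \<theta> * \<Delta>) + 2 / \<theta>) / real k) + \<Delta>"
    using W_deviation by (intro add_right_mono sum_mono divide_right_mono) auto
  also have "(\<Sum>r = 1..k. (\<Delta> * (3 + 2 * \<theta> * \<Delta>) + 2 / \<theta>) / real k) = \<Delta> * (3 + 2 * \<theta> * \<Delta>) + 2 / \<theta>"
    using k by simp
  also have "\<dots> + \<Delta> = \<Delta> * (4 + 2 * \<theta> * \<Delta>) + 2 / \<theta>" by (simp add: algebra_simps)
  finally show "expectation (\<lambda>\<omega>. \<bar>a_hat \<nu> f k I (N \<omega>) (X \<omega>) (Y \<omega>) - (\<integral>x. f x \<partial>\<nu>)\<bar>) \<le> \<Delta> * (4 + 2 * \<theta> * \<Delta>) + 2 / \<theta>" .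
qed

text \<open>The count of \<open>S\<close> is Poisson with mean \<kappa> a, so after division by
  \<kappa> its deviation has order 1 / sqrt \<kappa>. The lower bound m keeps the limit of the
  denominator of \<open>c_hat\<close> away from 0.\<close>

lemma c_hat_L1:
  defines "a \<equiv> \<integral>x. f x \<partial>\<nu>"
  shows "m \<le> a" "integrable P (\<lambda>\<omega>. measure (N \<omega>) S)"
    "expectation (\<lambda>\<omega>. \<bar>measure (N \<omega>) S / \<kappa> - a\<bar>) \<le> sqrt (a / \<kappa>)"
proof -
  have "AE x in \<nu>. \<forall>r\<in>{1..k}. x \<in> I r \<longrightarrow> h r \<le> f x"
    using lower by (intro AE_finite_allI) auto
  then have "AE x in \<nu>. m \<le> f x"
    using AE_space
  proof eventually_elim
    case (elim x)
    then obtain r where r: "r \<in> {1..k}" "x \<in> I r" using I_Un by blast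
    then show ?case using elim bounds[OF r(1)] by force
  qed
  then have "(\<integral>x. m \<partial>\<nu>) \<le> a" unfolding a_def using integrable_f by (intro integral_mono_AE) auto
  then show ma: "m \<le> a" by (simp add: nu.prob_space)
  have S: "S \<in> sets Z" by simp
  have \<mu>: "emeasure E S = ennreal (\<kappa> * a)" "0 \<le> \<kappa> * a"
    using emeasure_S[OF integrable_f] ma m_pos \<kappa> by (auto simp: a_def)
  show i: "integrable P (\<lambda>\<omega>. measure (N \<omega>) S)" by (rule count_L1(1)[OF S \<mu>])
  have "\<bar>measure (N \<omega>) S / \<kappa> - a\<bar> = \<bar>measure (N \<omega>) S - \<kappa> * a\<bar> / \<kappa>" for \<omega>
  proof -
    have "measure (N \<omega>) S / \<kappa> - a = (measure (N \<omega>) S - \<kappa> * a) / \<kappa>" using \<kappa> by (simp add: field_simps)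
    then show ?thesis using \<kappa> by simp
  qed
  then have "expectation (\<lambda>\<omega>. \<bar>measure (N \<omega>) S / \<kappa> - a\<bar>) = expectation (\<lambda>\<omega>. \<bar>measure (N \<omega>) S - \<kappa> * a\<bar>) / \<kappa>"
    by simp
  also have "\<dots> \<le> sqrt (\<kappa> * a) / \<kappa>"
    using count_L1(2)[OF S \<mu>] \<kappa> by (intro divide_right_mono) auto
  also have "\<dots> = sqrt (a / \<kappa>)"
    using \<kappa> by (simp add: real_sqrt_mult real_sqrt_divide field_simps) 
  finally show "expectation (\<lambda>\<omega>. \<bar>measure (N \<omega>) S / \<kappa> - a\<bar>) \<le> sqrt (a / \<kappa>)" .
qed

end

section \<open>Limits in probability\<close>

text \<open>Convergence in probability is expressed below by expectations of min 1 |X - Y|; this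
  inequality lets them control characteristic functions.\<close>

lemma cmod_iexp_diff_le: "cmod (iexp x - iexp y) \<le> 2 * min 1 \<bar>x - y\<bar>"
proof -
  have "iexp x - iexp y = iexp y * (iexp (x - y) - 1)"
    by (simp add: right_diff_distrib exp_add[symmetric] of_real_diff algebra_simps)
  then have eq: "cmod (iexp x - iexp y) = cmod (iexp (x - y) - 1)" by (simp add: norm_mult)
  have "cmod (iexp (x - y) - 1) \<le> \<bar>x - y\<bar>"
    using iexp_approx1[of "x - y" 0] by simp
  moreover have "cmod (iexp (x - y) - 1) \<le> 2"
    using norm_triangle_ineq4[of "iexp (x - y)" 1] by simp
  moreover have "t \<le> 2 * min 1 d" if "t \<le> d" "t \<le> 2" "0 \<le> d" for t d :: real
    using that by (simp add: min_def)
  ultimately show ?thesis unfolding eq using abs_ge_zero by blast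
qed

context prob_space
begin

lemma integrable_min_abs: "X \<in> borel_measurable M \<Longrightarrow> integrable M (\<lambda>\<omega>. min 1 \<bar>X \<omega> :: real\<bar>)"
  by (rule integrable_const_bound[of _ 1]) auto

lemma min_abs_mean_le: "integrable M (X :: 'a \<Rightarrow> real) \<Longrightarrow> expectation (\<lambda>\<omega>. min 1 \<bar>X \<omega>\<bar>) \<le> expectation (\<lambda>\<omega>. \<bar>X \<omega>\<bar>)"
  by (intro integral_mono integrable_min_abs) auto

lemma char_diff_le:
  fixes X Y :: "'a \<Rightarrow> real"
  assumes [measurable]: "X \<in> borel_measurable M" "Y \<in> borel_measurable M"
  shows "cmod ((\<integral>\<omega>. iexp (X \<omega>) \<partial>M) - (\<integral>\<omega>. iexp (Y \<omega>) \<partial>M)) \<le> 2 * expectation (\<lambda>\<omega>. min 1 \<bar>X \<omega> - Y \<omega>\<bar>)"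
proof -
  have i: "integrable M (\<lambda>\<omega>. iexp (X \<omega>))" "integrable M (\<lambda>\<omega>. iexp (Y \<omega>))"
    by (auto intro!: integrable_const_bound[of _ 1])
  have "cmod ((\<integral>\<omega>. iexp (X \<omega>) \<partial>M) - (\<integral>\<omega>. iexp (Y \<omega>) \<partial>M)) = cmod (\<integral>\<omega>. iexp (X \<omega>) - iexp (Y \<omega>) \<partial>M)"
    using i by simp
  also have "\<dots> \<le> expectation (\<lambda>\<omega>. cmod (iexp (X \<omega>) - iexp (Y \<omega>)))" by (rule integral_norm_bound)
  also have "\<dots> \<le> expectation (\<lambda>\<omega>. 2 * min 1 \<bar>X \<omega> - Y \<omega>\<bar>)"
    using i integrable_min_abs[of "\<lambda>\<omega>. X \<omega> - Y \<omega>"]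
    by (intro integral_mono cmod_iexp_diff_le integrable_norm Bochner_Integration.integrable_diff integrable_mult_right) auto
  finally show ?thesis by simp
qed

text \<open>A Slutsky argument: where |D| is at most a small e the product is at most e |Z|, and
  elsewhere min 1 |D| / e is already at least 1.\<close>

lemma mult_vanishes:
  fixes D Z :: "nat \<Rightarrow> 'a \<Rightarrow> real"
  assumes D: "\<And>n. D n \<in> borel_measurable M" and Z: "\<And>n. integrable M (Z n)"
    and B: "eventually (\<lambda>n. expectation (\<lambda>\<omega>. \<bar>Z n \<omega>\<bar>) \<le> B) sequentially"
    and lim: "(\<lambda>n. expectation (\<lambda>\<omega>. min 1 \<bar>D n \<omega>\<bar>)) \<longlonglongrightarrow> 0"
  shows "(\<lambda>n. expectation (\<lambda>\<omega>. min 1 \<bar>D n \<omega> * Z n \<omega>\<bar>)) \<longlonglongrightarrow> 0"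
proof (rule tendstoI)
  fix r :: real assume r: "0 < r"
  define B' where "B' = max B 1"
  \<comment> \<open>e \<le> 1 ensures min 1 |d| \<ge> e whenever |d| > e, and \<open>B'\<close>
    keeps the denominator positive for any B.\<close>
  define e where "e = min 1 (r / (2 * B'))"
  have e: "0 < e" "e \<le> 1" "e * B' \<le> r / 2" using r by (auto simp: e_def B'_def min_def field_simps)
  have pt: "min 1 \<bar>d * z\<bar> \<le> e * \<bar>z\<bar> + min 1 \<bar>d\<bar> / e" for d z :: real
  proof (cases "\<bar>d\<bar> \<le> e")
    case True
    then have "\<bar>d * z\<bar> \<le> e * \<bar>z\<bar>" by (simp add: abs_mult mult_right_mono)
    moreover have "0 \<le> min 1 \<bar>d\<bar> / e" using e by simp
    ultimately show ?thesis by linarith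
  next
    case False
    then have "1 \<le> min 1 \<bar>d\<bar> / e" using e by (auto simp: le_divide_eq)
    moreover have "0 \<le> e * \<bar>z\<bar>" using e by simp
    ultimately show ?thesis by linarith
  qed
  have "eventually (\<lambda>n. expectation (\<lambda>\<omega>. min 1 \<bar>D n \<omega>\<bar>) < e * (r / 2)) sequentially"
    using lim e r by (intro order_tendstoD(2)) auto
  then show "eventually (\<lambda>n. dist (expectation (\<lambda>\<omega>. min 1 \<bar>D n \<omega> * Z n \<omega>\<bar>)) 0 < r) sequentially"
    using B
  proof eventually_elim
    case (elim n)
    note [measurable] = D borel_measurable_integrable[OF Z]
    have "expectation (\<lambda>\<omega>. min 1 \<bar>D n \<omega> * Z n \<omega>\<bar>) \<le> expectation (\<lambda>\<omega>. e * \<bar>Z n \<omega>\<bar> + min 1 \<bar>D n \<omega>\<bar> / e)"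
      using Z[of n] integrable_min_abs[OF D] pt
      by (intro integral_mono integrable_min_abs Bochner_Integration.integrable_add) auto
    also have "\<dots> = e * expectation (\<lambda>\<omega>. \<bar>Z n \<omega>\<bar>) + expectation (\<lambda>\<omega>. min 1 \<bar>D n \<omega>\<bar>) / e"
      using Z[of n] integrable_min_abs[OF D] by simp
    also have "\<dots> < e * B' + r / 2"
    proof (rule add_le_less_mono)
      show "e * expectation (\<lambda>\<omega>. \<bar>Z n \<omega>\<bar>) \<le> e * B'" using elim e by (intro mult_left_mono) (auto simp: B'_def)
      show "expectation (\<lambda>\<omega>. min 1 \<bar>D n \<omega>\<bar>) / e < r / 2" using elim e by (simp add: divide_less_eq mult.commute)
    qed
    also have "\<dots> \<le> r" using e by simp
    finally have "expectation (\<lambda>\<omega>. min 1 \<bar>D n \<omega> * Z n \<omega>\<bar>) < r" .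
    moreover have "0 \<le> expectation (\<lambda>\<omega>. min 1 \<bar>D n \<omega> * Z n \<omega>\<bar>)" by (intro integral_nonneg_AE) auto
    ultimately show ?case by simp
  qed
qed

end

text \<open>If B is not within a / 2 of a, the right side is at least 1 whatever the quotient is;
  this covers B = 0 too. Otherwise B > a / 2 supplies the constant 2 / a.\<close>

lemma ratio_close:
  fixes a A B :: real
  assumes a: "0 < a"
  shows "min 1 \<bar>A / B - 1\<bar> \<le> 2 / a * (\<bar>A - a\<bar> + \<bar>B - a\<bar>)"
proof (cases "\<bar>B - a\<bar> < a / 2")
  case True
  then have B: "a / 2 < B" by linarith
  then have "\<bar>A / B - 1\<bar> = \<bar>A - B\<bar> / B" using a by (simp add: field_simps abs_divide[symmetric])
  also have "\<dots> \<le> \<bar>A - B\<bar> / (a / 2)" using B a by (intro divide_left_mono) auto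
  also have "\<dots> \<le> (\<bar>A - a\<bar> + \<bar>B - a\<bar>) / (a / 2)" using a by (intro divide_right_mono) auto
  finally show ?thesis by (simp add: min_def field_simps)
next
  case False
  then have "1 \<le> 2 / a * \<bar>B - a\<bar>" using a by (simp add: field_simps)
  also have "\<dots> \<le> 2 / a * (\<bar>A - a\<bar> + \<bar>B - a\<bar>)" using a by (intro mult_left_mono) auto
  finally show ?thesis by simp
qed

text \<open>The hypotheses start at n = 1, so the limits are first obtained for the shifted
  sequence.\<close>

lemma converges_in_distribution_Suc:
  assumes "converges_in_distribution P (\<lambda>n. Z (Suc n)) \<mu>"
  shows "converges_in_distribution P Z \<mu>"
  using assms
  unfolding converges_in_distribution_def
    eventually_sequentially_Suc[of "\<lambda>n. Z n \<in> borel_measurable P"]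
    filterlim_sequentially_Suc[where f = "\<lambda>n. \<integral>\<omega>. _ (Z n \<omega>) \<partial>P"] .

text \<open>\<open>L\<close> is an approximation whose characteristic functions are known;
  coordinatewise closeness in probability transfers their limits to \<open>Z\<close>.\<close>

theorem converges_to_gaussianI:
  fixes Z L :: "nat \<Rightarrow> 'w \<Rightarrow> real ^ 'p::finite" and C :: "real ^ 'p ^ 'p"
  assumes P: "prob_space P"
    and Z: "\<And>n. 1 \<le> n \<Longrightarrow> Z n \<in> borel_measurable P" and L: "\<And>n. 1 \<le> n \<Longrightarrow> L n \<in> borel_measurable P"
    and sym: "\<And>i j. C $ i $ j = C $ j $ i" and psd: "\<And>v. 0 \<le> v \<bullet> (C *v v)"
    and char: "\<And>v. (\<lambda>n. \<integral>\<omega>. iexp (v \<bullet> L n \<omega>) \<partial>P) \<longlonglongrightarrow> exp (- (v \<bullet> (C *v v)) / 2)"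
    and close: "\<And>j. (\<lambda>n. \<integral>\<omega>. min 1 \<bar>Z n \<omega> $ j - L n \<omega> $ j\<bar> \<partial>P) \<longlonglongrightarrow> 0"
  shows "converges_to_gaussian P Z C"
proof -
  interpret prob_space P by fact
  obtain \<mu> where \<mu>: "prob_space \<mu>" "sets \<mu> = sets borel" "centered_gaussian C \<mu>"
    "\<And>v. (\<integral>z. iexp (v \<bullet> z) \<partial>\<mu>) = exp (- (v \<bullet> (C *v v)) / 2)"
    using gaussian_exists[OF sym psd] by blast
  have "converges_in_distribution P (\<lambda>n. Z (Suc n)) \<mu>"
  proof (rule levy_continuity_euclidean[OF P _ \<mu>(1,2)])
    show "Z (Suc n) \<in> borel_measurable P" for n by (rule Z) simp
    fix v :: "real ^ 'p"
    \<comment> \<open>V dominates every coefficient of v, and V \<ge> 1 settles the case that some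
      coordinate differs by more than 1.\<close>
    define V where "V = 1 + (\<Sum>j\<in>UNIV. \<bar>v $ j\<bar>)"
    have V: "1 \<le> V" "\<bar>v $ j\<bar> \<le> V" for j
      using member_le_sum[of j UNIV "\<lambda>j. \<bar>v $ j\<bar>"] by (auto simp: V_def intro: sum_nonneg)
    have bound: "cmod ((\<integral>\<omega>. iexp (v \<bullet> Z n \<omega>) \<partial>P) - (\<integral>\<omega>. iexp (v \<bullet> L n \<omega>) \<partial>P))
        \<le> 2 * V * (\<Sum>j\<in>UNIV. expectation (\<lambda>\<omega>. min 1 \<bar>Z n \<omega> $ j - L n \<omega> $ j\<bar>))" if "1 \<le> n" for n
    proof -
      note [measurable] = Z[OF that] L[OF that]
      have ij: "integrable P (\<lambda>\<omega>. min 1 \<bar>Z n \<omega> $ j - L n \<omega> $ j\<bar>)" for j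
        using borel_measurable_inner[OF Z[OF that] borel_measurable_const[of "axis j 1"]]
          borel_measurable_inner[OF L[OF that] borel_measurable_const[of "axis j 1"]]
        by (intro integrable_min_abs borel_measurable_diff) (simp_all add: inner_axis)
      have pt: "min 1 \<bar>v \<bullet> z - v \<bullet> l\<bar> \<le> V * (\<Sum>j\<in>UNIV. min 1 \<bar>z $ j - l $ j\<bar>)" for z l :: "real ^ 'p"
      proof (cases "\<forall>j. \<bar>z $ j - l $ j\<bar> \<le> 1")
        case True
        have "\<bar>v \<bullet> z - v \<bullet> l\<bar> \<le> (\<Sum>j\<in>UNIV. \<bar>v $ j * (z $ j - l $ j)\<bar>)"
        proof -
          have "v \<bullet> z - v \<bullet> l = (\<Sum>j\<in>UNIV. v $ j * (z $ j - l $ j))"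
            by (simp add: inner_vec_def sum_subtractf right_diff_distrib)
          then show ?thesis by (simp only: sum_abs)
        qed
        also have "\<dots> \<le> (\<Sum>j\<in>UNIV. V * min 1 \<bar>z $ j - l $ j\<bar>)"
          using V True by (intro sum_mono) (auto simp: abs_mult min_absorb2 intro!: mult_right_mono)
        finally show ?thesis by (simp add: sum_distrib_left)
      next
        case False
        then obtain j where "1 < \<bar>z $ j - l $ j\<bar>" by (auto simp: not_le)
        then have "min 1 \<bar>z $ j - l $ j\<bar> = 1" by simp
        then have "1 \<le> (\<Sum>j\<in>UNIV. min 1 \<bar>z $ j - l $ j\<bar>)"
          using member_le_sum[of j UNIV "\<lambda>j. min 1 \<bar>z $ j - l $ j\<bar>"] by simp
        then have "1 * 1 \<le> V * (\<Sum>j\<in>UNIV. min 1 \<bar>z $ j - l $ j\<bar>)" using V by (intro mult_mono) auto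
        then show ?thesis by simp
      qed
      have "cmod ((\<integral>\<omega>. iexp (v \<bullet> Z n \<omega>) \<partial>P) - (\<integral>\<omega>. iexp (v \<bullet> L n \<omega>) \<partial>P))
          \<le> 2 * expectation (\<lambda>\<omega>. min 1 \<bar>v \<bullet> Z n \<omega> - v \<bullet> L n \<omega>\<bar>)"
        by (rule char_diff_le) simp_all
      also have "\<dots> \<le> 2 * expectation (\<lambda>\<omega>. V * (\<Sum>j\<in>UNIV. min 1 \<bar>Z n \<omega> $ j - L n \<omega> $ j\<bar>))"
      proof (intro mult_left_mono integral_mono pt)
        show "integrable P (\<lambda>\<omega>. min 1 \<bar>v \<bullet> Z n \<omega> - v \<bullet> L n \<omega>\<bar>)" by (rule integrable_min_abs) simp
        show "integrable P (\<lambda>\<omega>. V * (\<Sum>j\<in>UNIV. min 1 \<bar>Z n \<omega> $ j - L n \<omega> $ j\<bar>))"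
          using ij by (intro integrable_mult_right Bochner_Integration.integrable_sum) auto
      qed simp
      also have "\<dots> = 2 * V * (\<Sum>j\<in>UNIV. expectation (\<lambda>\<omega>. min 1 \<bar>Z n \<omega> $ j - L n \<omega> $ j\<bar>))"
        using ij by (simp add: Bochner_Integration.integral_sum)
      finally show ?thesis .
    qed
    have "(\<lambda>n. 2 * V * (\<Sum>j\<in>UNIV. expectation (\<lambda>\<omega>. min 1 \<bar>Z n \<omega> $ j - L n \<omega> $ j\<bar>))) \<longlonglongrightarrow> 2 * V * (\<Sum>j\<in>(UNIV :: 'p set). 0)"
      by (intro tendsto_mult tendsto_const tendsto_sum close)
    then have "(\<lambda>n. 2 * V * (\<Sum>j\<in>UNIV. expectation (\<lambda>\<omega>. min 1 \<bar>Z n \<omega> $ j - L n \<omega> $ j\<bar>))) \<longlonglongrightarrow> 0" by simp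
    moreover have "eventually (\<lambda>n. cmod ((\<integral>\<omega>. iexp (v \<bullet> Z n \<omega>) \<partial>P) - (\<integral>\<omega>. iexp (v \<bullet> L n \<omega>) \<partial>P))
        \<le> 2 * V * (\<Sum>j\<in>UNIV. expectation (\<lambda>\<omega>. min 1 \<bar>Z n \<omega> $ j - L n \<omega> $ j\<bar>))) sequentially"
      using bound by (rule eventually_sequentiallyI)
    ultimately have "(\<lambda>n. (\<integral>\<omega>. iexp (v \<bullet> Z n \<omega>) \<partial>P) - (\<integral>\<omega>. iexp (v \<bullet> L n \<omega>) \<partial>P)) \<longlonglongrightarrow> 0"
      by (rule Lim_null_comparison[rotated])
    from tendsto_add[OF this char[of v]]
    have "(\<lambda>n. \<integral>\<omega>. iexp (v \<bullet> Z n \<omega>) \<partial>P) \<longlonglongrightarrow> exp (- (v \<bullet> (C *v v)) / 2)" by simp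
    then show "(\<lambda>n. \<integral>\<omega>. iexp (v \<bullet> Z (Suc n) \<omega>) \<partial>P) \<longlonglongrightarrow> (\<integral>z. iexp (v \<bullet> z) \<partial>\<mu>)"
      unfolding \<mu>(4) by (rule LIMSEQ_Suc)
  qed
  then show ?thesis
    using \<mu>(3) converges_in_distribution_Suc unfolding converges_to_gaussian_def by blast
qed

section \<open>Essential bounds and cell averages\<close>

context prob_space
begin

lemma AE_le_iff_measure_0:
  assumes [measurable]: "{x\<in>space M. Q x} \<in> events" "A \<in> events"
  shows "measure M ({x\<in>space M. Q x} \<inter> A) = 0 \<longleftrightarrow> (AE x in M. x \<in> A \<longrightarrow> \<not> Q x)"
proof -
  have "(AE x in M. x \<notin> {x\<in>space M. Q x} \<inter> A) \<longleftrightarrow> (AE x in M. x \<in> A \<longrightarrow> \<not> Q x)"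
    by (intro AE_cong) auto
  then show ?thesis
    using AE_iff_measurable[of "{x\<in>space M. Q x} \<inter> A" M "\<lambda>x. x \<notin> {x\<in>space M. Q x} \<inter> A"]
    by (auto simp: emeasure_eq_measure measure_nonneg)
qed

text \<open>The bound is proved for the countably many nonnegative rationals below the supremum and
  extended by density. An infinite supremum becomes 0 under \<open>enn2real\<close>, and then the
  claim is nonnegativity of f.\<close>

lemma ess_lower_AE:
  assumes f[measurable]: "f \<in> borel_measurable M" and A[measurable]: "A \<in> events"
    and nonneg: "\<And>x. x \<in> space M \<Longrightarrow> 0 \<le> f x"
  shows "AE x in M. x \<in> A \<longrightarrow> enn2real (ess_lower M f A) \<le> f x"
proof -
  let ?a = "enn2real (ess_lower M f A)"
  have "AE x in M. \<forall>q::rat. 0 \<le> real_of_rat q \<longrightarrow> real_of_rat q < ?a \<longrightarrow> x \<in> A \<longrightarrow> real_of_rat q \<le> f x"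
    unfolding AE_all_countable
  proof (intro allI impI)
    fix q :: rat
    show "AE x in M. 0 \<le> real_of_rat q \<longrightarrow> real_of_rat q < ?a \<longrightarrow> x \<in> A \<longrightarrow> real_of_rat q \<le> f x"
    proof (cases "0 \<le> real_of_rat q \<and> real_of_rat q < ?a")
      case True
      then have "ennreal (real_of_rat q) < ess_lower M f A"
        by (cases "ess_lower M f A") (auto simp: ennreal_less_iff)
      then obtain \<alpha> :: real where \<alpha>: "0 < \<alpha>" "measure M ({x\<in>space M. f x < \<alpha>} \<inter> A) = 0" "ennreal (real_of_rat q) < ennreal \<alpha>"
        unfolding ess_lower_def less_SUP_iff by auto
      then have "AE x in M. x \<in> A \<longrightarrow> \<not> f x < \<alpha>" by (subst (asm) AE_le_iff_measure_0) auto
      moreover have "real_of_rat q < \<alpha>" using \<alpha>(3) True by (simp add: ennreal_less_iff)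
      ultimately show ?thesis by (auto elim!: eventually_mono)
    qed auto
  qed
  then show ?thesis
    using AE_space
  proof eventually_elim
    case (elim x)
    show ?case
    proof (intro impI, rule ccontr)
      assume x: "x \<in> A" and "\<not> ?a \<le> f x"
      then obtain q where q: "f x < real_of_rat q" "real_of_rat q < ?a" using of_rat_dense[of "f x" ?a] by auto
      moreover have "0 \<le> real_of_rat q" using q(1) nonneg[OF elim(2)] by linarith
      ultimately have "real_of_rat q \<le> f x" using elim(1) x by blast
      then show False using q(1) by simp
    qed
  qed
qed

text \<open>The same argument with rationals above the infimum. Finiteness matters because
  \<open>enn2real\<close> sends \<infinity> to 0, which would be too small here.\<close>

lemma ess_upper_AE:
  assumes f[measurable]: "f \<in> borel_measurable M" and A[measurable]: "A \<in> events"
    and fin: "ess_upper M f A < \<infinity>"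
  shows "AE x in M. x \<in> A \<longrightarrow> f x \<le> enn2real (ess_upper M f A)"
proof -
  let ?b = "enn2real (ess_upper M f A)"
  have b: "ess_upper M f A = ennreal ?b" using fin by (simp add: less_top)
  have "AE x in M. \<forall>q::rat. ?b < real_of_rat q \<longrightarrow> x \<in> A \<longrightarrow> f x \<le> real_of_rat q"
    unfolding AE_all_countable
  proof (intro allI impI)
    fix q :: rat
    show "AE x in M. ?b < real_of_rat q \<longrightarrow> x \<in> A \<longrightarrow> f x \<le> real_of_rat q"
    proof (cases "?b < real_of_rat q")
      case True
      then have "ess_upper M f A < ennreal (real_of_rat q)"
        by (subst b) (simp add: ennreal_less_iff)
      then obtain \<alpha> :: real where \<alpha>: "0 < \<alpha>" "measure M ({x\<in>space M. f x > \<alpha>} \<inter> A) = 0" "ennreal \<alpha> < ennreal (real_of_rat q)"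
        unfolding ess_upper_def INF_less_iff by auto
      then have "AE x in M. x \<in> A \<longrightarrow> \<not> f x > \<alpha>" by (subst (asm) AE_le_iff_measure_0) auto
      moreover have "\<alpha> < real_of_rat q" using \<alpha>(1,3) by (simp add: ennreal_less_iff)
      ultimately show ?thesis by (auto elim!: eventually_mono)
    qed auto
  qed
  then show ?thesis
  proof eventually_elim
    case (elim x)
    show ?case
    proof (intro impI, rule ccontr)
      assume x: "x \<in> A" and "\<not> f x \<le> ?b"
      then obtain q where q: "?b < real_of_rat q" "real_of_rat q < f x" using of_rat_dense[of ?b "f x"] by auto
      then have "f x \<le> real_of_rat q" using elim x by blast
      then show False using q(2) by simp
    qed
  qed
qed

lemma ess_lower_antimono:
  assumes [measurable]: "f \<in> borel_measurable M" "A \<in> events" "B \<in> events" and AB: "A \<subseteq> B"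
  shows "ess_lower M f B \<le> ess_lower M f A"
  unfolding ess_lower_def
proof (rule SUP_subset_mono)
  show "{\<alpha>. 0 < \<alpha> \<and> prob ({x \<in> space M. f x < \<alpha>} \<inter> B) = 0} \<subseteq> {\<alpha>. 0 < \<alpha> \<and> prob ({x \<in> space M. f x < \<alpha>} \<inter> A) = 0}"
  proof clarify
    fix \<alpha> assume *: "prob ({x \<in> space M. f x < \<alpha>} \<inter> B) = 0"
    have "prob ({x \<in> space M. f x < \<alpha>} \<inter> A) \<le> prob ({x \<in> space M. f x < \<alpha>} \<inter> B)"
      using AB by (intro finite_measure_mono) auto
    then show "prob ({x \<in> space M. f x < \<alpha>} \<inter> A) = 0" using * by (simp add: measure_le_0_iff)
  qed
qed simp

lemma ess_upper_mono:
  assumes [measurable]: "f \<in> borel_measurable M" "A \<in> events" "B \<in> events" and AB: "A \<subseteq> B"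
  shows "ess_upper M f A \<le> ess_upper M f B"
  unfolding ess_upper_def
proof (rule INF_superset_mono)
  show "{\<alpha>. 0 < \<alpha> \<and> prob ({x \<in> space M. f x > \<alpha>} \<inter> B) = 0} \<subseteq> {\<alpha>. 0 < \<alpha> \<and> prob ({x \<in> space M. f x > \<alpha>} \<inter> A) = 0}"
  proof clarify
    fix \<alpha> assume *: "prob ({x \<in> space M. f x > \<alpha>} \<inter> B) = 0"
    have "prob ({x \<in> space M. f x > \<alpha>} \<inter> A) \<le> prob ({x \<in> space M. f x > \<alpha>} \<inter> B)"
      using AB by (intro finite_measure_mono) auto
    then show "prob ({x \<in> space M. f x > \<alpha>} \<inter> A) = 0" using * by (simp add: measure_le_0_iff)
  qed
qed simp

text \<open>Two thresholds in the wrong order would leave no value for f on A. On a null set the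
  lower bound would be \<infinity> and the upper one 0, hence the positive probability.\<close>

lemma ess_lower_le_upper:
  assumes [measurable]: "f \<in> borel_measurable M" "A \<in> events" and pos: "0 < prob A"
  shows "ess_lower M f A \<le> ess_upper M f A"
  unfolding ess_lower_def ess_upper_def
proof (intro SUP_least INF_greatest)
  fix \<alpha> \<beta> :: real
  assume \<alpha>: "\<alpha> \<in> {\<alpha>. 0 < \<alpha> \<and> prob ({x \<in> space M. f x < \<alpha>} \<inter> A) = 0}"
    and \<beta>: "\<beta> \<in> {\<alpha>. 0 < \<alpha> \<and> prob ({x \<in> space M. f x > \<alpha>} \<inter> A) = 0}"
  have "\<alpha> \<le> \<beta>"
  proof (rule ccontr)
    assume "\<not> \<alpha> \<le> \<beta>"
    have "AE x in M. x \<in> A \<longrightarrow> \<not> f x < \<alpha>" using \<alpha> by (subst AE_le_iff_measure_0[symmetric]) auto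
    moreover have "AE x in M. x \<in> A \<longrightarrow> \<not> f x > \<beta>" using \<beta> by (subst AE_le_iff_measure_0[symmetric]) auto
    ultimately have "AE x in M. x \<notin> A" by eventually_elim (use \<open>\<not> \<alpha> \<le> \<beta>\<close> in auto)
    then have "prob A = 0" using prob_eq_0[OF assms(2)] by simp
    with pos show False by simp
  qed
  then show "ennreal \<alpha> \<le> ennreal \<beta>" by (rule ennreal_leI)
qed

end

section \<open>Cell integrals of a kernel\<close>

context cell_partition
begin

lemma norm1_le_norm2:
  assumes "finite_norms \<nu> g" shows "norm1 \<nu> g \<le> norm2 \<nu> g"
  using assms abs_mean_le_sqrt(2)[of g] borel_measurable_integrable[of \<nu> g]
  by (simp add: finite_norms_def norm1_def norm2_def)

lemma integrable_cell_indicator: "r \<in> {1..k} \<Longrightarrow> integrable \<nu> (indicator (I r) :: 'a \<Rightarrow> real)"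
  using I[of r] by (intro integrable_real_indicator) (auto simp: less_top[symmetric])

text \<open>Tests \<open>g\<close> against the step function formed by the signs of its cell
  integrals.\<close>

lemma sum_abs_cell_integrals:
  assumes g: "integrable \<nu> (g :: 'a \<Rightarrow> real)"
  shows "(\<Sum>r = 1..k. \<bar>LINT t:I r|\<nu>. g t\<bar>) \<le> norm1 \<nu> g"
proof -
  have "(\<Sum>r = 1..k. \<bar>LINT t:I r|\<nu>. g t\<bar>) = (\<Sum>r = 1..k. (LINT t:I r|\<nu>. g t) * sgn (LINT t:I r|\<nu>. g t))"
    by (intro sum.cong refl) (simp add: abs_sgn)
  also have "\<dots> = (\<integral>x. g x * step (\<lambda>r. sgn (LINT t:I r|\<nu>. g t)) x \<partial>\<nu>)"
    by (rule sum_cell_integrals(2)[OF g])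
  also have "\<dots> \<le> (\<integral>x. \<bar>g x\<bar> \<partial>\<nu>)"
  proof (rule integral_mono[OF sum_cell_integrals(1)[OF g] integrable_abs[OF g]])
    fix x assume "x \<in> space \<nu>"
    then obtain r where r: "r \<in> {1..k}" "x \<in> I r" by (rule in_cell)
    have "g x * sgn y \<le> \<bar>g x\<bar>" for y :: real by (auto simp: sgn_if)
    then show "g x * step (\<lambda>r. sgn (LINT t:I r|\<nu>. g t)) x \<le> \<bar>g x\<bar>" unfolding step_eq[OF r] .
  qed
  finally show ?thesis by (simp add: norm1_def)
qed

lemma abs_cell_integral_le:
  assumes g: "finite_norms \<nu> g" and r: "r \<in> {1..k}"
  shows "\<bar>LINT t:I r|\<nu>. g t\<bar> \<le> norm_sup \<nu> g / real k"
proof -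
  have i: "integrable \<nu> g" and bdd: "bdd_above ((\<lambda>t. \<bar>g t\<bar>) ` space \<nu>)" using g by (auto simp: finite_norms_def)
  have sup: "\<bar>g t\<bar> \<le> norm_sup \<nu> g" if "t \<in> space \<nu>" for t
    unfolding norm_sup_def using that bdd by (rule cSUP_upper)
  have "\<bar>LINT t:I r|\<nu>. g t\<bar> \<le> (\<integral>t. \<bar>indicator (I r) t * g t\<bar> \<partial>\<nu>)"
    unfolding set_lebesgue_integral_def real_scaleR_def by (rule integral_abs_bound)
  also have "\<dots> \<le> (\<integral>t. norm_sup \<nu> g * indicator (I r) t \<partial>\<nu>)"
  proof (rule integral_mono)
    show "\<bar>indicator (I r) t * g t\<bar> \<le> norm_sup \<nu> g * indicator (I r) t" if "t \<in> space \<nu>" for t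
      using sup[OF that] by (auto simp: indicator_def)
  qed (use set_integrable_cell[OF i r] integrable_cell_indicator[OF r] in auto)
  also have "\<dots> = norm_sup \<nu> g / real k" using I[OF r] I_measure[OF r] by simp
  finally show ?thesis .
qed

text \<open>Boundedness of the kernel makes the real supremum a genuine upper bound; exchanging s
  and t gives the absolute value.\<close>

lemma kernel_osc_upper:
  assumes g: "bdd_above ((\<lambda>t. \<bar>K x t\<bar>) ` space \<nu>)" and r: "r \<in> {1..k}" and st: "s \<in> I r" "t \<in> I r"
  shows "\<bar>K x t - K x s\<bar> \<le> kernel_osc k I K x"
proof -
  obtain B where B: "\<And>t. t \<in> space \<nu> \<Longrightarrow> \<bar>K x t\<bar> \<le> B" using g by (auto simp: bdd_above_def)
  have sub: "I r \<subseteq> space \<nu>" using I[OF r] by (rule sets.sets_into_space)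
  have bdd: "bdd_above ((\<lambda>(s, t). K x t - K x s) ` (I r \<times> I r))"
  proof (rule bdd_aboveI2[where M = "2 * B"], clarify)
    fix s t assume "s \<in> I r" "t \<in> I r"
    then have "\<bar>K x s\<bar> \<le> B" "\<bar>K x t\<bar> \<le> B" using B sub by auto
    then show "K x t - K x s \<le> 2 * B" by linarith
  qed
  have le: "K x t - K x s \<le> kernel_osc k I K x" if "s \<in> I r" "t \<in> I r" for s t
  proof -
    have "K x t - K x s \<le> (SUP (s, t) \<in> I r \<times> I r. K x t - K x s)"
      using cSUP_upper[OF _ bdd, of "(s, t)"] that by simp
    also have "\<dots> \<le> kernel_osc k I K x"
      unfolding kernel_osc_def using r by (intro Max_ge) auto
    finally show ?thesis .
  qed
  show ?thesis using le[OF st] le[OF st(2,1)] by (auto simp: abs_le_iff)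
qed

text \<open>\<open>a r\<close> is the average of the kernel over a cell and differs from each of its
  values there by at most the oscillation. The scaled sum is therefore the inner product of
  \<open>g\<close> with a step function uniformly close to \<open>K x\<close>.\<close>

lemma cell_product_close:
  assumes g1: "finite_norms \<nu> (K x)" and g2: "finite_norms \<nu> g"
  shows "\<bar>real k * (\<Sum>r = 1..k. (LINT t:I r|\<nu>. K x t) * (LINT t:I r|\<nu>. g t)) - inner2 \<nu> (K x) g\<bar>
    \<le> kernel_osc k I K x * norm1 \<nu> g"
proof -
  let ?\<Gamma> = "kernel_osc k I K x"
  have i1: "integrable \<nu> (K x)" and bdd: "bdd_above ((\<lambda>t. \<bar>K x t\<bar>) ` space \<nu>)" and i2: "integrable \<nu> g"
    using g1 g2 by (auto simp: finite_norms_def)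
  have i12: "integrable \<nu> (\<lambda>t. K x t * g t)"
  proof -
    obtain B where B: "\<And>t. t \<in> space \<nu> \<Longrightarrow> \<bar>K x t\<bar> \<le> B" using bdd by (auto simp: bdd_above_def)
    show ?thesis
      by (rule Bochner_Integration.integrable_bound[of \<nu> "\<lambda>t. B * \<bar>g t\<bar>"])
        (use i1 i2 B in \<open>auto simp: abs_mult intro!: AE_I2 mult_right_mono intro: order_trans[OF _ abs_ge_self]\<close>)
  qed
  define a where "a r = real k * (LINT t:I r|\<nu>. K x t)" for r
  have avg: "\<bar>a r - K x s\<bar> \<le> ?\<Gamma>" if r: "r \<in> {1..k}" and s: "s \<in> I r" for r s
  proof -
    have ic: "integrable \<nu> (\<lambda>t. indicator (I r) t * K x s)"
      using integrable_cell_indicator[OF r] by (rule integrable_mult_left)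
    have "(LINT t:I r|\<nu>. K x t) - K x s / real k = (\<integral>t. indicator (I r) t * K x t - indicator (I r) t * K x s \<partial>\<nu>)"
      using set_integrable_cell[OF i1 r] ic I[OF r] I_measure[OF r]
      by (simp add: set_lebesgue_integral_def)
    also have "\<bar>\<dots>\<bar> \<le> (\<integral>t. \<bar>indicator (I r) t * K x t - indicator (I r) t * K x s\<bar> \<partial>\<nu>)"
      by (rule integral_abs_bound)
    also have "\<dots> \<le> (\<integral>t. ?\<Gamma> * indicator (I r) t \<partial>\<nu>)"
    proof (rule integral_mono)
      show "integrable \<nu> (\<lambda>t. ?\<Gamma> * indicator (I r) t)"
        using integrable_cell_indicator[OF r] by (rule integrable_mult_right)
      show "\<bar>indicator (I r) t * K x t - indicator (I r) t * K x s\<bar> \<le> ?\<Gamma> * indicator (I r) t" for t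
        using kernel_osc_upper[where K = K and x = x and s = s and t = t, OF bdd r s] by (auto simp: indicator_def)
    qed (use set_integrable_cell[OF i1 r] ic in auto)
    also have "\<dots> = ?\<Gamma> / real k" using I[OF r] I_measure[OF r] by simp
    finally have "real k * \<bar>(LINT t:I r|\<nu>. K x t) - K x s / real k\<bar> \<le> ?\<Gamma>"
      using k by (simp add: field_simps)
    also have "real k * \<bar>(LINT t:I r|\<nu>. K x t) - K x s / real k\<bar> = \<bar>a r - K x s\<bar>"
    proof -
      have "real k * ((LINT t:I r|\<nu>. K x t) - K x s / real k) = a r - K x s"
        using k by (simp add: a_def right_diff_distrib)
      then have "\<bar>real k * ((LINT t:I r|\<nu>. K x t) - K x s / real k)\<bar> = \<bar>a r - K x s\<bar>" by (rule arg_cong)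
      then show ?thesis unfolding abs_mult by simp
    qed
    finally show ?thesis .
  qed
  have "real k * (\<Sum>r = 1..k. (LINT t:I r|\<nu>. K x t) * (LINT t:I r|\<nu>. g t)) = (\<Sum>r = 1..k. (LINT t:I r|\<nu>. g t) * a r)"
    by (simp add: a_def sum_distrib_left mult_ac)
  also have "\<dots> = (\<integral>t. g t * step a t \<partial>\<nu>)" by (rule sum_cell_integrals(2)[OF i2])
  also have "\<dots> - inner2 \<nu> (K x) g = (\<integral>t. g t * step a t - K x t * g t \<partial>\<nu>)"
    unfolding inner2_def using sum_cell_integrals(1)[OF i2] i12 by simp
  also have "\<bar>\<dots>\<bar> \<le> (\<integral>t. \<bar>g t * step a t - K x t * g t\<bar> \<partial>\<nu>)" by (rule integral_abs_bound)
  also have "\<dots> \<le> (\<integral>t. ?\<Gamma> * \<bar>g t\<bar> \<partial>\<nu>)"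
  proof (rule integral_mono)
    fix t assume "t \<in> space \<nu>"
    then obtain r where r: "r \<in> {1..k}" "t \<in> I r" by (rule in_cell)
    have "\<bar>g t * step a t - K x t * g t\<bar> = \<bar>a r - K x t\<bar> * \<bar>g t\<bar>"
      unfolding step_eq[OF r] abs_mult[symmetric] by (simp add: algebra_simps)
    then show "\<bar>g t * step a t - K x t * g t\<bar> \<le> ?\<Gamma> * \<bar>g t\<bar>"
      using avg[OF r] by (simp add: mult_right_mono)
  qed (use sum_cell_integrals(1)[OF i2] i12 i2 in auto)
  finally show ?thesis by (simp add: norm1_def)
qed

lemma cell_integral_minus_value:
  assumes g: "integrable \<nu> (g :: 'a \<Rightarrow> real)" and r: "r \<in> {1..k}"
  shows "(LINT t:I r|\<nu>. (g t - y)) = (LINT t:I r|\<nu>. g t) - measure \<nu> (I r) * y"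
proof -
  have "integrable \<nu> (\<lambda>t. indicator (I r) t * y)"
    using integrable_cell_indicator[OF r] by (rule integrable_mult_left)
  then show ?thesis
    using set_integrable_cell[OF g r] I[OF r] by (simp add: set_lebesgue_integral_def right_diff_distrib)
qed

end

section \<open>The limit theorem\<close>

locale estimation = nu: prob_space \<nu> + prob_space P
  for \<nu> :: "'a measure" and P :: "'w measure" +
  fixes f :: "'a \<Rightarrow> real" and c :: real
    and N :: "nat \<Rightarrow> 'w \<Rightarrow> ('a \<times> real) measure"
    and X :: "nat \<Rightarrow> 'w \<Rightarrow> nat \<Rightarrow> 'a" and Y :: "nat \<Rightarrow> 'w \<Rightarrow> nat \<Rightarrow> real"
    and k :: "nat \<Rightarrow> nat" and I :: "nat \<Rightarrow> nat \<Rightarrow> 'a set"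
    and K :: "nat \<Rightarrow> 'a \<Rightarrow> 'a \<Rightarrow> real" and F :: "'a set" and \<sigma> :: "'a \<Rightarrow> 'a \<Rightarrow> real"
  assumes f[measurable]: "f \<in> borel_measurable \<nu>" and f_nonneg: "\<And>x. x \<in> space \<nu> \<Longrightarrow> 0 \<le> f x"
    and c: "0 < c"
    and ppp: "\<And>n. 1 \<le> n \<Longrightarrow> poisson_point_process P (intensity \<nu> f c n) (N n)"
    and pts: "\<And>n \<omega>. 1 \<le> n \<Longrightarrow> \<omega> \<in> space P \<Longrightarrow> has_points (N n \<omega>) (subgraph f (space \<nu>)) (X n \<omega>) (Y n \<omega>)"
    and cells: "\<And>n. 1 \<le> n \<Longrightarrow> cell_partition \<nu> (k n) (I n)"
    and norms: "\<And>n x. 1 \<le> n \<Longrightarrow> x \<in> F \<Longrightarrow> finite_norms \<nu> (K n x)"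
    and norm2_pos: "\<And>n x. 1 \<le> n \<Longrightarrow> x \<in> F \<Longrightarrow> 0 < norm2 \<nu> (K n x)"
    and rate: "(\<lambda>n. real (k n) * ln (real n) / real n) \<longlonglongrightarrow> 0"
    and f_lower: "0 < ess_lower \<nu> f (space \<nu>)" and f_upper: "ess_upper \<nu> f (space \<nu>) < \<infinity>"
    and osc: "(\<lambda>n. real n / real (k n) * max_osc \<nu> f (k n) (I n)) \<longlonglongrightarrow> 0"
    and K1: "\<And>x1 x2. x1 \<in> F \<Longrightarrow> x2 \<in> F \<Longrightarrow>
      (\<lambda>n. kernel_osc (k n) (I n) (K n) x1 * norm1 \<nu> (K n x2)) \<in> o(\<lambda>n. norm2 \<nu> (K n x1) * norm2 \<nu> (K n x2))"
    and K2: "\<And>x1 x2. x1 \<in> F \<Longrightarrow> x2 \<in> F \<Longrightarrow>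
      (\<lambda>n. inner2 \<nu> (K n x1) (K n x2) / (norm2 \<nu> (K n x1) * norm2 \<nu> (K n x2))) \<longlonglongrightarrow> \<sigma> x1 x2"
    and K3: "\<And>x. x \<in> F \<Longrightarrow> (\<lambda>n. norm_sup \<nu> (K n x) / (sqrt (real (k n)) * norm2 \<nu> (K n x))) \<longlonglongrightarrow> 0"
    and K4: "\<And>x. x \<in> F \<Longrightarrow>
      (\<lambda>n. real n / (sqrt (real (k n)) * norm2 \<nu> (K n x))
             * max (kernel_bias \<nu> f (K n) x) (max_osc \<nu> f (k n) (I n) * norm1 \<nu> (K n x))) \<longlonglongrightarrow> 0"
begin

definition "h n r = enn2real (ess_lower \<nu> f (I n r))"
definition "H n r = enn2real (ess_upper \<nu> f (I n r))"
definition "m = enn2real (ess_lower \<nu> f (space \<nu>))"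
definition "M = enn2real (ess_upper \<nu> f (space \<nu>))"
abbreviation "\<Delta> n \<equiv> max_osc \<nu> f (k n) (I n)"

text \<open>The essential bounds of each cell serve as \<open>h\<close> and \<open>H\<close>.
  Finiteness is checked throughout because \<open>enn2real\<close> sends \<infinity> to 0.\<close>

lemma part:
  assumes n: "1 \<le> n"
  shows "graph_partition P \<nu> f c n (N n) (X n) (Y n) (k n) (I n) (h n) (H n) m M (\<Delta> n)"
proof -
  interpret cell_partition \<nu> "k n" "I n" by (rule cells[OF n])
  have sub: "I n r \<subseteq> space \<nu>" if "r \<in> {1..k n}" for r using I[OF that] by (rule sets.sets_into_space)
  have U: "ess_upper \<nu> f (I n r) \<le> ess_upper \<nu> f (space \<nu>)" if "r \<in> {1..k n}" for r
    using I[OF that] sub[OF that] by (intro nu.ess_upper_mono) auto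
  have Ufin: "ess_upper \<nu> f (I n r) < \<infinity>" if "r \<in> {1..k n}" for r
    using U[OF that] f_upper by (rule order.strict_trans1)
  have L: "ess_lower \<nu> f (space \<nu>) \<le> ess_lower \<nu> f (I n r)" if "r \<in> {1..k n}" for r
    using I[OF that] sub[OF that] by (intro nu.ess_lower_antimono) auto
  have LU: "ess_lower \<nu> f (I n r) \<le> ess_upper \<nu> f (I n r)" if "r \<in> {1..k n}" for r
    using I[OF that] I_measure[OF that] k by (intro nu.ess_lower_le_upper) auto
  have Lfin: "ess_lower \<nu> f (I n r) < \<infinity>" if "r \<in> {1..k n}" for r
    using LU[OF that] Ufin[OF that] by (rule order.strict_trans1)
  show ?thesis
  proof (unfold_locales)
    show "0 < m"
      using f_lower order.strict_trans1[OF L[of 1] Lfin[of 1]] k by (auto simp: m_def enn2real_positive_iff)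
    show "m \<le> h n r \<and> h n r \<le> H n r \<and> H n r \<le> M \<and> H n r - h n r \<le> \<Delta> n" if r: "r \<in> {1..k n}" for r
    proof (intro conjI)
      show "m \<le> h n r" unfolding m_def h_def using L[OF r] Lfin[OF r] by (intro enn2real_mono) auto
      show "h n r \<le> H n r" unfolding h_def H_def using LU[OF r] Ufin[OF r] by (intro enn2real_mono) auto
      show "H n r \<le> M" unfolding H_def M_def using U[OF r] f_upper by (intro enn2real_mono) auto
      show "H n r - h n r \<le> \<Delta> n" unfolding max_osc_def H_def h_def using r by (intro Max_ge) auto
    qed
    show "AE x in \<nu>. x \<in> I n r \<longrightarrow> h n r \<le> f x" if "r \<in> {1..k n}" for r
      unfolding h_def by (rule nu.ess_lower_AE[OF f I[OF that] f_nonneg])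
    show "AE x in \<nu>. x \<in> I n r \<longrightarrow> f x \<le> H n r" if "r \<in> {1..k n}" for r
      unfolding H_def by (rule nu.ess_upper_AE[OF f I[OF that] Ufin[OF that]])
  qed (use c n ppp[OF n] pts[OF n] f_nonneg in auto)
qed

definition "\<theta> n = real n * c / real (k n)"

lemma \<theta>_eq: "1 \<le> n \<Longrightarrow> graph_partition.\<theta> c n (k n) = \<theta> n"
  using graph_partition.\<theta>_def[OF part] graph_process.\<kappa>_def[OF graph_partition.axioms(1)[OF part]]
  by (simp add: \<theta>_def)

lemma k_pos: "1 \<le> n \<Longrightarrow> 1 \<le> k n" using cell_partition.k[OF cells] .

lemma \<theta>_pos: "1 \<le> n \<Longrightarrow> 0 < \<theta> n" using k_pos[of n] c by (simp add: \<theta>_def)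

lemma m_pos: "0 < m" using graph_partition.m_pos[OF part[of 1]] by simp

lemma M_pos: "0 < M"
  using graph_partition.bounds[OF part[of 1], of 1] k_pos[of 1] m_pos by auto

lemma \<Delta>_nonneg: "1 \<le> n \<Longrightarrow> 0 \<le> \<Delta> n" using graph_partition.\<Delta>_nonneg[OF part] .

text \<open>ln n is at least 1 from n = 3 on, so the rate condition dominates this quotient.\<close>

lemma lim_k_over_n: "(\<lambda>n. real (k n) / real n) \<longlonglongrightarrow> 0"
proof (rule Lim_null_comparison[OF _ rate])
  have "norm (real (k n) / real n) \<le> real (k n) * ln (real n) / real n" if "3 \<le> n" for n
  proof -
    have "1 = ln (exp 1 :: real)" by simp
    also have "\<dots> \<le> ln (real n)" using that exp_le by (intro ln_mono) auto
    finally have "real (k n) * 1 \<le> real (k n) * ln (real n)" by (intro mult_left_mono) auto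
    then show ?thesis by (simp add: divide_right_mono)
  qed
  then show "\<forall>\<^sub>F n in sequentially. norm (real (k n) / real n) \<le> real (k n) * ln (real n) / real n"
    by (rule eventually_sequentiallyI)
qed

lemma lim_inverse_\<theta>: "(\<lambda>n. 1 / \<theta> n) \<longlonglongrightarrow> 0"
  using tendsto_divide[OF lim_k_over_n tendsto_const[of c]] c by (simp add: \<theta>_def)

lemma lim_\<theta>_\<Delta>: "(\<lambda>n. \<theta> n * \<Delta> n) \<longlonglongrightarrow> 0"
  using tendsto_mult_left[OF osc, of c] by (simp add: \<theta>_def mult_ac)

lemma lim_\<Delta>: "\<Delta> \<longlonglongrightarrow> 0"
proof (rule Lim_transform_eventually)
  show "(\<lambda>n. \<theta> n * \<Delta> n * (1 / \<theta> n)) \<longlonglongrightarrow> 0" using tendsto_mult[OF lim_\<theta>_\<Delta> lim_inverse_\<theta>] by simp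
  have "\<theta> n * \<Delta> n * (1 / \<theta> n) = \<Delta> n" if "1 \<le> n" for n using \<theta>_pos[OF that] by simp
  then show "\<forall>\<^sub>F n in sequentially. \<theta> n * \<Delta> n * (1 / \<theta> n) = \<Delta> n" by (rule eventually_sequentiallyI)
qed

text \<open>The logarithm in the rate condition makes the probability of an empty cell negligible.\<close>

lemma lim_empty_cell: "(\<lambda>n. real n * exp (- (\<theta> n * m))) \<longlonglongrightarrow> 0"
proof (rule Lim_null_comparison)
  show "(\<lambda>n. 1 / real n) \<longlonglongrightarrow> 0" by (rule lim_1_over_n)
  \<comment> \<open>The threshold c m / 2 makes \<theta> n m at least 2 ln n, so the exponential is
    at most 1 / n^2 and outweighs the factor n.\<close>
  have "\<forall>\<^sub>F n in sequentially. real (k n) * ln (real n) / real n < c * m / 2"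
    using rate c m_pos by (intro order_tendstoD(2)) auto
  then show "\<forall>\<^sub>F n in sequentially. norm (real n * exp (- (\<theta> n * m))) \<le> 1 / real n"
    using eventually_ge_at_top[of 1]
  proof eventually_elim
    case (elim n)
    have n: "0 < real n" "0 < real (k n)" using elim k_pos[of n] by auto
    have "real (k n) * ln (real n) < c * m / 2 * real n" using elim(1) n by (simp add: divide_less_eq)
    then have "2 * ln (real n) \<le> \<theta> n * m" using n by (simp add: \<theta>_def field_simps)
    then have "exp (- (\<theta> n * m)) \<le> exp (- (2 * ln (real n)))" by simp
    also have "\<dots> = 1 / (real n * real n)"
    proof -
      have "exp (2 * ln (real n)) = real n * real n"
        unfolding mult_2 exp_add exp_ln[OF n(1)] ..
      then show ?thesis by (simp only: exp_minus inverse_eq_divide)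
    qed
    finally have "real n * exp (- (\<theta> n * m)) \<le> real n * (1 / (real n * real n))" using n by (intro mult_left_mono) auto
    then show ?case using n by simp
  qed
qed

section \<open>Normalised weights and the limit law of the main term\<close>

definition cint :: "nat \<Rightarrow> 'a \<Rightarrow> nat \<Rightarrow> real" where "cint n x r = (LINT t:I n r|\<nu>. K n x t)"

text \<open>Scaled so that, for cells of mass 1 / k, sums of products of weights approximate the
  normalised inner products in (K2).\<close>

definition w :: "nat \<Rightarrow> 'a \<Rightarrow> nat \<Rightarrow> real" where "w n x r = sqrt (real (k n)) * cint n x r / norm2 \<nu> (K n x)"

definition q :: "nat \<Rightarrow> 'a \<Rightarrow> real" where "q n x = real n * c / (sqrt (real (k n)) * norm2 \<nu> (K n x))"

definition main :: "nat \<Rightarrow> (nat \<Rightarrow> real) \<Rightarrow> 'w \<Rightarrow> real" where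
  "main n = graph_partition.main_term \<nu> f c n (N n) (X n) (Y n) (k n) (I n) (h n)"

definition cmax :: "nat \<Rightarrow> nat \<Rightarrow> 'w \<Rightarrow> real" where
  "cmax n r \<omega> = corrected_max \<nu> f (N n \<omega>) (X n \<omega>) (Y n \<omega>) (I n r)"

lemma q_pos: "1 \<le> n \<Longrightarrow> x \<in> F \<Longrightarrow> 0 < q n x"
  using norm2_pos[of n x] k_pos[of n] c by (simp add: q_def)

text \<open>Since sqrt k / k = 1 / sqrt k, weights acting on maxima scaled by \<theta> are those of
  the normalised estimator.\<close>

lemma w_\<theta>: "1 \<le> n \<Longrightarrow> w n x r * \<theta> n = q n x * cint n x r"
proof -
  assume n: "1 \<le> n"
  obtain s where "sqrt (real (k n)) = s" "real (k n) = s * s" "0 < s"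
    using k_pos[OF n] by fastforce
  then show ?thesis unfolding w_def \<theta>_def q_def by (simp only:) (simp add: field_simps)
qed

lemma W_eq_cmax: "1 \<le> n \<Longrightarrow> r \<in> {1..k n} \<Longrightarrow> graph_cell.W \<nu> f (N n) (X n) (Y n) (I n r) = cmax n r"
  using graph_cell.W_def[OF graph_partition.cell[OF part]] by (auto simp: cmax_def)

lemma sum_abs_w: "1 \<le> n \<Longrightarrow> x \<in> F \<Longrightarrow>
    (\<Sum>r = 1..k n. \<bar>w n x r\<bar>) \<le> sqrt (real (k n)) * (norm1 \<nu> (K n x) / norm2 \<nu> (K n x))"
proof -
  assume n: "1 \<le> n" and x: "x \<in> F"
  have "(\<Sum>r = 1..k n. \<bar>w n x r\<bar>) = sqrt (real (k n)) / norm2 \<nu> (K n x) * (\<Sum>r = 1..k n. \<bar>cint n x r\<bar>)"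
    unfolding sum_distrib_left using norm2_pos[OF n x] by (intro sum.cong) (auto simp: w_def abs_mult)
  also have "\<dots> \<le> sqrt (real (k n)) / norm2 \<nu> (K n x) * norm1 \<nu> (K n x)"
    unfolding cint_def
    using cell_partition.sum_abs_cell_integrals[OF cells[OF n], of "K n x"] norms[OF n x] norm2_pos[OF n x]
    by (intro mult_left_mono) (auto simp: finite_norms_def)
  finally show ?thesis by simp
qed

lemma norm1_le: "1 \<le> n \<Longrightarrow> x \<in> F \<Longrightarrow> norm1 \<nu> (K n x) \<le> norm2 \<nu> (K n x)"
  using cell_partition.norm1_le_norm2[OF cells norms] .

lemma abs_w: "1 \<le> n \<Longrightarrow> x \<in> F \<Longrightarrow> r \<in> {1..k n} \<Longrightarrow>
    \<bar>w n x r\<bar> \<le> norm_sup \<nu> (K n x) / (sqrt (real (k n)) * norm2 \<nu> (K n x))"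
proof -
  assume n: "1 \<le> n" and x: "x \<in> F" and r: "r \<in> {1..k n}"
  have "\<bar>w n x r\<bar> = sqrt (real (k n)) * \<bar>cint n x r\<bar> / norm2 \<nu> (K n x)"
    using norm2_pos[OF n x] by (simp add: w_def abs_mult)
  also have "\<dots> \<le> sqrt (real (k n)) * (norm_sup \<nu> (K n x) / real (k n)) / norm2 \<nu> (K n x)"
    using cell_partition.abs_cell_integral_le[OF cells[OF n] norms[OF n x] r] norm2_pos[OF n x]
    unfolding cint_def by (intro divide_right_mono mult_left_mono) auto
  also have "sqrt (real (k n)) * (norm_sup \<nu> (K n x) / real (k n)) = norm_sup \<nu> (K n x) / sqrt (real (k n))"
  proof -
    obtain s where "sqrt (real (k n)) = s" "real (k n) = s * s" "0 < s"
      using k_pos[OF n] by fastforce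
    then show ?thesis by (simp only:) (simp add: field_simps)
  qed
  finally show ?thesis by simp
qed

text \<open>By \<open>cell_product_close\<close> the distance to the normalised inner product is at
  most the quotient that vanishes by (K1); (K2) supplies the limit.\<close>

lemma lim_sum_w:
  assumes x: "x1 \<in> F" "x2 \<in> F"
  shows "(\<lambda>n. \<Sum>r = 1..k n. w n x1 r * w n x2 r) \<longlonglongrightarrow> \<sigma> x1 x2"
proof -
  define d where "d n = norm2 \<nu> (K n x1) * norm2 \<nu> (K n x2)" for n
  have d: "0 < d n" if "1 \<le> n" for n using norm2_pos[OF that] x by (simp add: d_def)
  have lim1: "(\<lambda>n. kernel_osc (k n) (I n) (K n) x1 * norm1 \<nu> (K n x2) / d n) \<longlonglongrightarrow> 0"
    using K1[OF x] unfolding d_def by (rule smalloD_tendsto)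
  have "(\<lambda>n. (\<Sum>r = 1..k n. w n x1 r * w n x2 r) - inner2 \<nu> (K n x1) (K n x2) / d n) \<longlonglongrightarrow> 0"
  proof (rule Lim_null_comparison[OF _ lim1], rule eventually_sequentiallyI)
    fix n :: nat assume n: "1 \<le> n"
    have "(\<Sum>r = 1..k n. w n x1 r * w n x2 r) = real (k n) * (\<Sum>r = 1..k n. cint n x1 r * cint n x2 r) / d n"
    proof -
      have "sqrt (real (k n)) * (sqrt (real (k n)) * y) = real (k n) * y" for y
        by (simp add: mult.assoc[symmetric])
      then show ?thesis
        unfolding sum_distrib_left sum_divide_distrib
        by (intro sum.cong refl) (simp add: w_def d_def mult_ac)
    qed
    then have "\<bar>(\<Sum>r = 1..k n. w n x1 r * w n x2 r) - inner2 \<nu> (K n x1) (K n x2) / d n\<bar>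
        = \<bar>real (k n) * (\<Sum>r = 1..k n. cint n x1 r * cint n x2 r) - inner2 \<nu> (K n x1) (K n x2)\<bar> / d n"
      using d[OF n] by (simp add: diff_divide_distrib[symmetric])
    also have "\<dots> \<le> kernel_osc (k n) (I n) (K n) x1 * norm1 \<nu> (K n x2) / d n"
      using d[OF n] cell_partition.cell_product_close[where K = "K n" and x = x1 and g = "K n x2",
          OF cells[OF n] norms[OF n x(1)] norms[OF n x(2)]]
      unfolding cint_def by (intro divide_right_mono) auto
    finally show "norm ((\<Sum>r = 1..k n. w n x1 r * w n x2 r) - inner2 \<nu> (K n x1) (K n x2) / d n)
        \<le> kernel_osc (k n) (I n) (K n) x1 * norm1 \<nu> (K n x2) / d n" by simp
  qed
  from tendsto_add[OF this K2[OF x, folded d_def]] show ?thesis by simp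
qed

text \<open>Symmetry and nonnegativity of \<sigma> on F are not assumed but inherited from the sums
  of products of weights that converge to it; the construction of the Gaussian law asks for
  both.\<close>

lemma \<sigma>_sym: "x1 \<in> F \<Longrightarrow> x2 \<in> F \<Longrightarrow> \<sigma> x1 x2 = \<sigma> x2 x1"
  using LIMSEQ_unique[OF lim_sum_w[of x1 x2]] lim_sum_w[of x2 x1] by (simp add: mult.commute)

lemma main_eq: "1 \<le> n \<Longrightarrow> main n u \<omega> = (\<Sum>r = 1..k n. u r *
    (graph_partition.e c n (k n) (h n) r
      - graph_partition.gap \<nu> f c n (N n) (X n) (Y n) (k n) (I n) (h n) r \<omega>))"
  unfolding main_def by (rule graph_partition.main_term_def[OF part])

text \<open>Linearity in the weights makes every projection of the vector of main terms a single
  main term, so the one-dimensional estimate serves all coordinates jointly.\<close>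

lemma main_sum:
  assumes "1 \<le> n" "finite J"
  shows "(\<Sum>j\<in>J. v j * main n (u j) \<omega>) = main n (\<lambda>r. \<Sum>j\<in>J. v j * u j r) \<omega>"
  unfolding main_eq[OF assms(1)] sum_distrib_left sum_distrib_right
  by (subst sum.swap) (simp add: mult.assoc)

lemma main_L1:
  assumes n: "1 \<le> n"
  shows "integrable P (main n u)"
    and "expectation (\<lambda>\<omega>. \<bar>main n u \<omega>\<bar>) \<le> sqrt ((\<Sum>r = 1..k n. (u r)\<^sup>2) * (1 + 5 / (\<theta> n * m)))"
  using graph_partition.main_term_L1[OF part[OF n], of u] by (simp_all add: main_def \<theta>_eq[OF n])

lemma main_char:
  assumes n: "1 \<le> n" and "\<And>r. r \<in> {1..k n} \<Longrightarrow> \<bar>u r\<bar> \<le> \<delta>"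
  shows "cmod ((\<integral>\<omega>. iexp (main n u \<omega>) \<partial>P) - exp (- (\<Sum>r = 1..k n. (u r)\<^sup>2) / 2))
    \<le> (\<Sum>r = 1..k n. (u r)\<^sup>2) * (7 * \<delta> / 6 + 5 / (\<theta> n * m) / 2 + \<delta>\<^sup>2 / 8)"
  using graph_partition.main_term_char[OF part[OF n] assms(2)] by (simp add: main_def \<theta>_eq[OF n])

lemma lim_inverse_\<theta>_m: "(\<lambda>n. y / (\<theta> n * m)) \<longlonglongrightarrow> 0"
  using tendsto_mult_left[OF lim_inverse_\<theta>, of "y / m"] by (simp add: mult.commute)

lemma sum_sq_lin_comb:
  fixes v :: "real ^ 'p::finite"
  shows "(\<Sum>r\<in>R. (\<Sum>j\<in>UNIV. v $ j * z j r)\<^sup>2) = (\<Sum>i\<in>UNIV. \<Sum>j\<in>UNIV. v $ i * v $ j * (\<Sum>r\<in>R. z i r * z j r))"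
proof -
  have "(\<Sum>r\<in>R. (\<Sum>j\<in>UNIV. v $ j * z j r)\<^sup>2) = (\<Sum>r\<in>R. \<Sum>i\<in>UNIV. \<Sum>j\<in>UNIV. v $ i * v $ j * (z i r * z j r))"
    by (simp add: power2_eq_square sum_product mult_ac)
  also have "\<dots> = (\<Sum>i\<in>UNIV. \<Sum>r\<in>R. \<Sum>j\<in>UNIV. v $ i * v $ j * (z i r * z j r))"
    by (rule sum.swap)
  also have "\<dots> = (\<Sum>i\<in>UNIV. \<Sum>j\<in>UNIV. \<Sum>r\<in>R. v $ i * v $ j * (z i r * z j r))"
    by (intro sum.cong refl sum.swap)
  finally show ?thesis by (simp add: sum_distrib_left)
qed

lemma quadratic_form:
  fixes v :: "real ^ 'p::finite"
  shows "v \<bullet> ((\<chi> i j. s i j) *v v) = (\<Sum>i\<in>UNIV. \<Sum>j\<in>UNIV. v $ i * v $ j * s i j)"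
  by (simp add: inner_vec_def matrix_vector_mult_def sum_distrib_left mult_ac)

lemma lim_sum_sq:
  fixes x :: "'p::finite \<Rightarrow> 'a" and v :: "real ^ 'p"
  assumes x: "range x \<subseteq> F"
  shows "(\<lambda>n. \<Sum>r = 1..k n. (\<Sum>j\<in>UNIV. v $ j * w n (x j) r)\<^sup>2) \<longlonglongrightarrow> v \<bullet> ((\<chi> i j. \<sigma> (x i) (x j)) *v v)"
  unfolding sum_sq_lin_comb quadratic_form using x
  by (intro tendsto_sum tendsto_mult_left lim_sum_w) auto

lemma psd:
  fixes x :: "'p::finite \<Rightarrow> 'a" and v :: "real ^ 'p"
  assumes x: "range x \<subseteq> F"
  shows "0 \<le> v \<bullet> ((\<chi> i j. \<sigma> (x i) (x j)) *v v)"
  by (rule LIMSEQ_le_const[OF lim_sum_sq[OF x]]) (auto intro!: sum_nonneg)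

text \<open>By (K3) a fixed linear combination of the weights is still uniformly small, so
  \<open>main_char\<close> applies with \<delta> n tending to 0.\<close>

lemma main_char_lim:
  fixes x :: "'p::finite \<Rightarrow> 'a" and v :: "real ^ 'p"
  assumes x: "range x \<subseteq> F"
  shows "(\<lambda>n. \<integral>\<omega>. iexp (v \<bullet> (\<chi> j. main n (w n (x j)) \<omega>)) \<partial>P)
    \<longlonglongrightarrow> exp (- (v \<bullet> ((\<chi> i j. \<sigma> (x i) (x j)) *v v)) / 2)"
proof -
  let ?V = "v \<bullet> ((\<chi> i j. \<sigma> (x i) (x j)) *v v)"
  define u where "u n r = (\<Sum>j\<in>UNIV. v $ j * w n (x j) r)" for n r
  define Q where "Q n = (\<Sum>r = 1..k n. (u n r)\<^sup>2)" for n
  define \<delta> where "\<delta> n = (\<Sum>j\<in>UNIV. \<bar>v $ j\<bar> * (norm_sup \<nu> (K n (x j)) / (sqrt (real (k n)) * norm2 \<nu> (K n (x j)))))" for n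
  have Q: "Q \<longlonglongrightarrow> ?V" unfolding Q_def u_def by (rule lim_sum_sq[OF x])
  have "\<delta> \<longlonglongrightarrow> (\<Sum>j\<in>UNIV. \<bar>v $ j\<bar> * 0)"
    unfolding \<delta>_def using x by (intro tendsto_sum tendsto_mult_left K3) auto
  then have \<delta>: "\<delta> \<longlonglongrightarrow> 0" by simp
  have u\<delta>: "\<bar>u n r\<bar> \<le> \<delta> n" if "1 \<le> n" "r \<in> {1..k n}" for n r
    unfolding u_def \<delta>_def
  proof (intro order_trans[OF sum_abs] sum_mono)
    fix j
    have "x j \<in> F" using x by auto
    from abs_w[OF that(1) this that(2)]
    show "\<bar>v $ j * w n (x j) r\<bar> \<le> \<bar>v $ j\<bar> * (norm_sup \<nu> (K n (x j)) / (sqrt (real (k n)) * norm2 \<nu> (K n (x j))))"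
      unfolding abs_mult by (rule mult_left_mono) simp
  qed
  have "(\<lambda>n. Q n * (7 * \<delta> n / 6 + 5 / (\<theta> n * m) / 2 + (\<delta> n)\<^sup>2 / 8)) \<longlonglongrightarrow> ?V * (7 * 0 / 6 + 0 / 2 + 0\<^sup>2 / 8)"
    by (intro tendsto_intros Q \<delta> lim_inverse_\<theta>_m) auto
  then have bound: "(\<lambda>n. Q n * (7 * \<delta> n / 6 + 5 / (\<theta> n * m) / 2 + (\<delta> n)\<^sup>2 / 8)) \<longlonglongrightarrow> 0" by simp
  have "(\<lambda>n. (\<integral>\<omega>. iexp (v \<bullet> (\<chi> j. main n (w n (x j)) \<omega>)) \<partial>P) - of_real (exp (- Q n / 2))) \<longlonglongrightarrow> 0"
  proof (rule Lim_null_comparison[OF _ bound], rule eventually_sequentiallyI)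
    fix n :: nat assume n: "1 \<le> n"
    have "v \<bullet> (\<chi> j. main n (w n (x j)) \<omega>) = main n (u n) \<omega>" for \<omega>
      unfolding u_def using main_sum[OF n, of UNIV "\<lambda>j. v $ j" "\<lambda>j. w n (x j)"] by (simp add: inner_vec_def)
    then show "norm ((\<integral>\<omega>. iexp (v \<bullet> (\<chi> j. main n (w n (x j)) \<omega>)) \<partial>P) - of_real (exp (- Q n / 2)))
        \<le> Q n * (7 * \<delta> n / 6 + 5 / (\<theta> n * m) / 2 + (\<delta> n)\<^sup>2 / 8)"
      using main_char[OF n u\<delta>[OF n]] by (simp only: Q_def)
  qed
  moreover have "(\<lambda>n. complex_of_real (exp (- Q n / 2))) \<longlonglongrightarrow> of_real (exp (- ?V / 2))"
    by (intro tendsto_intros Q) auto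
  ultimately have "(\<lambda>n. (\<integral>\<omega>. iexp (v \<bullet> (\<chi> j. main n (w n (x j)) \<omega>)) \<partial>P) - of_real (exp (- Q n / 2))
      + of_real (exp (- Q n / 2))) \<longlonglongrightarrow> 0 + of_real (exp (- ?V / 2))"
    by (rule tendsto_add)
  then show ?thesis by (simp only: diff_add_cancel add_0)
qed

section \<open>Estimation errors compared with the main term\<close>

definition err_hat :: "nat \<Rightarrow> 'a \<Rightarrow> 'w \<Rightarrow> real" where
  "err_hat n x \<omega> = q n x * (f_hat \<nu> f (k n) (I n) (K n) (N n \<omega>) (X n \<omega>) (Y n \<omega>) x - f x)"

definition err_tilde :: "(nat \<Rightarrow> nat \<Rightarrow> 'a) \<Rightarrow> nat \<Rightarrow> 'a \<Rightarrow> 'w \<Rightarrow> real" where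
  "err_tilde \<xi> n x \<omega> = q n x * (f_tilde \<nu> f (k n) (I n) (\<xi> n) (K n) (N n \<omega>) (X n \<omega>) (Y n \<omega>) x - f x)"

lemma cmax_L1:
  assumes n: "1 \<le> n" and r: "r \<in> {1..k n}"
  shows "integrable P (cmax n r)" "expectation (\<lambda>\<omega>. \<bar>cmax n r \<omega>\<bar>) \<le> \<Delta> n * (3 + 2 * \<theta> n * \<Delta> n) + M"
  using graph_partition.W_mean[OF part[OF n] r] by (simp_all add: W_eq_cmax[OF n r] \<theta>_eq[OF n])

text \<open>Separates the random part treated by \<open>weighted_sum_close\<close> from the
  deterministic bias of a kernel sum over the infima.\<close>

lemma err_hat_eq:
  assumes n: "1 \<le> n"
  shows "err_hat n x \<omega> = (\<Sum>r = 1..k n. w n x r * (\<theta> n * cmax n r \<omega> - \<theta> n * h n r))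
    + q n x * ((\<Sum>r = 1..k n. cint n x r * h n r) - f x)"
proof -
  have "(\<Sum>r = 1..k n. w n x r * (\<theta> n * cmax n r \<omega> - \<theta> n * h n r))
      = (\<Sum>r = 1..k n. q n x * cint n x r * (cmax n r \<omega> - h n r))"
    unfolding w_\<theta>[OF n, symmetric] by (simp add: algebra_simps)
  then show ?thesis
    by (simp add: err_hat_def f_hat_def cint_def[symmetric] cmax_def[symmetric] sum_distrib_left
        sum_subtractf right_diff_distrib mult.assoc)
qed

lemma err_hat_close:
  assumes x: "x \<in> F"
  shows "1 \<le> n \<Longrightarrow> integrable P (err_hat n x)"
    and "(\<lambda>n. expectation (\<lambda>\<omega>. \<bar>err_hat n x \<omega> - main n (w n x) \<omega>\<bar>)) \<longlonglongrightarrow> 0"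
proof -
  define D where "D n \<omega> = (\<Sum>r = 1..k n. w n x r * (\<theta> n * cmax n r \<omega> - \<theta> n * h n r)) - main n (w n x) \<omega>" for n \<omega>
  define d where "d n = q n x * ((\<Sum>r = 1..k n. cint n x r * h n r) - f x)" for n
  \<comment> \<open>The maximum in (K4) dominates the kernel bias as well as the oscillation term,
    so one vanishing sequence controls both.\<close>
  define A where "A n = real n / (sqrt (real (k n)) * norm2 \<nu> (K n x))
      * max (kernel_bias \<nu> f (K n) x) (\<Delta> n * norm1 \<nu> (K n x))" for n
  define Q where "Q n = (\<Sum>r = 1..k n. (w n x r)\<^sup>2)" for n
  have A: "A \<longlonglongrightarrow> 0" unfolding A_def by (rule K4[OF x])
  have Q: "Q \<longlonglongrightarrow> \<sigma> x x" using lim_sum_w[OF x x] by (simp add: Q_def[abs_def] power2_eq_square)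
  have A_eq: "q n x * max (kernel_bias \<nu> f (K n) x) (\<Delta> n * norm1 \<nu> (K n x)) = c * A n" for n
    by (simp add: A_def q_def)
  have D: "integrable P (D n)" "expectation (\<lambda>\<omega>. \<bar>D n \<omega>\<bar>)
      \<le> (c * A n * (3 + 2 * (\<theta> n * \<Delta> n)) + c * M * (real n * exp (- (\<theta> n * m)))) + sqrt (Q n * (10 / (\<theta> n * m)))"
    if n: "1 \<le> n" for n
  proof -
    have "(\<Sum>r = 1..k n. w n x r * (\<theta> n * cmax n r \<omega> - \<theta> n * h n r))
      = (\<Sum>r = 1..k n. w n x r * (\<theta> n * graph_cell.W \<nu> f (N n) (X n) (Y n) (I n r) \<omega> - \<theta> n * h n r))" for \<omega>
      by (intro sum.cong) (auto simp: W_eq_cmax[OF n])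
    then have Deq: "(\<Sum>r = 1..k n. w n x r * (\<theta> n * graph_cell.W \<nu> f (N n) (X n) (Y n) (I n r) \<omega> - \<theta> n * h n r))
        - graph_partition.main_term \<nu> f c n (N n) (X n) (Y n) (k n) (I n) (h n) (w n x) \<omega> = D n \<omega>" for \<omega>
      by (simp only: D_def main_def)
    note close = graph_partition.weighted_sum_close[OF part[OF n], of "w n x", unfolded \<theta>_eq[OF n] Deq, folded Q_def]
    show "integrable P (D n)" by (rule close(1))
    let ?s = "\<Sum>r = 1..k n. \<bar>w n x r\<bar>"
    have s1: "?s \<le> sqrt (real (k n)) * (norm1 \<nu> (K n x) / norm2 \<nu> (K n x))" by (rule sum_abs_w[OF n x])
    have k: "0 < real (k n)" using k_pos[OF n] by simp
    have t: "0 < \<theta> n" "0 \<le> \<Delta> n" using \<theta>_pos[OF n] \<Delta>_nonneg[OF n] by auto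
    have \<theta>_sqrt: "\<theta> n * sqrt (real (k n)) = real n * c / sqrt (real (k n))"
    proof -
      obtain s where "sqrt (real (k n)) = s" "real (k n) = s * s" "0 < s" using k by fastforce
      then show ?thesis unfolding \<theta>_def by (simp only:) (simp add: field_simps)
    qed
    have "\<theta> n * \<Delta> n * ?s \<le> \<theta> n * \<Delta> n * (sqrt (real (k n)) * (norm1 \<nu> (K n x) / norm2 \<nu> (K n x)))"
      using s1 t by (intro mult_left_mono) auto
    also have "\<dots> = q n x * (\<Delta> n * norm1 \<nu> (K n x))"
      using arg_cong[OF \<theta>_sqrt, of "\<lambda>y. y * (\<Delta> n * norm1 \<nu> (K n x) / norm2 \<nu> (K n x))"]
      by (simp add: q_def mult_ac)
    also have "\<dots> \<le> q n x * max (kernel_bias \<nu> f (K n) x) (\<Delta> n * norm1 \<nu> (K n x))"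
      using q_pos[OF n x] by (intro mult_left_mono) auto
    finally have t1: "\<theta> n * \<Delta> n * ?s \<le> c * A n" unfolding A_eq .
    \<comment> \<open>Deliberately crude: the resulting factor n is absorbed by
      \<open>lim_empty_cell\<close>.\<close>
    have "?s \<le> sqrt (real (k n)) * 1"
      using norm1_le[OF n x] norm2_pos[OF n x] by (intro order_trans[OF s1] mult_left_mono) (auto simp: divide_le_eq_1)
    then have "\<theta> n * ?s \<le> \<theta> n * sqrt (real (k n))" using t by (intro mult_left_mono) auto
    also have "\<dots> \<le> real n * c / 1"
      unfolding \<theta>_sqrt using k_pos[OF n] c by (intro divide_left_mono) auto
    finally have t2: "\<theta> n * ?s \<le> real n * c" by simp
    have "(\<theta> n * \<Delta> n * (3 + 2 * \<theta> n * \<Delta> n) + \<theta> n * M * exp (- (\<theta> n * m))) * ?s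
        = \<theta> n * \<Delta> n * ?s * (3 + 2 * (\<theta> n * \<Delta> n)) + \<theta> n * ?s * (M * exp (- (\<theta> n * m)))"
      by (simp add: algebra_simps)
    also have "\<dots> \<le> c * A n * (3 + 2 * (\<theta> n * \<Delta> n)) + real n * c * (M * exp (- (\<theta> n * m)))"
      using t1 t2 t M_pos by (intro add_mono mult_right_mono) auto
    finally show "expectation (\<lambda>\<omega>. \<bar>D n \<omega>\<bar>)
      \<le> (c * A n * (3 + 2 * (\<theta> n * \<Delta> n)) + c * M * (real n * exp (- (\<theta> n * m)))) + sqrt (Q n * (10 / (\<theta> n * m)))"
      using close(2) by (simp add: mult_ac)
  qed
  \<comment> \<open>Cell oscillation plus kernel bias, each at most the maximum in (K4), hence the
    factor 2.\<close>
  have d: "\<bar>d n\<bar> \<le> 2 * (c * A n)" if n: "1 \<le> n" for n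
  proof -
    have i: "integrable \<nu> (K n x)" using norms[OF n x] by (simp add: finite_norms_def)
    have "\<bar>(\<Sum>r = 1..k n. cint n x r * h n r) - f x\<bar>
        \<le> \<Delta> n * norm1 \<nu> (K n x) + kernel_bias \<nu> f (K n) x"
      using graph_partition.cell_sum_close[OF part[OF n] i] unfolding cint_def kernel_bias_def by linarith
    also have "\<dots> \<le> 2 * max (kernel_bias \<nu> f (K n) x) (\<Delta> n * norm1 \<nu> (K n x))" by linarith
    finally have "q n x * \<bar>(\<Sum>r = 1..k n. cint n x r * h n r) - f x\<bar>
        \<le> q n x * (2 * max (kernel_bias \<nu> f (K n) x) (\<Delta> n * norm1 \<nu> (K n x)))"
      using q_pos[OF n x] by (intro mult_left_mono) auto
    then show ?thesis unfolding A_eq[symmetric] d_def abs_mult using q_pos[OF n x] by (simp add: mult_ac)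
  qed
  have eq: "err_hat n x \<omega> = D n \<omega> + main n (w n x) \<omega> + d n" if "1 \<le> n" for n \<omega>
    using err_hat_eq[OF that] by (simp add: D_def d_def)
  show "integrable P (err_hat n x)" if n: "1 \<le> n" for n
  proof -
    have "integrable P (\<lambda>\<omega>. D n \<omega> + main n (w n x) \<omega> + d n)" using D(1)[OF n] main_L1(1)[OF n] by simp
    then show ?thesis by (simp only: eq[OF n, symmetric])
  qed
  have lim: "(\<lambda>n. (c * A n * (3 + 2 * (\<theta> n * \<Delta> n)) + c * M * (real n * exp (- (\<theta> n * m))))
      + sqrt (Q n * (10 / (\<theta> n * m))) + 2 * (c * A n)) \<longlonglongrightarrow> (c * 0 * (3 + 2 * 0) + c * M * 0) + sqrt (\<sigma> x x * 0) + 2 * (c * 0)"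
    by (intro tendsto_add tendsto_mult tendsto_const A Q lim_\<theta>_\<Delta> lim_empty_cell lim_inverse_\<theta>_m tendsto_real_sqrt)
  show "(\<lambda>n. expectation (\<lambda>\<omega>. \<bar>err_hat n x \<omega> - main n (w n x) \<omega>\<bar>)) \<longlonglongrightarrow> 0"
  proof (rule Lim_null_comparison[OF eventually_sequentiallyI])
    show "(\<lambda>n. (c * A n * (3 + 2 * (\<theta> n * \<Delta> n)) + c * M * (real n * exp (- (\<theta> n * m))))
      + sqrt (Q n * (10 / (\<theta> n * m))) + 2 * (c * A n)) \<longlonglongrightarrow> 0"
      using lim by simp
    fix n :: nat assume n: "1 \<le> n"
    have "expectation (\<lambda>\<omega>. \<bar>err_hat n x \<omega> - main n (w n x) \<omega>\<bar>) \<le> expectation (\<lambda>\<omega>. \<bar>D n \<omega>\<bar> + \<bar>d n\<bar>)"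
      unfolding eq[OF n] using D(1)[OF n] by (intro integral_mono) auto
    also have "\<dots> = expectation (\<lambda>\<omega>. \<bar>D n \<omega>\<bar>) + \<bar>d n\<bar>" using D(1)[OF n] by (simp add: prob_space)
    finally have "expectation (\<lambda>\<omega>. \<bar>err_hat n x \<omega> - main n (w n x) \<omega>\<bar>)
        \<le> (c * A n * (3 + 2 * (\<theta> n * \<Delta> n)) + c * M * (real n * exp (- (\<theta> n * m))))
          + sqrt (Q n * (10 / (\<theta> n * m))) + 2 * (c * A n)"
      using D(2)[OF n] d[OF n] by linarith
    moreover have "0 \<le> expectation (\<lambda>\<omega>. \<bar>err_hat n x \<omega> - main n (w n x) \<omega>\<bar>)" by (intro integral_nonneg_AE) auto
    ultimately show "norm (expectation (\<lambda>\<omega>. \<bar>err_hat n x \<omega> - main n (w n x) \<omega>\<bar>))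
        \<le> (c * A n * (3 + 2 * (\<theta> n * \<Delta> n)) + c * M * (real n * exp (- (\<theta> n * m))))
          + sqrt (Q n * (10 / (\<theta> n * m))) + 2 * (c * A n)" by simp
  qed
qed

end

lemma borel_measurable_vec_lambda:
  fixes g :: "'p::finite \<Rightarrow> 'w \<Rightarrow> real"
  assumes "\<And>j. g j \<in> borel_measurable P"
  shows "(\<lambda>\<omega>. \<chi> j. g j \<omega>) \<in> borel_measurable P"
  using assms by (subst borel_measurable_euclidean_space) (auto simp: Basis_vec_def inner_axis)

context estimation
begin

text \<open>The two estimators differ by a weighted sum of corrected maxima. These are bounded in L1
  uniformly over the cells, so the weight differences can be summed in absolute value, which is the
  sum in (K5).\<close>

lemma err_tilde_close:
  assumes x: "x \<in> F"
    and K5: "(\<lambda>n. real n / (sqrt (real (k n)) * norm2 \<nu> (K n x))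
          * (\<Sum>r = 1..k n. \<bar>LINT t:I n r|\<nu>. (K n x t - K n x (\<xi> n r))\<bar>)) \<longlonglongrightarrow> 0"
  shows "1 \<le> n \<Longrightarrow> integrable P (err_tilde \<xi> n x)"
    and "(\<lambda>n. expectation (\<lambda>\<omega>. \<bar>err_tilde \<xi> n x \<omega> - main n (w n x) \<omega>\<bar>)) \<longlonglongrightarrow> 0"
proof -
  define v where "v n r = measure \<nu> (I n r) * K n x (\<xi> n r) - cint n x r" for n r
  define B where "B n = real n / (sqrt (real (k n)) * norm2 \<nu> (K n x))
          * (\<Sum>r = 1..k n. \<bar>LINT t:I n r|\<nu>. (K n x t - K n x (\<xi> n r))\<bar>)" for n
  have B: "B \<longlonglongrightarrow> 0" unfolding B_def by (rule K5)
  have eq: "err_tilde \<xi> n x \<omega> = err_hat n x \<omega> + q n x * (\<Sum>r = 1..k n. v n r * cmax n r \<omega>)" for n \<omega>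
    by (simp add: err_tilde_def err_hat_def f_hat_def f_tilde_def cint_def[symmetric] cmax_def[symmetric] v_def
        left_diff_distrib sum_subtractf algebra_simps)
  have iS: "integrable P (\<lambda>\<omega>. \<Sum>r = 1..k n. v n r * cmax n r \<omega>)" if n: "1 \<le> n" for n
    using cmax_L1(1)[OF n] by (intro Bochner_Integration.integrable_sum integrable_mult_right) auto
  show "integrable P (err_tilde \<xi> n x)" if n: "1 \<le> n" for n
  proof -
    have "integrable P (\<lambda>\<omega>. err_hat n x \<omega> + q n x * (\<Sum>r = 1..k n. v n r * cmax n r \<omega>))"
      using err_hat_close(1)[OF x n] iS[OF n] by simp
    then show ?thesis by (simp only: eq[symmetric])
  qed
  have lim: "(\<lambda>n. expectation (\<lambda>\<omega>. \<bar>err_hat n x \<omega> - main n (w n x) \<omega>\<bar>)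
      + c * B n * (\<Delta> n * (3 + 2 * (\<theta> n * \<Delta> n)) + M)) \<longlonglongrightarrow> 0 + c * 0 * (0 * (3 + 2 * 0) + M)"
    by (intro tendsto_add tendsto_mult tendsto_const err_hat_close(2)[OF x] B lim_\<Delta> lim_\<theta>_\<Delta>)
  show "(\<lambda>n. expectation (\<lambda>\<omega>. \<bar>err_tilde \<xi> n x \<omega> - main n (w n x) \<omega>\<bar>)) \<longlonglongrightarrow> 0"
  proof (rule Lim_null_comparison[OF eventually_sequentiallyI])
    show "(\<lambda>n. expectation (\<lambda>\<omega>. \<bar>err_hat n x \<omega> - main n (w n x) \<omega>\<bar>)
      + c * B n * (\<Delta> n * (3 + 2 * (\<theta> n * \<Delta> n)) + M)) \<longlonglongrightarrow> 0" using lim by simp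
    fix n :: nat assume n: "1 \<le> n"
    let ?S = "\<lambda>\<omega>. \<Sum>r = 1..k n. v n r * cmax n r \<omega>"
    let ?C = "\<Delta> n * (3 + 2 * \<theta> n * \<Delta> n) + M"
    have iK: "integrable \<nu> (K n x)" using norms[OF n x] by (simp add: finite_norms_def)
    have vB: "q n x * (\<Sum>r = 1..k n. \<bar>v n r\<bar>) = c * B n"
    proof -
      have "(\<Sum>r = 1..k n. \<bar>v n r\<bar>) = (\<Sum>r = 1..k n. \<bar>LINT t:I n r|\<nu>. (K n x t - K n x (\<xi> n r))\<bar>)"
      proof (intro sum.cong refl)
        fix r assume r: "r \<in> {1..k n}"
        show "\<bar>v n r\<bar> = \<bar>LINT t:I n r|\<nu>. (K n x t - K n x (\<xi> n r))\<bar>"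
          unfolding cell_partition.cell_integral_minus_value[OF cells[OF n] iK r] v_def cint_def
          by (rule abs_minus_commute)
      qed
      then show ?thesis by (simp add: q_def B_def)
    qed
    have "expectation (\<lambda>\<omega>. \<bar>?S \<omega>\<bar>) \<le> expectation (\<lambda>\<omega>. \<Sum>r = 1..k n. \<bar>v n r\<bar> * \<bar>cmax n r \<omega>\<bar>)"
    proof (rule integral_mono[OF integrable_abs[OF iS[OF n]]])
      show "integrable P (\<lambda>\<omega>. \<Sum>r = 1..k n. \<bar>v n r\<bar> * \<bar>cmax n r \<omega>\<bar>)"
        using cmax_L1(1)[OF n] by (intro Bochner_Integration.integrable_sum integrable_mult_right integrable_abs) auto
      show "\<bar>?S \<omega>\<bar> \<le> (\<Sum>r = 1..k n. \<bar>v n r\<bar> * \<bar>cmax n r \<omega>\<bar>)" for \<omega>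
        by (rule order_trans[OF sum_abs]) (simp add: abs_mult)
    qed
    also have "\<dots> = (\<Sum>r = 1..k n. expectation (\<lambda>\<omega>. \<bar>v n r\<bar> * \<bar>cmax n r \<omega>\<bar>))"
      using cmax_L1(1)[OF n] by (intro Bochner_Integration.integral_sum integrable_mult_right integrable_abs) auto
    also have "\<dots> \<le> (\<Sum>r = 1..k n. \<bar>v n r\<bar> * ?C)"
      using cmax_L1(2)[OF n] by (intro sum_mono) (simp add: mult_left_mono)
    finally have "q n x * expectation (\<lambda>\<omega>. \<bar>?S \<omega>\<bar>) \<le> q n x * ((\<Sum>r = 1..k n. \<bar>v n r\<bar>) * ?C)"
      using q_pos[OF n x] by (intro mult_left_mono) (auto simp: sum_distrib_right)
    also have "\<dots> = c * B n * (\<Delta> n * (3 + 2 * (\<theta> n * \<Delta> n)) + M)"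
      unfolding vB[symmetric] by (simp add: mult_ac)
    finally have S: "q n x * expectation (\<lambda>\<omega>. \<bar>?S \<omega>\<bar>) \<le> c * B n * (\<Delta> n * (3 + 2 * (\<theta> n * \<Delta> n)) + M)" .
    have "expectation (\<lambda>\<omega>. \<bar>err_tilde \<xi> n x \<omega> - main n (w n x) \<omega>\<bar>)
        \<le> expectation (\<lambda>\<omega>. \<bar>err_hat n x \<omega> - main n (w n x) \<omega>\<bar> + q n x * \<bar>?S \<omega>\<bar>)"
    proof (rule integral_mono)
      show "integrable P (\<lambda>\<omega>. \<bar>err_tilde \<xi> n x \<omega> - main n (w n x) \<omega>\<bar>)"
        unfolding eq using err_hat_close(1)[OF x n] iS[OF n] main_L1(1)[OF n] by simp
      show "integrable P (\<lambda>\<omega>. \<bar>err_hat n x \<omega> - main n (w n x) \<omega>\<bar> + q n x * \<bar>?S \<omega>\<bar>)"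
        using err_hat_close(1)[OF x n] iS[OF n] main_L1(1)[OF n]
        by (intro Bochner_Integration.integrable_add integrable_abs Bochner_Integration.integrable_diff integrable_mult_right)
      show "\<bar>err_tilde \<xi> n x \<omega> - main n (w n x) \<omega>\<bar> \<le> \<bar>err_hat n x \<omega> - main n (w n x) \<omega>\<bar> + q n x * \<bar>?S \<omega>\<bar>" for \<omega>
      proof -
        have "\<bar>q n x * ?S \<omega>\<bar> = q n x * \<bar>?S \<omega>\<bar>" using q_pos[OF n x] by (simp add: abs_mult)
        then show ?thesis unfolding eq by linarith
      qed
    qed
    also have "\<dots> = expectation (\<lambda>\<omega>. \<bar>err_hat n x \<omega> - main n (w n x) \<omega>\<bar>) + q n x * expectation (\<lambda>\<omega>. \<bar>?S \<omega>\<bar>)"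
      using err_hat_close(1)[OF x n] iS[OF n] main_L1(1)[OF n]
      by (subst Bochner_Integration.integral_add) (auto intro!: integrable_abs Bochner_Integration.integrable_diff integrable_mult_right)
    finally show "norm (expectation (\<lambda>\<omega>. \<bar>err_tilde \<xi> n x \<omega> - main n (w n x) \<omega>\<bar>))
        \<le> expectation (\<lambda>\<omega>. \<bar>err_hat n x \<omega> - main n (w n x) \<omega>\<bar>) + c * B n * (\<Delta> n * (3 + 2 * (\<theta> n * \<Delta> n)) + M)"
      using S by (simp add: integral_nonneg_AE)
  qed
qed

section \<open>The estimated constant and transfer of the limit law\<close>

definition chat :: "nat \<Rightarrow> 'w \<Rightarrow> real" where
  "chat n \<omega> = c_hat \<nu> f n (k n) (I n) (N n \<omega>) (X n \<omega>) (Y n \<omega>)"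

lemma chat_measurable:
  assumes n: "1 \<le> n" shows "chat n \<in> borel_measurable P"
  unfolding chat_def[abs_def] c_hat_def
  using graph_partition.a_hat_L1(1)[OF part[OF n]] graph_partition.c_hat_L1(2)[OF part[OF n]] by simp

text \<open>The scaled count of \<open>S\<close> and \<open>a_hat\<close> both approach the integral
  of f in L1, and \<open>ratio_close\<close> passes to their quotient even where the denominator is
  small.\<close>

lemma chat_consistent: "(\<lambda>n. expectation (\<lambda>\<omega>. min 1 \<bar>chat n \<omega> / c - 1\<bar>)) \<longlonglongrightarrow> 0"
proof -
  define a where "a = (\<integral>x. f x \<partial>\<nu>)"
  have a: "0 < a" using graph_partition.c_hat_L1(1)[OF part[of 1]] m_pos by (simp add: a_def)
  have "(\<lambda>n. a / c * (1 / real n)) \<longlonglongrightarrow> a / c * 0" by (intro tendsto_mult_left lim_1_over_n)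
  then have "(\<lambda>n. a / (real n * c)) \<longlonglongrightarrow> 0" by (simp add: mult.commute)
  then have lim: "(\<lambda>n. 2 / a * (sqrt (a / (real n * c)) + (\<Delta> n * (4 + 2 * (\<theta> n * \<Delta> n)) + 2 * (1 / \<theta> n))))
      \<longlonglongrightarrow> 2 / a * (sqrt 0 + (0 * (4 + 2 * 0) + 2 * 0))"
    by (intro tendsto_mult tendsto_add tendsto_const tendsto_real_sqrt lim_\<Delta> lim_\<theta>_\<Delta> lim_inverse_\<theta>)
  show ?thesis
  proof (rule Lim_null_comparison[OF eventually_sequentiallyI])
    show "(\<lambda>n. 2 / a * (sqrt (a / (real n * c)) + (\<Delta> n * (4 + 2 * (\<theta> n * \<Delta> n)) + 2 * (1 / \<theta> n)))) \<longlonglongrightarrow> 0"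
      using lim by simp
    fix n :: nat assume n: "1 \<le> n"
    have \<kappa>: "graph_process.\<kappa> c n = real n * c"
      by (rule graph_process.\<kappa>_def[OF graph_partition.axioms(1)[OF part[OF n]]])
    define A where "A \<omega> = measure (N n \<omega>) (subgraph f (space \<nu>)) / (real n * c)" for \<omega>
    define B where "B \<omega> = a_hat \<nu> f (k n) (I n) (N n \<omega>) (X n \<omega>) (Y n \<omega>)" for \<omega>
    have A: "integrable P A" "expectation (\<lambda>\<omega>. \<bar>A \<omega> - a\<bar>) \<le> sqrt (a / (real n * c))"
      using graph_partition.c_hat_L1(2,3)[OF part[OF n]] by (simp_all add: A_def[abs_def] a_def \<kappa>)
    have B: "integrable P B" "expectation (\<lambda>\<omega>. \<bar>B \<omega> - a\<bar>) \<le> \<Delta> n * (4 + 2 * (\<theta> n * \<Delta> n)) + 2 * (1 / \<theta> n)"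
      using graph_partition.a_hat_L1[OF part[OF n]] by (simp_all add: B_def[abs_def] a_def \<theta>_eq[OF n] mult.assoc)
    have eq: "chat n \<omega> / c = A \<omega> / B \<omega>" for \<omega> by (simp add: chat_def c_hat_def A_def B_def)
    have "expectation (\<lambda>\<omega>. min 1 \<bar>chat n \<omega> / c - 1\<bar>) \<le> expectation (\<lambda>\<omega>. 2 / a * (\<bar>A \<omega> - a\<bar> + \<bar>B \<omega> - a\<bar>))"
    proof (rule integral_mono)
      show "integrable P (\<lambda>\<omega>. min 1 \<bar>chat n \<omega> / c - 1\<bar>)"
        using chat_measurable[OF n] by (intro integrable_min_abs) simp
      show "integrable P (\<lambda>\<omega>. 2 / a * (\<bar>A \<omega> - a\<bar> + \<bar>B \<omega> - a\<bar>))" using A(1) B(1) by simp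
      show "min 1 \<bar>chat n \<omega> / c - 1\<bar> \<le> 2 / a * (\<bar>A \<omega> - a\<bar> + \<bar>B \<omega> - a\<bar>)" for \<omega>
        unfolding eq by (rule ratio_close[OF a])
    qed
    also have "\<dots> = 2 / a * (expectation (\<lambda>\<omega>. \<bar>A \<omega> - a\<bar>) + expectation (\<lambda>\<omega>. \<bar>B \<omega> - a\<bar>))"
      using A(1) B(1) by simp
    also have "\<dots> \<le> 2 / a * (sqrt (a / (real n * c)) + (\<Delta> n * (4 + 2 * (\<theta> n * \<Delta> n)) + 2 * (1 / \<theta> n)))"
      using A(2) B(2) a by (intro mult_left_mono add_mono) auto
    finally show "norm (expectation (\<lambda>\<omega>. min 1 \<bar>chat n \<omega> / c - 1\<bar>))
        \<le> 2 / a * (sqrt (a / (real n * c)) + (\<Delta> n * (4 + 2 * (\<theta> n * \<Delta> n)) + 2 * (1 / \<theta> n)))"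
      by (simp add: integral_nonneg_AE)
  qed
qed

text \<open>\<open>R\<close> stands for either estimation error. Estimating c multiplies it by a
  ratio that tends to 1 in probability, and boundedness of the error in L1 makes the change
  negligible.\<close>

theorem converges_of_close:
  fixes x :: "'p::finite \<Rightarrow> 'a" and R :: "nat \<Rightarrow> 'a \<Rightarrow> 'w \<Rightarrow> real"
  assumes x: "range x \<subseteq> F"
    and R: "\<And>n x. 1 \<le> n \<Longrightarrow> x \<in> F \<Longrightarrow> integrable P (R n x)"
    and close: "\<And>x. x \<in> F \<Longrightarrow> (\<lambda>n. expectation (\<lambda>\<omega>. \<bar>R n x \<omega> - main n (w n x) \<omega>\<bar>)) \<longlonglongrightarrow> 0"
  shows "converges_to_gaussian P (\<lambda>n \<omega>. \<chi> j. R n (x j) \<omega>) (\<chi> i j. \<sigma> (x i) (x j))"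
    and "converges_to_gaussian P (\<lambda>n \<omega>. \<chi> j. chat n \<omega> / c * R n (x j) \<omega>) (\<chi> i j. \<sigma> (x i) (x j))"
proof -
  let ?C = "(\<chi> i j. \<sigma> (x i) (x j)) :: real ^ 'p ^ 'p"
  have xF: "x j \<in> F" for j using x by auto
  have sym: "?C $ i $ j = ?C $ j $ i" for i j using \<sigma>_sym[OF xF xF] by simp
  note psd = psd[OF x] and char = main_char_lim[OF x]
  have L: "(\<lambda>\<omega>. \<chi> j. main n (w n (x j)) \<omega>) \<in> borel_measurable P" if "1 \<le> n" for n
    using main_L1(1)[OF that] by (intro borel_measurable_vec_lambda) simp
  have iD: "integrable P (\<lambda>\<omega>. R n (x j) \<omega> - main n (w n (x j)) \<omega>)" if "1 \<le> n" for n j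
    using R[OF that xF] main_L1(1)[OF that] by simp
  have small: "(\<lambda>n. expectation (\<lambda>\<omega>. min 1 \<bar>R n (x j) \<omega> - main n (w n (x j)) \<omega>\<bar>)) \<longlonglongrightarrow> 0" for j
  proof (rule Lim_null_comparison[OF eventually_sequentiallyI close[OF xF[of j]]])
    fix n :: nat assume "1 \<le> n"
    from min_abs_mean_le[OF iD[OF this]]
    show "norm (expectation (\<lambda>\<omega>. min 1 \<bar>R n (x j) \<omega> - main n (w n (x j)) \<omega>\<bar>))
        \<le> expectation (\<lambda>\<omega>. \<bar>R n (x j) \<omega> - main n (w n (x j)) \<omega>\<bar>)" by (simp add: integral_nonneg_AE)
  qed
  show "converges_to_gaussian P (\<lambda>n \<omega>. \<chi> j. R n (x j) \<omega>) ?C"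
  proof (rule converges_to_gaussianI[OF prob_space_axioms _ L sym psd char])
    show "(\<lambda>\<omega>. \<chi> j. R n (x j) \<omega>) \<in> borel_measurable P" if "1 \<le> n" for n
      using R[OF that xF] by (intro borel_measurable_vec_lambda) simp
  qed (use small in simp_all)
  have vanish: "(\<lambda>n. expectation (\<lambda>\<omega>. min 1 \<bar>(chat n \<omega> / c - 1) * R n (x j) \<omega>\<bar>)) \<longlonglongrightarrow> 0" for j
  proof -
    \<comment> \<open>Bounds the mean absolute main term; its convergence makes the errors bounded
      in L1 from some index on.\<close>
    define T where "T n = sqrt ((\<Sum>r = 1..k n. (w n (x j) r)\<^sup>2) * (1 + 5 / (\<theta> n * m)))" for n
    have "T \<longlonglongrightarrow> sqrt (\<sigma> (x j) (x j) * (1 + 0))"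
      unfolding T_def power2_eq_square
      by (intro tendsto_real_sqrt tendsto_mult tendsto_add tendsto_const lim_sum_w[OF xF xF] lim_inverse_\<theta>_m)
    from tendsto_add[OF close[OF xF[of j]] this]
    have "(\<lambda>n. expectation (\<lambda>\<omega>. \<bar>R n (x j) \<omega> - main n (w n (x j)) \<omega>\<bar>) + T n) \<longlonglongrightarrow> sqrt (\<sigma> (x j) (x j))" by simp
    then have "\<forall>\<^sub>F n in sequentially. expectation (\<lambda>\<omega>. \<bar>R n (x j) \<omega> - main n (w n (x j)) \<omega>\<bar>) + T n < sqrt (\<sigma> (x j) (x j)) + 1"
      by (rule order_tendstoD(2)) simp
    then have "\<forall>\<^sub>F n in sequentially. expectation (\<lambda>\<omega>. \<bar>R n (x j) \<omega>\<bar>) \<le> sqrt (\<sigma> (x j) (x j)) + 1"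
      using eventually_ge_at_top[of 1]
    proof eventually_elim
      case (elim n)
      have "expectation (\<lambda>\<omega>. \<bar>R n (x j) \<omega>\<bar>)
          \<le> expectation (\<lambda>\<omega>. \<bar>R n (x j) \<omega> - main n (w n (x j)) \<omega>\<bar> + \<bar>main n (w n (x j)) \<omega>\<bar>)"
        using R[OF elim(2) xF] main_L1(1)[OF elim(2)] iD[OF elim(2)] by (intro integral_mono) auto
      also have "\<dots> = expectation (\<lambda>\<omega>. \<bar>R n (x j) \<omega> - main n (w n (x j)) \<omega>\<bar>) + expectation (\<lambda>\<omega>. \<bar>main n (w n (x j)) \<omega>\<bar>)"
        using main_L1(1)[OF elim(2)] iD[OF elim(2)] by (intro Bochner_Integration.integral_add) auto
      finally show ?case using elim(1) main_L1(2)[OF elim(2), of "w n (x j)"] by (simp add: T_def)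
    qed
    \<comment> \<open>Shifted by one because \<open>mult_vanishes\<close> asks for measurability and
      integrability at every index.\<close>
    then have "\<forall>\<^sub>F n in sequentially. expectation (\<lambda>\<omega>. \<bar>R (Suc n) (x j) \<omega>\<bar>) \<le> sqrt (\<sigma> (x j) (x j)) + 1"
      by (subst eventually_sequentially_Suc[of "\<lambda>n. expectation (\<lambda>\<omega>. \<bar>R n (x j) \<omega>\<bar>) \<le> sqrt (\<sigma> (x j) (x j)) + 1"])
    then have "(\<lambda>n. expectation (\<lambda>\<omega>. min 1 \<bar>(chat (Suc n) \<omega> / c - 1) * R (Suc n) (x j) \<omega>\<bar>)) \<longlonglongrightarrow> 0"
      using chat_measurable R[OF _ xF] LIMSEQ_Suc[OF chat_consistent]
      by (intro mult_vanishes[where B = "sqrt (\<sigma> (x j) (x j)) + 1"]) auto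
    then show ?thesis by (rule LIMSEQ_imp_Suc)
  qed
  show "converges_to_gaussian P (\<lambda>n \<omega>. \<chi> j. chat n \<omega> / c * R n (x j) \<omega>) ?C"
  proof (rule converges_to_gaussianI[OF prob_space_axioms _ L sym psd char])
    show m: "(\<lambda>\<omega>. \<chi> j. chat n \<omega> / c * R n (x j) \<omega>) \<in> borel_measurable P" if "1 \<le> n" for n
      using R[OF that xF] chat_measurable[OF that] by (intro borel_measurable_vec_lambda) simp
    fix j
    let ?Z = "\<lambda>n \<omega>. chat n \<omega> / c * R n (x j) \<omega>" and ?L = "\<lambda>n. main n (w n (x j))"
    have "(\<lambda>n. expectation (\<lambda>\<omega>. min 1 \<bar>?Z n \<omega> - ?L n \<omega>\<bar>)) \<longlonglongrightarrow> 0"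
    proof (rule Lim_null_comparison[OF eventually_sequentiallyI])
      show "(\<lambda>n. expectation (\<lambda>\<omega>. min 1 \<bar>(chat n \<omega> / c - 1) * R n (x j) \<omega>\<bar>)
          + expectation (\<lambda>\<omega>. min 1 \<bar>R n (x j) \<omega> - ?L n \<omega>\<bar>)) \<longlonglongrightarrow> 0"
        using tendsto_add[OF vanish[of j] small[of j]] by simp
      fix n :: nat assume n: "1 \<le> n"
      note [measurable] = chat_measurable[OF n] borel_measurable_integrable[OF R[OF n xF]]
        borel_measurable_integrable[OF main_L1(1)[OF n]]
      have i: "integrable P (\<lambda>\<omega>. min 1 \<bar>?Z n \<omega> - ?L n \<omega>\<bar>)"
        "integrable P (\<lambda>\<omega>. min 1 \<bar>(chat n \<omega> / c - 1) * R n (x j) \<omega>\<bar>)"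
        "integrable P (\<lambda>\<omega>. min 1 \<bar>R n (x j) \<omega> - ?L n \<omega>\<bar>)"
        by (intro integrable_min_abs; measurable)+
      have "expectation (\<lambda>\<omega>. min 1 \<bar>?Z n \<omega> - ?L n \<omega>\<bar>)
          \<le> expectation (\<lambda>\<omega>. min 1 \<bar>(chat n \<omega> / c - 1) * R n (x j) \<omega>\<bar> + min 1 \<bar>R n (x j) \<omega> - ?L n \<omega>\<bar>)"
      proof (rule integral_mono[OF i(1) Bochner_Integration.integrable_add[OF i(2,3)]])
        fix \<omega>
        have "?Z n \<omega> - ?L n \<omega> = (chat n \<omega> / c - 1) * R n (x j) \<omega> + (R n (x j) \<omega> - ?L n \<omega>)"
          by (simp add: left_diff_distrib)
        moreover have "min 1 \<bar>s + t\<bar> \<le> min 1 \<bar>s\<bar> + min 1 \<bar>t\<bar>" for s t :: real by (auto simp: min_def)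
        ultimately show "min 1 \<bar>?Z n \<omega> - ?L n \<omega>\<bar>
            \<le> min 1 \<bar>(chat n \<omega> / c - 1) * R n (x j) \<omega>\<bar> + min 1 \<bar>R n (x j) \<omega> - ?L n \<omega>\<bar>" by simp
      qed
      then show "norm (expectation (\<lambda>\<omega>. min 1 \<bar>?Z n \<omega> - ?L n \<omega>\<bar>))
          \<le> expectation (\<lambda>\<omega>. min 1 \<bar>(chat n \<omega> / c - 1) * R n (x j) \<omega>\<bar>)
            + expectation (\<lambda>\<omega>. min 1 \<bar>R n (x j) \<omega> - ?L n \<omega>\<bar>)"
        using i(2,3) by (simp add: integral_nonneg_AE)
    qed
    then show "(\<lambda>n. expectation (\<lambda>\<omega>. min 1 \<bar>(\<chi> j. chat n \<omega> / c * R n (x j) \<omega>) $ j - (\<chi> j. main n (w n (x j)) \<omega>) $ j\<bar>)) \<longlonglongrightarrow> 0"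
      by simp
  qed
qed

end

section \<open>Specialisation to the two estimators, with known and with estimated constant\<close>

theorem theorem2:
  fixes \<nu> :: "'a measure"
    and f :: "'a \<Rightarrow> real"
    and c :: real
    and P :: "'w measure"
    and N :: "nat \<Rightarrow> 'w \<Rightarrow> ('a \<times> real) measure"
    and X :: "nat \<Rightarrow> 'w \<Rightarrow> nat \<Rightarrow> 'a"
    and Y :: "nat \<Rightarrow> 'w \<Rightarrow> nat \<Rightarrow> real"
    and k :: "nat \<Rightarrow> nat"
    and I :: "nat \<Rightarrow> nat \<Rightarrow> 'a set"
    and \<xi> :: "nat \<Rightarrow> nat \<Rightarrow> 'a"
    and K :: "nat \<Rightarrow> 'a \<Rightarrow> 'a \<Rightarrow> real"
    and F :: "'a set"
    and \<sigma> :: "'a \<Rightarrow> 'a \<Rightarrow> real"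
  defines "S \<equiv> subgraph f (space \<nu>)"
    and "\<Delta> \<equiv> \<lambda>n. max_osc \<nu> f (k n) (I n)"
    and "\<Gamma> \<equiv> \<lambda>n. kernel_osc (k n) (I n) (K n)"
    and "\<Psi> \<equiv> \<lambda>n. kernel_bias \<nu> f (K n)"
    and "fh \<equiv> \<lambda>n \<omega>. f_hat \<nu> f (k n) (I n) (K n) (N n \<omega>) (X n \<omega>) (Y n \<omega>)"
    and "ft \<equiv> \<lambda>n \<omega>. f_tilde \<nu> f (k n) (I n) (\<xi> n) (K n) (N n \<omega>) (X n \<omega>) (Y n \<omega>)"
    and "ch \<equiv> \<lambda>n \<omega>. c_hat \<nu> f n (k n) (I n) (N n \<omega>) (X n \<omega>) (Y n \<omega>)"
  assumes "prob_space \<nu>"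
    and "f \<in> borel_measurable \<nu>" and "\<And>x. x \<in> space \<nu> \<Longrightarrow> 0 \<le> f x"
    and "0 < c"
    and "prob_space P"
    and "\<And>n. 1 \<le> n \<Longrightarrow> poisson_point_process P (intensity \<nu> f c n) (N n)"
    and "\<And>n \<omega>. 1 \<le> n \<Longrightarrow> \<omega> \<in> space P \<Longrightarrow> has_points (N n \<omega>) S (X n \<omega>) (Y n \<omega>)"
    and "\<And>n. 1 \<le> n \<Longrightarrow> 1 \<le> k n"
    and "\<And>n r. 1 \<le> n \<Longrightarrow> r \<in> {1..k n} \<Longrightarrow> I n r \<in> sets \<nu>"
    and "\<And>n. 1 \<le> n \<Longrightarrow> disjoint_family_on (I n) {1..k n}"
    and "\<And>n. 1 \<le> n \<Longrightarrow> (\<Union>r\<in>{1..k n}. I n r) = space \<nu>"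
    and "\<And>n r. 1 \<le> n \<Longrightarrow> r \<in> {1..k n} \<Longrightarrow> measure \<nu> (I n r) = 1 / real (k n)"
    and "\<And>n r. 1 \<le> n \<Longrightarrow> r \<in> {1..k n} \<Longrightarrow> \<xi> n r \<in> I n r"
    and "\<And>n. 1 \<le> n \<Longrightarrow> (\<lambda>(x, t). K n x t) \<in> borel_measurable (\<nu> \<Otimes>\<^sub>M \<nu>)"
    and "F \<subseteq> space \<nu>"
    and "\<And>n x. 1 \<le> n \<Longrightarrow> x \<in> F \<Longrightarrow> finite_norms \<nu> (K n x)"
    and "\<And>n x. 1 \<le> n \<Longrightarrow> x \<in> F \<Longrightarrow> 0 < norm2 \<nu> (K n x)"
    and cond_1: "mono_on {1..} k" "filterlim k at_top sequentially"
      "(\<lambda>n. real (k n) * ln (real n) / real n) \<longlonglongrightarrow> 0"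
    and cond_2: "0 < ess_lower \<nu> f (space \<nu>)"
      "ess_lower \<nu> f (space \<nu>) \<le> ess_upper \<nu> f (space \<nu>)"
      "ess_upper \<nu> f (space \<nu>) < \<infinity>"
      "(\<lambda>n. real n / real (k n) * \<Delta> n) \<longlonglongrightarrow> 0"
    and cond_K0: "\<And>n. 1 \<le> n \<Longrightarrow> (\<integral>\<^sup>+(x, t). ennreal \<bar>K n x t\<bar> \<partial>(\<nu> \<Otimes>\<^sub>M \<nu>)) < \<infinity>"
    and cond_K1: "\<And>x1 x2. x1 \<in> F \<Longrightarrow> x2 \<in> F \<Longrightarrow>
      (\<lambda>n. \<Gamma> n x1 * norm1 \<nu> (K n x2)) \<in> o(\<lambda>n. norm2 \<nu> (K n x1) * norm2 \<nu> (K n x2))"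
    and cond_K2: "\<And>x1 x2. x1 \<in> F \<Longrightarrow> x2 \<in> F \<Longrightarrow>
      (\<lambda>n. inner2 \<nu> (K n x1) (K n x2) / (norm2 \<nu> (K n x1) * norm2 \<nu> (K n x2))) \<longlonglongrightarrow> \<sigma> x1 x2"
    and cond_K3: "\<And>x. x \<in> F \<Longrightarrow>
      (\<lambda>n. norm_sup \<nu> (K n x) / (sqrt (real (k n)) * norm2 \<nu> (K n x))) \<longlonglongrightarrow> 0"
    and cond_K4: "\<And>x. x \<in> F \<Longrightarrow>
      (\<lambda>n. real n / (sqrt (real (k n)) * norm2 \<nu> (K n x))
             * max (\<Psi> n x) (\<Delta> n * norm1 \<nu> (K n x))) \<longlonglongrightarrow> 0"
  shows
    "(\<forall>x :: 'p::finite \<Rightarrow> 'a. range x \<subseteq> F \<longrightarrow>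
        converges_to_gaussian P
          (\<lambda>n \<omega>. \<chi> j. real n * c / (sqrt (real (k n)) * norm2 \<nu> (K n (x j))) * (fh n \<omega> (x j) - f (x j)))
          (\<chi> i j. \<sigma> (x i) (x j))
      \<and> converges_to_gaussian P
          (\<lambda>n \<omega>. \<chi> j. real n * ch n \<omega> / (sqrt (real (k n)) * norm2 \<nu> (K n (x j))) * (fh n \<omega> (x j) - f (x j)))
          (\<chi> i j. \<sigma> (x i) (x j)))
     \<and>
     ((\<forall>x\<in>F. (\<lambda>n. real n / (sqrt (real (k n)) * norm2 \<nu> (K n x))
          * (\<Sum>r = 1..k n. \<bar>LINT t:I n r|\<nu>. (K n x t - K n x (\<xi> n r))\<bar>)) \<longlonglongrightarrow> 0)
      \<longrightarrow>
      (\<forall>x :: 'p \<Rightarrow> 'a. range x \<subseteq> F \<longrightarrow>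
        converges_to_gaussian P
          (\<lambda>n \<omega>. \<chi> j. real n * c / (sqrt (real (k n)) * norm2 \<nu> (K n (x j))) * (ft n \<omega> (x j) - f (x j)))
          (\<chi> i j. \<sigma> (x i) (x j))
      \<and> converges_to_gaussian P
          (\<lambda>n \<omega>. \<chi> j. real n * ch n \<omega> / (sqrt (real (k n)) * norm2 \<nu> (K n (x j))) * (ft n \<omega> (x j) - f (x j)))
          (\<chi> i j. \<sigma> (x i) (x j))))"
proof -
  have "estimation \<nu> P f c N X Y k I K F \<sigma>"
  proof (intro estimation.intro estimation_axioms.intro)
    show "cell_partition \<nu> (k n) (I n)" if "1 \<le> n" for n
      using assms that by (intro cell_partition.intro cell_partition_axioms.intro) auto
  qed (use assms in \<open>simp_all add: S_def \<Delta>_def \<Gamma>_def \<Psi>_def\<close>)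
  then interpret estimation \<nu> P f c N X Y k I K F \<sigma> .
  have plain: "(\<lambda>n \<omega>. \<chi> j. real n * c / (sqrt (real (k n)) * norm2 \<nu> (K n (x j))) * (fh n \<omega> (x j) - f (x j)))
        = (\<lambda>n \<omega>. \<chi> j. err_hat n (x j) \<omega>)"
      "(\<lambda>n \<omega>. \<chi> j. real n * c / (sqrt (real (k n)) * norm2 \<nu> (K n (x j))) * (ft n \<omega> (x j) - f (x j)))
        = (\<lambda>n \<omega>. \<chi> j. err_tilde \<xi> n (x j) \<omega>)"
    for x :: "'p \<Rightarrow> 'a"
    by (simp_all add: err_hat_def err_tilde_def q_def fh_def ft_def)
  \<comment> \<open>Replacing c by its estimate multiplies the error normalised with c by the ratio
    of the two.\<close>
  have rescale: "a * y / d * z = y / c * (a * c / d * z)" for a y d z :: real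
    using \<open>0 < c\<close> by simp
  have estimated:
      "(\<lambda>n \<omega>. \<chi> j. real n * ch n \<omega> / (sqrt (real (k n)) * norm2 \<nu> (K n (x j))) * (fh n \<omega> (x j) - f (x j)))
        = (\<lambda>n \<omega>. \<chi> j. chat n \<omega> / c * err_hat n (x j) \<omega>)"
      "(\<lambda>n \<omega>. \<chi> j. real n * ch n \<omega> / (sqrt (real (k n)) * norm2 \<nu> (K n (x j))) * (ft n \<omega> (x j) - f (x j)))
        = (\<lambda>n \<omega>. \<chi> j. chat n \<omega> / c * err_tilde \<xi> n (x j) \<omega>)"
    for x :: "'p \<Rightarrow> 'a"
    unfolding err_hat_def err_tilde_def q_def chat_def fh_def ft_def ch_def
    by (intro ext, subst vec_eq_iff, simp only: vec_lambda_beta, intro allI, rule rescale)+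
  show ?thesis
    unfolding plain estimated
  proof (intro conjI impI allI)
    fix x :: "'p \<Rightarrow> 'a" assume x: "range x \<subseteq> F"
    note conv = converges_of_close[OF x err_hat_close]
    show "converges_to_gaussian P (\<lambda>n \<omega>. \<chi> j. err_hat n (x j) \<omega>) (\<chi> i j. \<sigma> (x i) (x j))"
      by (rule conv(1))
    show "converges_to_gaussian P (\<lambda>n \<omega>. \<chi> j. chat n \<omega> / c * err_hat n (x j) \<omega>) (\<chi> i j. \<sigma> (x i) (x j))"
      by (rule conv(2))
  next
    fix x :: "'p \<Rightarrow> 'a" assume K5: "\<forall>x\<in>F. (\<lambda>n. real n / (sqrt (real (k n)) * norm2 \<nu> (K n x))
          * (\<Sum>r = 1..k n. \<bar>LINT t:I n r|\<nu>. (K n x t - K n x (\<xi> n r))\<bar>)) \<longlonglongrightarrow> 0" and x: "range x \<subseteq> F"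
    note conv = converges_of_close[OF x err_tilde_close[OF _ K5[rule_format]]]
    show "converges_to_gaussian P (\<lambda>n \<omega>. \<chi> j. err_tilde \<xi> n (x j) \<omega>) (\<chi> i j. \<sigma> (x i) (x j))"
      by (rule conv(1))
    show "converges_to_gaussian P (\<lambda>n \<omega>. \<chi> j. chat n \<omega> / c * err_tilde \<xi> n (x j) \<omega>) (\<chi> i j. \<sigma> (x i) (x j))"
      by (rule conv(2))
  qed
qed

end
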